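(* Let $\mathbf{k}$ be a field, $R=\mathbf{k}[x,y,z]$, and let $L$ be a lex-segment ideal of codimension $3$ in $R$. Let $\mathfrak{a}=L:(x)$ and suppose $\mathfrak{a}\neq R$. Write the Boij-Söderberg decomposition of $\mathfrak{a}$ as $$\beta(\mathfrak{a})=\sum_{i=0}^{t}\alpha_i\,\pi_{\mathbf{d}^i}+R_{\mathfrak{a}},$$ where $\mathbf{d}^0<\mathbf{d}^1<\dots<\mathbf{d}^t$ are all the top degree sequences of length $3$ occurring in the decomposition, $\mathbf{d}^i=(d^i_0,d^i_1,d^i_2)$ for $i=0,1,\dots,t$, and $R_{\mathfrak{a}}$ is the remaining part of the decomposition, a linear combination of pure diagrams greater than $\pi_{\mathbf{d}^t}$. Then the Boij-Söderberg decomposition of $L$ has the form $$\beta(L)=\sum_{i=0}^{t}\tilde{\alpha}_i\,\pi_{\bar{\mathbf{d}}^i}+R_L,$$ where $\bar{\mathbf{d}}^i=(d^i_0+1,d^i_1+1,d^i_2+1)$ for $i=0,1,\dots,t$, $\tilde{\alpha}_i=\alpha_i$ for $i=0,1,\dots,t-1$, $\tilde{\alpha}_t\ge\alpha_t$, and $R_L$ is a linear combination of pure diagrams greater than $\pi_{\bar{\mathbf{d}}^t}$.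
   Context: Lex-segment ideals. Variables of $R$ have degree one and are ordered $x>y>z$. For monomials, $m>_{glex}n$ means that $\deg m>\deg n$, or $\deg m=\deg n$ and the first nonzero difference (exponent in $m$ minus exponent in $n$), taken in the order of the variables, is positive. For a monomial ideal $I$, $G(I)$ is its set of minimal monomial generators. A monomial ideal $L$ is a lex-segment ideal if for every monomial $m\in R$: whenever there is $m_i\in G(L)$ with $\deg m=\deg m_i$ and $m>_{glex}m_i$, then $m\in L$. If $L$ is lex-segment, so is $L:(x)$. Betti diagrams. For a finitely generated graded $R$-module $M$, $\beta_{i,j}(M)$ is the number of summands $R(-j)$ in homological degree $i$ of its minimal graded free resolution, and $\beta(M)=(\beta_{i,j}(M))$ is its Betti diagram. For an ideal $I$, $\beta(I)$ is the Betti diagram of $I$ itself as a module (not of $R/I$). Degree sequences and pure diagrams. A degree sequence of length $p+1$ is $\mathbf{d}=(d_0<d_1<\dots<d_p)$, with $d_i$ nonnegative integers. Its pure diagram $\pi_{\mathbf{d}}$ has entry $\lambda/P_i$ at position $(i,d_i)$, $0\le i\le p$, and all other entries zero, where $P_i=\prod_{r\ne i}|d_i-d_r|$ (empty product $=1$) and $\lambda=\mathrm{lcm}(P_0,\dots,P_p)$. Degree sequences are partially ordered componentwise, a shorter sequence being extended by entries $\infty$; $\mathbf{d}<\mathbf{d}'$ means $\mathbf d\neq \mathbf d'$ and $d_i\le d'_i$ for all $i$. Pure diagrams are ordered accordingly: $\pi_{\mathbf{d}}<\pi_{\mathbf{d}'}$ iff $\mathbf{d}<\mathbf{d}'$. Boij-Söderberg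 decomposition. For a nonzero diagram $D$, let $p$ be the largest $i$ such that column $i$ of $D$ is nonzero; the top degree sequence of $D$ is $(d_0,\dots,d_p)$ with $d_i=\min\{j: D_{i,j}\ne0\}$. Starting with $D=\beta(M)$, one repeatedly takes the top degree sequence $\mathbf{d}$ of the current diagram $D$, sets $\alpha=\min_i D_{i,d_i}/(\pi_{\mathbf{d}})_{i,d_i}$, and replaces $D$ by $D-\alpha\pi_{\mathbf{d}}$, until $D=0$. This yields $\beta(M)=\sum_s\alpha_s\pi_{\mathbf{d}^s}$ with positive rational coefficients and $\mathbf{d}^0<\mathbf{d}^1<\cdots$; this is the Boij-Söderberg decomposition of $M$, and the $\mathbf{d}^s$ are its (top) degree sequences. *)

theory Defs
  imports
    "HOL-Library.Poly_Mapping"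
    "HOL-Library.Product_Plus"
    "HOL-Library.Extended_Nat"
    "Jordan_Normal_Form.Matrix_Kernel"
begin

section \<open>The polynomial ring in three variables and its ideals\<close>

text \<open>
  The triple \<open>(a, b, c)\<close> stands for the monomial \<open>x^a y^b z^c\<close>, and \<open>k[x,y,z]\<close> is the monoid
  algebra of the additive monoid of such triples.
\<close>

type_synonym mono3 = "nat \<times> nat \<times> nat"

type_synonym 'k poly3 = "mono3 \<Rightarrow>\<^sub>0 'k"

definition mon :: "mono3 \<Rightarrow> 'k::field poly3" where
  "mon m = Poly_Mapping.single m 1"

definition var_x :: "'k::field poly3" where "var_x = mon (1, 0, 0)"
definition var_y :: "'k::field poly3" where "var_y = mon (0, 1, 0)"
definition var_z :: "'k::field poly3" where "var_z = mon (0, 0, 1)"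

fun mdeg :: "mono3 \<Rightarrow> nat" where
  "mdeg (a, b, c) = a + b + c"

text \<open>Ideals are the submodules of the ring regarded as a module over itself.\<close>

lemma module_self: "Modules.module ((*) :: 'a::comm_ring_1 \<Rightarrow> 'a \<Rightarrow> 'a)"
  by unfold_locales (simp_all add: algebra_simps)

abbreviation is_ideal :: "'a::comm_ring_1 set \<Rightarrow> bool" where
  "is_ideal \<equiv> Modules.module.subspace (*)"

abbreviation ideal_gen :: "'a::comm_ring_1 set \<Rightarrow> 'a set" where
  "ideal_gen \<equiv> Modules.module.span (*)"

definition colon_ideal :: "'a::comm_ring_1 set \<Rightarrow> 'a set \<Rightarrow> 'a set" where
  "colon_ideal I J = {r. \<forall>s\<in>J. r * s \<in> I}"

definition is_prime_ideal :: "'a::comm_ring_1 set \<Rightarrow> bool" where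
  "is_prime_ideal P \<longleftrightarrow> is_ideal P \<and> P \<noteq> UNIV \<and> (\<forall>a b. a * b \<in> P \<longrightarrow> a \<in> P \<or> b \<in> P)"

definition prime_height :: "'a::comm_ring_1 set \<Rightarrow> enat" where
  "prime_height P = Sup {enat n | n. \<exists>Q :: nat \<Rightarrow> 'a set.
     (\<forall>i\<le>n. is_prime_ideal (Q i)) \<and> (\<forall>i<n. Q i \<subset> Q (Suc i)) \<and> Q n = P}"

text \<open>The unit ideal gets codimension \<open>\<infinity>\<close>.\<close>

definition codim :: "'a::comm_ring_1 set \<Rightarrow> enat" where
  "codim I = Inf (prime_height ` {P. is_prime_ideal P \<and> I \<subseteq> P})"

section \<open>Lex-segment ideals\<close>

fun glex_greater :: "mono3 \<Rightarrow> mono3 \<Rightarrow> bool" where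
  "glex_greater (a, b, c) (a', b', c') \<longleftrightarrow>
     mdeg (a, b, c) > mdeg (a', b', c') \<or>
     mdeg (a, b, c) = mdeg (a', b', c') \<and>
       (a > a' \<or> a = a' \<and> (b > b' \<or> b = b' \<and> c > c'))"

definition monomial_ideal :: "'k::field poly3 set \<Rightarrow> bool" where
  "monomial_ideal I \<longleftrightarrow> (\<exists>S. I = ideal_gen (mon ` S))"

text \<open>
  The minimal monomial generators: the monomials of the ideal having no proper divisor in it.
\<close>

definition min_gens :: "'k::field poly3 set \<Rightarrow> mono3 set" where
  "min_gens I = {m. mon m \<in> I \<and>
     (\<forall>n. mon n \<in> I \<and> (mon n :: 'k poly3) dvd mon m \<longrightarrow> n = m)}"

definition lex_segment_ideal :: "'k::field poly3 set \<Rightarrow> bool" where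
  "lex_segment_ideal L \<longleftrightarrow> monomial_ideal L \<and>
     (\<forall>m. (\<exists>n\<in>min_gens L. mdeg m = mdeg n \<and> glex_greater m n) \<longrightarrow> mon m \<in> L)"

section \<open>Minimal graded free resolutions and Betti diagrams\<close>

text \<open>
  A list \<open>e\<close> of natural numbers represents the graded free module that is the direct sum of the
  \<open>R(-j)\<close>, \<open>j\<close> running through \<open>e\<close>. A matrix represents a homogeneous map of degree \<open>0\<close> from the
  module of \<open>e\<close> to that of \<open>d\<close> iff its entry in row \<open>r\<close> and column \<open>c\<close> is homogeneous of degree
  \<open>e ! c - d ! r\<close> (zero, if this is negative).
\<close>

definition graded_map :: "nat list \<Rightarrow> nat list \<Rightarrow> 'k::field poly3 mat \<Rightarrow> bool" where
  "graded_map e d A \<longleftrightarrow> A \<in> carrier_mat (length d) (length e) \<and>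
     (\<forall>r<length d. \<forall>c<length e. \<forall>m\<in>Poly_Mapping.keys (A $$ (r, c)). mdeg m + d ! r = e ! c)"

definition mat_image :: "'a::comm_ring_1 mat \<Rightarrow> 'a vec set" where
  "mat_image A = (\<lambda>v. A *\<^sub>v v) ` carrier_vec (dim_col A)"

text \<open>
  A minimal graded free resolution \<open>\<dots> \<rightarrow> F 1 \<rightarrow> F 0 \<rightarrow> I \<rightarrow> 0\<close> of a homogeneous ideal \<open>I\<close> as a
  module. The map \<open>\<phi> (Suc i)\<close> goes from \<open>F (Suc i)\<close> to \<open>F i\<close>, and \<open>\<phi> 0\<close> is the augmentation
  followed by the inclusion of \<open>I\<close> into \<open>R = R(-0)\<close>. As \<open>I\<close> lives in nonnegative degrees, a minimal
  resolution involves no \<open>R(-j)\<close> with \<open>j < 0\<close>, so shifts in \<open>nat\<close> suffice. Finite resolutions are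
  those with \<open>F i = []\<close> for large \<open>i\<close>.
\<close>

definition minimal_graded_free_resolution ::
  "'k::field poly3 set \<Rightarrow> (nat \<Rightarrow> nat list) \<Rightarrow> (nat \<Rightarrow> 'k poly3 mat) \<Rightarrow> bool" where
  "minimal_graded_free_resolution I F \<phi> \<longleftrightarrow>
     graded_map (F 0) [0] (\<phi> 0) \<and>
     (\<forall>i. graded_map (F (Suc i)) (F i) (\<phi> (Suc i))) \<and>
     (\<lambda>v. v $ 0) ` mat_image (\<phi> 0) = I \<and>
     (\<forall>i. mat_image (\<phi> (Suc i)) = mat_kernel (\<phi> i)) \<and>
     (\<forall>i. elements_mat (\<phi> (Suc i)) \<subseteq> ideal_gen {var_x, var_y, var_z})"

type_synonym diagram = "nat \<Rightarrow> nat \<Rightarrow> rat"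

text \<open>
  The choice is harmless: minimal graded free resolutions exist for homogeneous ideals and are
  unique up to isomorphism.
\<close>

definition betti :: "'k::field poly3 set \<Rightarrow> diagram" where
  "betti I i j =
     of_nat (count_list ((SOME F. \<exists>\<phi>. minimal_graded_free_resolution I F \<phi>) i) j)"

section \<open>Pure diagrams\<close>

definition degree_sequence :: "nat list \<Rightarrow> bool" where
  "degree_sequence d \<longleftrightarrow> d \<noteq> [] \<and> sorted_wrt (<) d"

definition pure_P :: "nat list \<Rightarrow> nat \<Rightarrow> nat" where
  "pure_P d i = (\<Prod>r\<in>{..<length d} - {i}. nat \<bar>int (d ! i) - int (d ! r)\<bar>)"

definition pure_diagram :: "nat list \<Rightarrow> diagram" where
  "pure_diagram d i j =
     (if i < length d \<and> j = d ! i
      then of_nat (Lcm (pure_P d ` {..<length d})) / of_nat (pure_P d i) else 0)"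

definition deg_entry :: "nat list \<Rightarrow> nat \<Rightarrow> enat" where
  "deg_entry d i = (if i < length d then enat (d ! i) else \<infinity>)"

definition deg_seq_less :: "nat list \<Rightarrow> nat list \<Rightarrow> bool" where
  "deg_seq_less d d' \<longleftrightarrow> d \<noteq> d' \<and> (\<forall>i. deg_entry d i \<le> deg_entry d' i)"

section \<open>The Boij-Soederberg decomposition\<close>

definition top_degree_sequence :: "diagram \<Rightarrow> nat list" where
  "top_degree_sequence D =
     map (\<lambda>i. LEAST j. D i j \<noteq> 0) [0..<Suc (GREATEST i. \<exists>j. D i j \<noteq> 0)]"

definition top_coefficient :: "diagram \<Rightarrow> rat" where
  "top_coefficient D = (let d = top_degree_sequence D in
     Min ((\<lambda>i. D i (d ! i) / pure_diagram d i (d ! i)) ` {..<length d}))"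

text \<open>
  \<open>bs_algorithm D xs\<close>: started on \<open>D\<close>, the greedy algorithm reaches the zero diagram, and \<open>xs\<close> lists
  the coefficients and degree sequences of its steps, in order.
\<close>

inductive bs_algorithm :: "diagram \<Rightarrow> (rat \<times> nat list) list \<Rightarrow> bool" where
  bs_stop: "bs_algorithm (\<lambda>i j. 0) []"
| bs_step: "D \<noteq> (\<lambda>i j. 0) \<Longrightarrow> d = top_degree_sequence D \<Longrightarrow> \<alpha> = top_coefficient D \<Longrightarrow>
    bs_algorithm (\<lambda>i j. D i j - \<alpha> * pure_diagram d i j) xs \<Longrightarrow> bs_algorithm D ((\<alpha>, d) # xs)"

definition bs_decomposition :: "diagram \<Rightarrow> (rat \<times> nat list) list \<Rightarrow> bool" where
  "bs_decomposition D xs \<longleftrightarrow> bs_algorithm D xs \<and>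
     (\<forall>(\<alpha>, d)\<in>set xs. \<alpha> > 0 \<and> degree_sequence d) \<and>
     sorted_wrt deg_seq_less (map snd xs)"

lemma bs_decomposition_unique:
  assumes "bs_decomposition D xs" "bs_decomposition D ys"
  shows "xs = ys"
proof -
  have "bs_algorithm D xs \<Longrightarrow> bs_algorithm D ys \<Longrightarrow> xs = ys"
  proof (induction arbitrary: ys rule: bs_algorithm.induct)
    case bs_stop
    then show ?case by cases auto
  next
    case (bs_step D d \<alpha> xs)
    from bs_step.prems bs_step.hyps(1) obtain zs
      where "ys = (top_coefficient D, top_degree_sequence D) # zs"
        and "bs_algorithm (\<lambda>i j. D i j - top_coefficient D *
               pure_diagram (top_degree_sequence D) i j) zs"
      by (cases rule: bs_algorithm.cases) blast+
    with bs_step.IH bs_step.hyps(2,3) show ?case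
      by blast
  qed
  with assms show ?thesis
    by (simp add: bs_decomposition_def)
qed

lemma bs_decomposition_sum:
  assumes "bs_decomposition D xs"
  shows "D i j = (\<Sum>(\<alpha>, d)\<leftarrow>xs. \<alpha> * pure_diagram d i j)"
proof -
  have "bs_algorithm D xs \<Longrightarrow> D i j = (\<Sum>(\<alpha>, d)\<leftarrow>xs. \<alpha> * pure_diagram d i j)"
  proof (induction rule: bs_algorithm.induct)
    case (bs_step D d \<alpha> xs)
    from bs_step.IH show ?case by simp
  qed simp
  with assms show ?thesis
    by (simp add: bs_decomposition_def)
qed

end

theory Submission
  imports Defs
begin

text \<open>
  Write \<open>L = x \<aa> + J R\<close> with \<open>J = L \<inter> k[y,z]\<close> and let \<open>A\<close> be minimal with \<open>y^A \<in> L\<close>, which exists since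
  \<open>codim L > 1\<close>. Lexicity puts all multiples of \<open>x\<close> of degree \<open>A\<close> into \<open>L\<close>, so that the generators of
  \<open>\<aa>\<close> have degree \<open>< A\<close>, those of \<open>J\<close> have degree \<open>\<ge> A\<close>, and \<open>G(L)\<close> is the disjoint union of \<open>x G(\<aa>)\<close>
  and \<open>G(J)\<close>. By the Eliahou--Kervaire resolution, obtained as an iterated mapping cone,
  \<open>\<beta>(L)\<close> is the shift of \<open>\<beta>(\<aa>)\<close> plus linear strands in the rows \<open>\<ge> A\<close>.

  A chain of pure diagrams with positive coefficients summing to \<open>D\<close> is the greedy decomposition
  of \<open>D\<close>. Hence only what remains of \<open>\<beta>(L)\<close> after subtracting the shifted length \<open>3\<close> part of
  \<open>\<beta>(\<aa>)\<close> has to be decomposed into a chain, all of whose members are at least the shift of \<open>d t\<close>;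
  the first member is merged with the last subtracted term if their degree sequences agree.
  That the greedy algorithm succeeds on this remainder follows from the shape of its tail and
  from the two relations \<open>\<Sum> (-1)^i \<beta>\<^sub>i\<^sub>j = 1\<close> and \<open>\<Sum> (-1)^i j \<beta>\<^sub>i\<^sub>j = 0\<close>.
\<close>

section \<open>Pure diagrams and the greedy decomposition\<close>

text \<open>The obstacle is the remainder: it is not presented as the Betti diagram of a module, so
  its greedy decomposition has to be shown by hand. It could fail only where the lowest degrees of
  neighbouring columns stop increasing. A failure is refuted by signs: an intact row of the tail has
  the entries n, 2n, n, which contribute 0 to both relations, so that the few other entries would
  force a wrong value. Both relations survive subtraction of a pure diagram of length 3, only the
  first survives length 2, and neither is asked for once column 0 alone is left; the invariant
  weakens accordingly.

  Two gradings are used. The total degree gives the Betti numbers, and since \<open>betti\<close>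
  picks an arbitrary minimal resolution, its numbers must first be shown independent of the choice.
  The mapping cones are graded by exponent vectors, because this fine grading makes minimality
  visible: neighbouring free modules share no multidegree, whereas their total degrees may well
  coincide.\<close>

lemma degree_sequence_nth_less:
  assumes "degree_sequence d" "i < i'" "i' < length d"
  shows "d ! i < d ! i'"
  using assms by (auto simp: degree_sequence_def sorted_wrt_iff_nth_less)

lemma degree_sequence_nth_inj:
  assumes "degree_sequence d" "i < length d" "i' < length d" "d ! i = d ! i'"
  shows "i = i'"
  by (metis assms degree_sequence_nth_less less_irrefl linorder_neqE_nat)

lemma degree_sequence_nth_ge:
  assumes "degree_sequence d"
  shows "i < length d \<Longrightarrow> i \<le> d ! i"
proof (induction i)
  case (Suc i)
  with degree_sequence_nth_less[OF assms, of i "Suc i"] show ?case by auto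
qed simp

lemma degree_sequence_map_Suc: "degree_sequence d \<Longrightarrow> degree_sequence (map Suc d)"
  by (auto simp: degree_sequence_def sorted_wrt_map)

lemma pure_diagram_nonneg: "pure_diagram d i j \<ge> 0"
  by (simp add: pure_diagram_def)

lemma pure_diagram_pos:
  assumes "degree_sequence d" "i < length d"
  shows "pure_diagram d i (d ! i) > 0"
proof -
  have P: "pure_P d i > 0" if "i < length d" for i
    unfolding pure_P_def
    by (intro prod_pos) (use degree_sequence_nth_inj[OF assms(1) that] in force)
  then have "0 \<notin> pure_P d ` {..<length d}" by force
  then have "Lcm (pure_P d ` {..<length d}) > 0"
    using Lcm_0_iff[of "pure_P d ` {..<length d}"] by (intro gr0I) simp
  with P[OF assms(2)] assms(2) show ?thesis
    unfolding pure_diagram_def by (simp add: zero_less_divide_iff)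
qed

lemma pure_diagram_eq_0: "\<not> (i < length d \<and> j = d ! i) \<Longrightarrow> pure_diagram d i j = 0"
  unfolding pure_diagram_def by (rule if_not_P)

lemma pure_P_map_Suc: "i < length d \<Longrightarrow> pure_P (map Suc d) i = pure_P d i"
  by (auto simp: pure_P_def intro!: prod.cong)

text \<open>The products \<open>pure_P\<close> involve only differences of degrees, so a shift moves
  the entries and leaves their values alone.\<close>

lemma pure_diagram_map_Suc:
  "pure_diagram (map Suc d) i j = (case j of 0 \<Rightarrow> 0 | Suc j' \<Rightarrow> pure_diagram d i j')"
proof -
  have "pure_P (map Suc d) ` {..<length d} = pure_P d ` {..<length d}"
    by (auto simp: pure_P_map_Suc intro!: image_cong)
  then show ?thesis
    by (auto simp: pure_diagram_def pure_P_map_Suc split: nat.splits)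
qed

lemma pure_diagram_length_2:
  assumes "u < v"
  shows "pure_diagram [u, v] 0 u = 1" "pure_diagram [u, v] (Suc 0) v = 1"
proof -
  have s: "{..<Suc (Suc 0)} - {0} = {Suc 0}" "{..<Suc (Suc 0)} - {Suc 0} = {0}"
    by auto
  have P: "pure_P [u, v] 0 = v - u" "pure_P [u, v] (Suc 0) = v - u"
    using assms by (auto simp: pure_P_def s abs_if)
  have "pure_P [u, v] ` {..<Suc (Suc 0)} = {v - u}"
    using P by (auto simp: lessThan_Suc)
  with P assms show "pure_diagram [u, v] 0 u = 1" "pure_diagram [u, v] (Suc 0) v = 1"
    by (auto simp: pure_diagram_def)
qed

text \<open>Up to a factor this is the only solution of the Herzog-Kuehl equations, the alternating
  sum of the entries and its version weighted by degree both being 0. The factor \<open>c\<close>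
  hides the lcm.\<close>

lemma pure_diagram_length_3:
  assumes "u < v" "v < w"
  obtains c where "c > 0"
    "pure_diagram [u, v, w] 0 u = c * (of_nat w - of_nat v)"
    "pure_diagram [u, v, w] 1 v = c * (of_nat w - of_nat u)"
    "pure_diagram [u, v, w] 2 w = c * (of_nat v - of_nat u)"
proof -
  have s: "{..<Suc (Suc (Suc 0))} - {0} = {Suc 0, 2}"
     "{..<Suc (Suc (Suc 0))} - {Suc 0} = {0, 2}"
     "{..<Suc (Suc (Suc 0))} - {2} = {0, Suc 0}"
    by auto
  have P: "pure_P [u, v, w] 0 = (v - u) * (w - u)" "pure_P [u, v, w] 1 = (v - u) * (w - v)"
    "pure_P [u, v, w] 2 = (w - u) * (w - v)"
    using assms by (auto simp: pure_P_def s abs_if nat_diff_distrib')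
  define l :: rat where "l = of_nat (Lcm (pure_P [u, v, w] ` {..<length [u, v, w]}))"
  define x y z :: rat where "x = of_nat (v - u)" and "y = of_nat (w - u)" and "z = of_nat (w - v)"
  have xyz: "x > 0" "y > 0" "z > 0"
    using assms by (auto simp: x_def y_def z_def)
  have "degree_sequence [u, v, w]"
    using assms by (simp add: degree_sequence_def)
  from pure_diagram_pos[OF this, of 0] xyz have l: "l > 0"
    by (auto simp: pure_diagram_def P l_def zero_less_divide_iff)
  show ?thesis
  proof
    \<comment> \<open>Each product \<open>pure_P\<close> omits exactly one of the three differences,
      so dividing the lcm by it leaves this constant times the omitted difference.\<close>
    show "l / (x * y * z) > 0" using xyz l by simp
    show "pure_diagram [u, v, w] 0 u = l / (x * y * z) * (of_nat w - of_nat v)"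
      "pure_diagram [u, v, w] 1 v = l / (x * y * z) * (of_nat w - of_nat u)"
      "pure_diagram [u, v, w] 2 w = l / (x * y * z) * (of_nat v - of_nat u)"
      using assms xyz
      by (auto simp: pure_diagram_def P[unfolded One_nat_def] l_def[symmetric, unfolded length_Cons list.size] x_def y_def z_def of_nat_diff
          divide_simps)
  qed
qed

lemma deg_seq_less_trans: "deg_seq_less d e \<Longrightarrow> deg_seq_less e f \<Longrightarrow> deg_seq_less d f"
proof -
  assume a: "deg_seq_less d e" "deg_seq_less e f"
  then have "\<And>i. deg_entry d i \<le> deg_entry f i"
    by (meson deg_seq_less_def order_trans)
  \<comment> \<open>Antisymmetry: equal entries force equal lengths, because the padding value
    \<infinity> differs from every true entry.\<close>
  moreover have "d \<noteq> f"
  proof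
    assume "d = f"
    with a have "\<And>i. deg_entry d i = deg_entry e i"
      by (meson deg_seq_less_def antisym)
    moreover from this have "length d = length e"
      by (metis deg_entry_def enat.distinct(2) linorder_neqE_nat not_less_iff_gr_or_eq)
    ultimately have "d = e"
      by (intro nth_equalityI) (auto simp: deg_entry_def split: if_splits, metis enat.inject)
    with a show False by (simp add: deg_seq_less_def)
  qed
  ultimately show ?thesis by (simp add: deg_seq_less_def)
qed

lemma deg_seq_lessI:
  assumes "length e \<le> length d" "\<And>i. i < length e \<Longrightarrow> d ! i \<le> e ! i" "d \<noteq> e"
  shows "deg_seq_less d e"
  using assms by (auto simp: deg_seq_less_def deg_entry_def)

lemma deg_seq_lessD:
  assumes "deg_seq_less d e"
  shows "length e \<le> length d" "i < length e \<Longrightarrow> d ! i \<le> e ! i" "d \<noteq> e"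
proof -
  have le: "deg_entry d i \<le> deg_entry e i" for i
    using assms by (simp add: deg_seq_less_def)
  show len: "length e \<le> length d"
    using le[of "length d"] by (simp add: deg_entry_def split: if_splits)
  show "d ! i \<le> e ! i" if "i < length e"
    using le[of i] that len by (simp add: deg_entry_def)
  show "d \<noteq> e"
    using assms by (simp add: deg_seq_less_def)
qed

section \<open>Chains of pure diagrams and the greedy algorithm\<close>

definition pure_chain :: "diagram \<Rightarrow> (rat \<times> nat list) list \<Rightarrow> bool" where
  "pure_chain D xs \<longleftrightarrow> (\<forall>(\<alpha>, d)\<in>set xs. \<alpha> > 0 \<and> degree_sequence d) \<and>
     sorted_wrt deg_seq_less (map snd xs) \<and>
     (\<forall>i j. D i j = (\<Sum>(\<alpha>, d)\<leftarrow>xs. \<alpha> * pure_diagram d i j))"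

lemma bs_decomposition_imp_pure_chain: "bs_decomposition D xs \<Longrightarrow> pure_chain D xs"
  using bs_decomposition_sum[of D xs] by (auto simp: pure_chain_def bs_decomposition_def)

lemma sum_pure_nonneg:
  assumes "\<forall>(\<alpha>, d)\<in>set xs. \<alpha> > 0"
  shows "(\<Sum>(\<alpha>, d)\<leftarrow>xs. \<alpha> * pure_diagram d i j) \<ge> (0::rat)"
  using assms by (intro sum_list_nonneg) (auto simp: pure_diagram_nonneg less_imp_le)

lemma sum_pure_zero:
  assumes "\<forall>(\<alpha>, d)\<in>set xs. \<not> (i < length d \<and> j = d ! i)"
  shows "(\<Sum>(\<alpha>, d)\<leftarrow>xs. \<alpha> * pure_diagram d i j) = (0::rat)"
  using assms by (induction xs) (auto simp: pure_diagram_eq_0)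

lemma sum_pure_pos:
  assumes "\<forall>(\<alpha>, d)\<in>set xs. \<alpha> > 0 \<and> degree_sequence d" "(\<alpha>, d) \<in> set xs" "i < length d"
    and j: "j = d ! i"
  shows "(\<Sum>(\<alpha>, d)\<leftarrow>xs. \<alpha> * pure_diagram d i j) > (0::rat)"
  using assms(1-3)
proof (induction xs)
  case (Cons x xs)
  obtain b e where x: "x = (b, e)" by fastforce
  have "(\<Sum>(\<alpha>, d)\<leftarrow>xs. \<alpha> * pure_diagram d i j) \<ge> 0"
    using Cons.prems by (intro sum_pure_nonneg) auto
  moreover have "b * pure_diagram e i j \<ge> 0"
    using Cons.prems x by (auto simp: pure_diagram_nonneg less_imp_le)
  moreover have "b * pure_diagram e i j > 0" if "x = (\<alpha>, d)"
    using Cons.prems x that j pure_diagram_pos by auto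
  ultimately show ?case
    using Cons x by (cases "x = (\<alpha>, d)") (auto intro: add_pos_nonneg add_nonneg_pos)
qed simp

lemma pure_chain_support:
  assumes "pure_chain D xs" "(\<alpha>, d) \<in> set xs" "i < length d"
  shows "D i (d ! i) > 0"
  using assms sum_pure_pos[of xs \<alpha> d i "d ! i"] by (simp add: pure_chain_def)

lemma pure_chain_nonneg: "pure_chain D xs \<Longrightarrow> D i j \<ge> 0"
  using sum_pure_nonneg[of xs i j] by (auto simp: pure_chain_def case_prod_beta)

lemma deg_seq_less_differ:
  assumes "deg_seq_less d e"
  obtains i where "i < length d" "i < length e \<Longrightarrow> d ! i < e ! i"
proof (cases "length e = length d")
  case True
  with deg_seq_lessD[OF assms] obtain i where "i < length d" "d ! i \<noteq> e ! i"
    by (metis nth_equalityI)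
  with True deg_seq_lessD[OF assms] that show ?thesis
    by (metis le_neq_implies_less)
next
  case False
  with deg_seq_lessD[OF assms] that[of "length e"] show ?thesis by auto
qed

text \<open>All later sequences dominate \<open>d\<close>, so \<open>d\<close> is the lower boundary
  of the support of \<open>D\<close>, which is what \<open>top_degree_sequence\<close> reads off.
  The greedy coefficient is \<alpha> because the rest of the chain vanishes at some position of
  \<open>d\<close>.\<close>

lemma pure_chain_Cons:
  assumes "pure_chain D ((\<alpha>, d) # xs)"
  shows "pure_chain (\<lambda>i j. D i j - \<alpha> * pure_diagram d i j) xs"
    "\<alpha> > 0" "degree_sequence d" "top_degree_sequence D = d" "top_coefficient D = \<alpha>"
    "D \<noteq> (\<lambda>i j. 0)"
proof -
  define R where "R = (\<lambda>i j. D i j - \<alpha> * pure_diagram d i j)"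
  from assms show R: "pure_chain (\<lambda>i j. D i j - \<alpha> * pure_diagram d i j) xs"
    and \<alpha>: "\<alpha> > 0" and d: "degree_sequence d"
    by (auto simp: pure_chain_def)
  from assms have less: "deg_seq_less d e" if "(\<beta>, e) \<in> set xs" for \<beta> e
    using that by (force simp: pure_chain_def)
  have D: "D i j = \<alpha> * pure_diagram d i j + R i j" for i j
    by (simp add: R_def)
  have R0: "R i j \<ge> 0" for i j
    using pure_chain_nonneg[OF R] by (simp add: R_def)
  have Rz: "R i j = 0" if "\<forall>(\<beta>, e)\<in>set xs. \<not> (i < length e \<and> j = e ! i)" for i j
    using R sum_pure_zero[OF that] by (simp add: pure_chain_def R_def)
  have pos: "D i (d ! i) > 0" if "i < length d" for i
    using pure_chain_support[OF assms, of \<alpha> d i] that by simp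
  have col: "D i j = 0" if "i \<ge> length d" for i j
  proof -
    have "R i j = 0"
    proof (rule Rz, clarify)
      fix \<beta> e assume "(\<beta>, e) \<in> set xs" "i < length e"
      with deg_seq_lessD(1)[OF less] that show False by fastforce
    qed
    with that show ?thesis by (simp add: D pure_diagram_eq_0)
  qed
  have low: "D i j = 0" if "i < length d" "j < d ! i" for i j
  proof -
    have "R i j = 0"
    proof (rule Rz, clarify)
      fix \<beta> e assume "(\<beta>, e) \<in> set xs" "i < length e" "j = e ! i"
      with deg_seq_lessD(2)[OF less] that show False by fastforce
    qed
    with that show ?thesis by (simp add: D pure_diagram_eq_0)
  qed
  have len: "length d > 0" using d by (simp add: degree_sequence_def)
  have G: "(GREATEST i. \<exists>j. D i j \<noteq> 0) = length d - 1"
  proof (rule Greatest_equality)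
    have "D (length d - 1) (d ! (length d - 1)) > 0" using pos len by simp
    then show "\<exists>j. D (length d - 1) j \<noteq> 0" by (metis less_irrefl)
    show "y \<le> length d - 1" if "\<exists>j. D y j \<noteq> 0" for y
      using col[of y] that by (cases "y < length d") auto
  qed
  have L: "(LEAST j. D i j \<noteq> 0) = d ! i" if "i < length d" for i
  proof (rule Least_equality)
    show "D i (d ! i) \<noteq> 0" using pos[OF that] by simp
    show "d ! i \<le> j" if "D i j \<noteq> 0" for j
      using low[OF \<open>i < length d\<close>, of j] that by (meson linorder_not_le)
  qed
  show top: "top_degree_sequence D = d"
    unfolding top_degree_sequence_def G using len by (auto intro!: nth_equalityI simp: L)
  have P: "pure_diagram d i (d ! i) > 0" if "i < length d" for i
    using pure_diagram_pos d that by simp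
  have q: "D i (d ! i) / pure_diagram d i (d ! i) = \<alpha> + R i (d ! i) / pure_diagram d i (d ! i)"
    if "i < length d" for i
    using P[OF that] by (simp add: D add_divide_distrib)
  \<comment> \<open>At some index the second sequence \<open>e\<close> has a larger entry than
    \<open>d\<close> or has already ended. All later sequences are at least \<open>e\<close>, so
    none of them comes back to this position of \<open>d\<close>, and the quotient there is exactly
    \<alpha>.\<close>
  obtain i0 where i0: "i0 < length d" "R i0 (d ! i0) = 0"
  proof (cases xs)
    case Nil
    with Rz[of 0 "d ! 0"] have "R 0 (d ! 0) = 0" by simp
    with len that show ?thesis by blast
  next
    case (Cons x xs')
    obtain \<beta> e where x: "x = (\<beta>, e)" by fastforce
    from less[of \<beta> e] Cons x have "deg_seq_less d e" by simp
    then obtain i where i: "i < length d" "i < length e \<Longrightarrow> d ! i < e ! i"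
      using deg_seq_less_differ by blast
    have "R i (d ! i) = 0"
    proof (rule Rz, clarify)
      fix \<gamma> f assume f: "(\<gamma>, f) \<in> set xs" "i < length f" "d ! i = f ! i"
      then have "f = e \<or> deg_seq_less e f"
        using assms Cons x by (force simp: pure_chain_def)
      with deg_seq_lessD(1,2)[of e f] i f show False by (auto simp: less_le_trans) (meson leD less_le_trans)
    qed
    with i that show ?thesis by blast
  qed
  show "top_coefficient D = \<alpha>"
    unfolding top_coefficient_def Let_def top
  proof (rule Min_eqI)
    show "\<alpha> \<in> (\<lambda>i. D i (d ! i) / pure_diagram d i (d ! i)) ` {..<length d}"
      using i0 q[of i0] by (auto intro!: image_eqI[of _ _ i0])
  next
    fix y assume "y \<in> (\<lambda>i. D i (d ! i) / pure_diagram d i (d ! i)) ` {..<length d}"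
    then show "\<alpha> \<le> y"
      using q P R0 by (auto simp: less_imp_le)
  qed simp
  show "D \<noteq> (\<lambda>i j. 0)"
    using pos[OF len] by auto
qed

lemma pure_chain_imp_bs_decomposition:
  assumes "pure_chain D xs"
  shows "bs_decomposition D xs"
proof -
  from assms have "bs_algorithm D xs"
  proof (induction xs arbitrary: D)
    case Nil
    then have "D = (\<lambda>i j. 0)" by (auto simp: pure_chain_def)
    then show ?case by (simp add: bs_stop)
  next
    case (Cons x xs)
    obtain \<alpha> d where x: "x = (\<alpha>, d)" by fastforce
    from pure_chain_Cons[OF Cons.prems[unfolded x]] Cons.IH show ?case
      unfolding x by (intro bs_step) auto
  qed
  with assms show ?thesis
    by (simp add: bs_decomposition_def pure_chain_def)
qed

section \<open>Decomposing a diagram whose tail is linear\<close>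

text \<open>Members of the given chain sit on nonzero entries of \<open>D\<close>, hence at or above
  \<open>q\<close>; the entry that the subtraction kills keeps them different from
  \<open>q\<close>.\<close>

lemma pure_chain_ConsI:
  assumes "pure_chain (\<lambda>i j. D i j - \<alpha> * pure_diagram q i j) xs"
    and "\<alpha> > 0" "degree_sequence q"
    and supp: "\<And>i j. D i j \<noteq> 0 \<Longrightarrow> i < length q \<and> q ! i \<le> j"
    and kill: "i < length q" "D i (q ! i) = \<alpha> * pure_diagram q i (q ! i)"
  shows "pure_chain D ((\<alpha>, q) # xs)"
proof -
  have "deg_seq_less q e" if "(\<beta>, e) \<in> set xs" for \<beta> e
  proof -
    have pos: "D i (e ! i) - \<alpha> * pure_diagram q i (e ! i) > 0" if "i < length e" for i
      using pure_chain_support[OF assms(1)] \<open>(\<beta>, e) \<in> set xs\<close> that by blast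
    have nz: "D i (e ! i) \<noteq> 0" if "i < length e" for i
      using pos[OF that] pure_diagram_nonneg[of q i "e ! i"] \<open>\<alpha> > 0\<close>
      by (metis diff_0 less_le_not_le mult_nonneg_nonneg neg_le_0_iff_le)
    have "e \<noteq> []"
      using assms(1) that by (auto simp: pure_chain_def degree_sequence_def)
    then have "length e \<le> length q"
      using supp[OF nz, of "length e - 1"] by simp linarith
    moreover have "q ! i \<le> e ! i" if "i < length e" for i
      using supp[OF nz[OF that]] by simp
    moreover have "q \<noteq> e"
      using kill pos[of i] by auto
    ultimately show ?thesis
      by (rule deg_seq_lessI)
  qed
  with assms show ?thesis
    unfolding pure_chain_def by (auto simp flip: diff_eq_eq add.commute) (metis add_diff_cancel_left' diff_add_cancel add.commute)
qed

text \<open>The minimal quotient is the largest multiple that keeps all entries nonnegative. An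
  index attaining it provides the killed entry for \<open>pure_chain_ConsI\<close>.\<close>

lemma peel_pure_diagram:
  fixes D :: diagram
  assumes "degree_sequence q" "\<And>i. i < length q \<Longrightarrow> D i (q ! i) > 0" "\<And>i j. D i j \<ge> 0"
  obtains \<alpha> i where "\<alpha> > 0" "i < length q" "D i (q ! i) = \<alpha> * pure_diagram q i (q ! i)"
    "\<And>i j. \<alpha> * pure_diagram q i j \<le> D i j"
proof -
  let ?r = "\<lambda>i. D i (q ! i) / pure_diagram q i (q ! i)"
  define \<alpha> where "\<alpha> = Min (?r ` {..<length q})"
  have ne: "{..<length q} \<noteq> {}" using assms(1) by (auto simp: degree_sequence_def lessThan_empty_iff)
  have pos: "pure_diagram q i (q ! i) > 0" if "i < length q" for i
    using assms(1) that by (rule pure_diagram_pos)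
  have "\<alpha> \<in> ?r ` {..<length q}"
    unfolding \<alpha>_def using ne by (intro Min_in) auto
  then obtain i where i: "i < length q" "\<alpha> = ?r i" by auto
  show ?thesis
  proof
    show "\<alpha> > 0" using i assms(2) pos by simp
    show "i < length q" by fact
    show "D i (q ! i) = \<alpha> * pure_diagram q i (q ! i)" using i pos[of i] by simp
    show "\<alpha> * pure_diagram q i j \<le> D i j" for i j
    proof (cases "i < length q \<and> j = q ! i")
      case True
      then have "\<alpha> \<le> ?r i" unfolding \<alpha>_def by (intro Min_le) auto
      with True pos[of i] show ?thesis by (simp add: pos_le_divide_eq)
    next
      case False
      with assms(3) show ?thesis by (simp add: pure_diagram_eq_0)
    qed
  qed
qed

text \<open>The sum of (-1)^i f(j) D i j over the first three columns, cut off at row N. Summing by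
  the row e = j - i of the Betti table lets the three entries of a linear strand meet in one
  summand.\<close>

definition euler_sum :: "nat \<Rightarrow> (nat \<Rightarrow> rat) \<Rightarrow> diagram \<Rightarrow> rat" where
  "euler_sum N f D = (\<Sum>e\<le>N. f e * D 0 e - f (Suc e) * D 1 (Suc e) + f (Suc (Suc e)) * D 2 (Suc (Suc e)))"

lemma euler_sum_diff:
  "euler_sum N f (\<lambda>i j. D i j - \<alpha> * D' i j) = euler_sum N f D - \<alpha> * euler_sum N f D'"
  unfolding euler_sum_def sum_distrib_left sum_subtractf[symmetric]
  by (intro sum.cong) (auto simp: algebra_simps)

lemma euler_sum_pure:
  assumes "\<And>i. i < length q \<Longrightarrow> i \<le> q ! i \<and> q ! i \<le> N + i" "length q \<le> 3"
  shows "euler_sum N f (pure_diagram q) = (\<Sum>i<length q. (-1) ^ i * f (q ! i) * pure_diagram q i (q ! i))"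
proof -
  have col: "(\<Sum>e\<le>N. f (e + i) * pure_diagram q i (e + i)) =
      (if i < length q then f (q ! i) * pure_diagram q i (q ! i) else 0)" for i
  proof (cases "i < length q")
    case True
    then have "(\<Sum>e\<le>N. f (e + i) * pure_diagram q i (e + i)) =
        (\<Sum>e\<le>N. if e = q ! i - i then f (q ! i) * pure_diagram q i (q ! i) else 0)"
      using assms(1)[OF True] by (intro sum.cong) (auto simp: pure_diagram_eq_0)
    moreover have "q ! i - i \<le> N" using assms(1)[OF True] by linarith
    ultimately show ?thesis using True by simp
  qed (simp add: pure_diagram_eq_0)
  have "euler_sum N f (pure_diagram q) = (\<Sum>i<3. (-1) ^ i * (\<Sum>e\<le>N. f (e + i) * pure_diagram q i (e + i)))"
    by (simp add: euler_sum_def sum.distrib sum_subtractf eval_nat_numeral)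
  also have "\<dots> = (\<Sum>i<3. if i < length q then (-1) ^ i * f (q ! i) * pure_diagram q i (q ! i) else 0)"
    unfolding col by (intro sum.cong) auto
  also have "\<dots> = (\<Sum>i<length q. (-1) ^ i * f (q ! i) * pure_diagram q i (q ! i))"
    using assms(2) by (intro sum.mono_neutral_cong_right) auto
  finally show ?thesis .
qed

text \<open>With the degree as weight the value would be u - v instead of 0, so the moment is lost
  when the greedy algorithm passes to length 2.\<close>

lemma euler_sum_pure_2:
  assumes "u < v" "v \<le> Suc N"
  shows "euler_sum N (\<lambda>_. 1) (pure_diagram [u, v]) = 0"
proof -
  have "euler_sum N (\<lambda>_. 1) (pure_diagram [u, v]) = pure_diagram [u, v] 0 u - pure_diagram [u, v] 1 v"
    using assms by (subst euler_sum_pure) (auto simp: less_Suc_eq)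
  with pure_diagram_length_2[OF assms(1)] show ?thesis by simp
qed

text \<open>After factoring out \<open>c\<close> these are the identities (w - v) - (w - u) + (v -
  u) = 0 and u (w - v) - v (w - u) + w (v - u) = 0.\<close>

lemma euler_sum_pure_3:
  assumes "u < v" "v < w" "w \<le> N + 2"
  shows "euler_sum N (\<lambda>_. 1) (pure_diagram [u, v, w]) = 0"
    and "euler_sum N of_nat (pure_diagram [u, v, w]) = 0"
proof -
  have *: "euler_sum N f (pure_diagram [u, v, w]) =
    f u * pure_diagram [u, v, w] 0 u - f v * pure_diagram [u, v, w] 1 v + f w * pure_diagram [u, v, w] 2 w" for f
    using assms by (subst euler_sum_pure) (auto simp: less_Suc_eq eval_nat_numeral)
  obtain c where c: "pure_diagram [u, v, w] 0 u = c * (of_nat w - of_nat v)"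
    "pure_diagram [u, v, w] 1 v = c * (of_nat w - of_nat u)"
    "pure_diagram [u, v, w] 2 w = c * (of_nat v - of_nat u)"
    using pure_diagram_length_3[OF assms(1,2)] .
  show "euler_sum N (\<lambda>_. 1) (pure_diagram [u, v, w]) = 0"
    "euler_sum N of_nat (pure_diagram [u, v, w]) = 0"
    unfolding * c by (simp_all add: algebra_simps)
qed

text \<open>Column \<open>i\<close> after some greedy steps, the last of which used degree
  \<open>p\<close>: emptied below \<open>p\<close>, untouched above, and arbitrary at
  \<open>p\<close>, where the entry may be partly consumed.\<close>

definition agrees_above :: "diagram \<Rightarrow> diagram \<Rightarrow> nat \<Rightarrow> nat \<Rightarrow> bool" where
  "agrees_above D\<^sub>0 D i p \<longleftrightarrow> (\<forall>j<p. D i j = 0) \<and> (\<forall>j>p. D i j = D\<^sub>0 i j)"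

text \<open>
  Here \<open>n e\<close> counts summands \<open>\<pi>\<close> of type \<open>(e, e + 1, e + 2)\<close>; everything else lives in columns 0 and 1
  and, by \<open>tail0\<close> and \<open>tail1\<close>, in the rows up to \<open>A\<close>.
\<close>

locale linear_tail =
  fixes D\<^sub>0 :: diagram and n :: "nat \<Rightarrow> rat" and A N :: nat
  assumes nonneg: "D\<^sub>0 i j \<ge> 0"
    and supp: "D\<^sub>0 i j \<noteq> 0 \<Longrightarrow> i < 3 \<and> i \<le> j \<and> j \<le> N + i"
    and n_low: "e < A \<Longrightarrow> n e = 0"
    and col2: "D\<^sub>0 2 (Suc (Suc e)) = n e"
    and tail0: "A < e \<Longrightarrow> D\<^sub>0 0 e = n e"
    and tail1: "A < e \<Longrightarrow> D\<^sub>0 (Suc 0) (Suc e) = 2 * n e"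
    and low: "f \<le> A \<Longrightarrow> (\<Sum>j\<le>f. D\<^sub>0 1 j) \<le> (\<Sum>j<f. D\<^sub>0 0 j)"
    and rank: "euler_sum N (\<lambda>_. 1) D\<^sub>0 = 1"
    and moment: "euler_sum N of_nat D\<^sub>0 = 0"
begin

text \<open>
  The invariant of the greedy algorithm: entries of degree above the last top degree sequence
  \<open>(p\<^sub>0, p\<^sub>1, p\<^sub>2)\<close> are still those of \<open>D\<^sub>0\<close>, and the alternating sum of the entries is preserved; the
  alternating sum weighted by the degree is preserved only while all three columns are in use.
\<close>

definition invar_tail :: "diagram \<Rightarrow> bool" where
  "invar_tail D \<longleftrightarrow> euler_sum N (\<lambda>_. 1) D = 1 \<and>
    (\<exists>p\<^sub>0 p\<^sub>1. p\<^sub>0 < p\<^sub>1 \<and> agrees_above D\<^sub>0 D 0 p\<^sub>0 \<and> agrees_above D\<^sub>0 D 1 p\<^sub>1 \<and>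
      ((\<exists>j. D 2 j \<noteq> 0) \<longrightarrow> euler_sum N of_nat D = 0 \<and> (\<exists>p\<^sub>2>p\<^sub>1. agrees_above D\<^sub>0 D 2 p\<^sub>2)))"

text \<open>The guard is for the final steps: a pure diagram of length 1 changes the alternating
  sum, and it is subtracted only when nothing is left outside column 0.\<close>

definition invar :: "diagram \<Rightarrow> bool" where
  "invar D \<longleftrightarrow> (\<forall>i j. 0 \<le> D i j \<and> D i j \<le> D\<^sub>0 i j) \<and> ((\<exists>i>0. \<exists>j. D i j \<noteq> 0) \<longrightarrow> invar_tail D)"

lemma invar_tail: "invar D \<Longrightarrow> 0 < i \<Longrightarrow> D i j \<noteq> 0 \<Longrightarrow> invar_tail D"
  unfolding invar_def by blast

text \<open>Nothing has been consumed yet, and the thresholds 0, 1, 2 are valid because column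
  \<open>i\<close> of \<open>D\<^sub>0\<close> starts in degree \<open>i\<close> at the
  earliest.\<close>

lemma invar_initial: "invar D\<^sub>0"
proof -
  have "agrees_above D\<^sub>0 D\<^sub>0 i i" for i
    using supp[of i] by (force simp: agrees_above_def)
  moreover have "(0::nat) < 1" "(1::nat) < 2" by simp_all
  ultimately show ?thesis
    unfolding invar_def invar_tail_def using nonneg rank moment by blast
qed

lemma invarD:
  assumes "invar D"
  shows "0 \<le> D i j" "D i j \<le> D\<^sub>0 i j" "D i j \<noteq> 0 \<Longrightarrow> i < 3 \<and> i \<le> j \<and> j \<le> N + i"
proof -
  show D: "0 \<le> D i j" "D i j \<le> D\<^sub>0 i j" using assms by (auto simp: invar_def)
  then show "D i j \<noteq> 0 \<Longrightarrow> i < 3 \<and> i \<le> j \<and> j \<le> N + i"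
    using supp[of i j] by fastforce
qed

text \<open>
  If column 1 had no entry in degrees \<open>< g\<close>, the intact linear tail would contribute \<open>0\<close> to the first moment
  and the entry at \<open>(2, g)\<close> a positive amount.
\<close>

lemma column1_below_column2:
  assumes D: "invar D" and g: "D 2 g \<noteq> 0" "\<And>j. j < g \<Longrightarrow> D 2 j = 0"
  shows "\<exists>j<g. D 1 j \<noteq> 0"
proof (rule ccontr)
  assume "\<not> ?thesis"
  then have b: "D 1 j = 0" if "j < g" for j using that by blast
  obtain p\<^sub>0 p\<^sub>1 p\<^sub>2 where p: "p\<^sub>0 < p\<^sub>1" "p\<^sub>1 < p\<^sub>2" "agrees_above D\<^sub>0 D 0 p\<^sub>0" "agrees_above D\<^sub>0 D 1 p\<^sub>1"
      "agrees_above D\<^sub>0 D 2 p\<^sub>2" and m: "euler_sum N of_nat D = 0"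
    using invar_tail[OF D _ g(1)] g(1) unfolding invar_tail_def by auto
  note D' = invarD[OF D]
  have pg: "p\<^sub>2 \<le> g" using p(5) g(1) by (meson agrees_above_def linorder_not_le)
  from D'(3)[OF g(1)] obtain e\<^sub>0 where e0: "g = Suc (Suc e\<^sub>0)" "e\<^sub>0 \<le> N"
    by (metis add_2_eq_Suc add_le_cancel_right add.commute le_Suc_ex)
  \<comment> \<open>Column 2 of \<open>D\<^sub>0\<close> is \<open>n\<close> moved by two degrees,
    and \<open>n\<close> vanishes below A. Hence all rows after \<open>e\<^sub>0\<close> obey the
    tail equations.\<close>
  have "A \<le> e\<^sub>0"
  proof (rule ccontr)
    assume "\<not> A \<le> e\<^sub>0"
    with n_low have "D\<^sub>0 2 g = 0" by (simp add: e0 col2)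
    with D'(1,2)[of 2 g] g(1) show False by simp
  qed
  \<comment> \<open>The summand of the moment in row \<open>e\<close>. Up to row
    \<open>e\<^sub>0\<close> its only negative entry is absent; later rows are intact and give n e *
    (e - 2 (e + 1) + (e + 2)) = 0.\<close>
  define T where "T e = of_nat e * D 0 e - of_nat (Suc e) * D 1 (Suc e) + of_nat (Suc (Suc e)) * D 2 (Suc (Suc e))" for e
  have "T e \<ge> 0" for e
  proof (cases "e \<le> e\<^sub>0")
    case True
    with b[of "Suc e"] e0 D'(1) show ?thesis by (simp add: T_def)
  next
    case False
    with p pg e0 \<open>A \<le> e\<^sub>0\<close> have "D 0 e = n e" "D 1 (Suc e) = 2 * n e" "D 2 (Suc (Suc e)) = n e"
      by (auto simp: agrees_above_def tail0 tail1 col2)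
    then show ?thesis by (simp add: T_def algebra_simps)
  qed
  moreover have "T e\<^sub>0 > 0"
  proof -
    have "of_nat (Suc (Suc e\<^sub>0)) * D 2 g > 0"
      using g(1) D'(1)[of 2 g] by (intro mult_pos_pos) auto
    moreover have "of_nat e\<^sub>0 * D 0 e\<^sub>0 \<ge> 0" using D'(1) by simp
    moreover have "D 1 (Suc e\<^sub>0) = 0" using b e0 by simp
    ultimately show ?thesis unfolding T_def e0(1) by simp
  qed
  ultimately have "euler_sum N of_nat D > 0"
    unfolding euler_sum_def T_def[symmetric] using e0 by (intro sum_pos2[of _ e\<^sub>0]) auto
  with m show False by simp
qed

text \<open>If column 0 were empty below \<open>f\<close>, it would be intact from \<open>f\<close>
  on, since \<open>p\<^sub>0\<close> < \<open>p\<^sub>1\<close> \<le> f. Which relation is then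
  violated depends on whether \<open>f\<close> lies in the tail and whether column 2 starts right
  after \<open>f\<close>.\<close>

lemma column0_below_column1:
  assumes D: "invar D" and f: "D 1 f \<noteq> 0" "\<And>j. j < f \<Longrightarrow> D 1 j = 0" "\<And>j. j \<le> f \<Longrightarrow> D 2 j = 0"
  shows "\<exists>j<f. D 0 j \<noteq> 0"
proof (rule ccontr)
  assume "\<not> ?thesis"
  then have a: "D 0 j = 0" if "j < f" for j using that by blast
  obtain p\<^sub>0 p\<^sub>1 where p: "p\<^sub>0 < p\<^sub>1" "agrees_above D\<^sub>0 D 0 p\<^sub>0" "agrees_above D\<^sub>0 D 1 p\<^sub>1"
      and r: "euler_sum N (\<lambda>_. 1) D = 1"
      and p2: "(\<exists>j. D 2 j \<noteq> 0) \<Longrightarrow> euler_sum N of_nat D = 0 \<and> (\<exists>p\<^sub>2. agrees_above D\<^sub>0 D 2 p\<^sub>2)"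
    using invar_tail[OF D _ f(1)] unfolding invar_tail_def by auto
  note D' = invarD[OF D]
  have pf: "p\<^sub>1 \<le> f" using p(3) f(1) by (meson agrees_above_def linorder_not_le)
  have f1: "1 \<le> f" "f \<le> Suc N" using D'(3)[OF f(1)] by auto
  have a': "D 0 j = D\<^sub>0 0 j" if "j \<ge> f" for j
    using p pf that by (auto simp: agrees_above_def)
  have b': "D 1 j = D\<^sub>0 1 j" if "j > f" for j
    using p pf that by (auto simp: agrees_above_def)
  have c': "D 2 (Suc (Suc e)) \<le> n e" for e
    using D'(2)[of 2 "Suc (Suc e)"] by (simp add: col2)
  show False
  proof (cases "f \<le> A")
    case True
    \<comment> \<open>What has been removed so far has alternating sum 0. Column 0 lost everything
      below \<open>f\<close>, so column 1 lost at least as much, and only in degrees up to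
      \<open>f\<close>. By \<open>low\<close> it had no more than that there, so nothing remains at
      \<open>f\<close>.\<close>
    have "euler_sum N (\<lambda>_. 1) (\<lambda>i j. D\<^sub>0 i j - 1 * D i j) = 0"
      unfolding euler_sum_diff rank r by simp
    then have "(\<Sum>e\<le>N. D\<^sub>0 0 e - D 0 e) - (\<Sum>e\<le>N. D\<^sub>0 1 (Suc e) - D 1 (Suc e))
        + (\<Sum>e\<le>N. D\<^sub>0 2 (Suc (Suc e)) - D 2 (Suc (Suc e))) = 0"
      unfolding euler_sum_def by (simp add: sum.distrib sum_subtractf)
    moreover have "(\<Sum>e\<le>N. D\<^sub>0 2 (Suc (Suc e)) - D 2 (Suc (Suc e))) \<ge> 0"
      using D'(2) by (intro sum_nonneg) (simp add: algebra_simps)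
    moreover have "(\<Sum>e\<le>N. D\<^sub>0 0 e - D 0 e) = (\<Sum>e<f. D\<^sub>0 0 e)"
    proof (rule sum.mono_neutral_cong)
      show "D\<^sub>0 0 i = 0" if "i \<in> {..<f} - {..N}" for i
        using supp[of 0 i] that by force
    qed (use a a' in \<open>auto simp: not_less\<close>)
    moreover have "(\<Sum>e\<le>N. D\<^sub>0 1 (Suc e) - D 1 (Suc e)) = (\<Sum>e<f. D\<^sub>0 1 (Suc e) - D 1 (Suc e))"
      using f1 b' by (intro sum.mono_neutral_right) auto
    moreover have "\<dots> = (\<Sum>e<f. D\<^sub>0 1 (Suc e)) - D 1 f"
    proof -
      from f1 obtain f' where f': "f = Suc f'" by (metis Suc_le_D One_nat_def)
      have "(\<Sum>e<f. D 1 (Suc e)) = D 1 f"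
        unfolding f' using f(2) by (auto simp: f')
      then show ?thesis by (simp add: sum_subtractf)
    qed
    moreover have "(\<Sum>e<f. D\<^sub>0 1 (Suc e)) \<le> (\<Sum>j\<le>f. D\<^sub>0 1 j)"
      unfolding sum.lessThan_Suc_shift lessThan_Suc_atMost[symmetric] using nonneg by simp
    ultimately have "D 1 f \<le> 0"
      using low[OF True] by linarith
    with D'(1)[of 1 f] f(1) show False by simp
  next
    case False
    then have "A < f" by simp
    show False
    proof (cases "D 2 (Suc f) = 0")
      case True
      \<comment> \<open>Below \<open>f\<close> only column 1 can contribute to a row. From
        \<open>f\<close> on a row consists of n e, 2 * n e and at most n e. So no row is positive,
        against the total 1.\<close>
      have "D 0 e - D 1 (Suc e) + D 2 (Suc (Suc e)) \<le> 0" for e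
      proof (cases "e \<ge> f")
        case True
        with a' b' c'[of e] \<open>A < f\<close> show ?thesis by (simp add: tail0 tail1)
      next
        case False
        then have "D 2 (Suc (Suc e)) = 0" using f(3) True by (cases "Suc e = f") auto
        with False a D'(1)[of 1 "Suc e"] show ?thesis by simp
      qed
      then have "euler_sum N (\<lambda>_. 1) D \<le> 0"
        unfolding euler_sum_def by (intro sum_nonpos) simp
      with r show False by simp
    next
      case nz: False
      then obtain p\<^sub>2 where m: "euler_sum N of_nat D = 0" and p\<^sub>2: "agrees_above D\<^sub>0 D 2 p\<^sub>2"
        using p2 by blast
      then have "p\<^sub>2 \<le> Suc f" using nz by (meson agrees_above_def linorder_not_le)
      \<comment> \<open>The weight j - f vanishes at the entry (1, f), cancels on the intact rows
        and equals 1 at (2, f + 1). So the weighted sum is nonnegative; but by the two relations it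
        is 0 - f.\<close>
      have "(of_nat e - of_nat f) * D 0 e - (of_nat (Suc e) - of_nat f) * D 1 (Suc e)
          + (of_nat (Suc (Suc e)) - of_nat f) * D 2 (Suc (Suc e)) \<ge> 0" for e
      proof (cases "e \<ge> f")
        case True
        with p\<^sub>2 \<open>p\<^sub>2 \<le> Suc f\<close> have "D 2 (Suc (Suc e)) = n e" by (simp add: agrees_above_def flip: col2)
        with True a' b' \<open>A < f\<close> show ?thesis by (simp add: tail0 tail1 algebra_simps)
      next
        case False
        then consider "Suc e < f" | "f = Suc e" by linarith
        then show ?thesis
        proof cases
          case 1
          with a f(2,3) show ?thesis by simp
        next
          case 2
          with a D'(1)[of 2 "Suc (Suc e)"] show ?thesis by simp
        qed
      qed
      then have "0 \<le> euler_sum N (\<lambda>e. of_nat e - of_nat f) D"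
        unfolding euler_sum_def by (intro sum_nonneg) simp
      also have "\<dots> = euler_sum N of_nat D - of_nat f * euler_sum N (\<lambda>_. 1) D"
        unfolding euler_sum_def sum_distrib_left sum_subtractf[symmetric]
        by (intro sum.cong) (auto simp: algebra_simps)
      finally show False using r m f1 by simp
    qed
  qed
qed

text \<open>If an entry outside column 0 survives, \<open>q\<close> has length 2 or 3. Length 3
  respects both relations; length 2 occurs only with column 2 empty, when just the alternating sum
  is required. The entries of \<open>q\<close> become the new thresholds.\<close>

lemma invar_step:
  assumes D: "invar D" and q: "degree_sequence q" "length q \<le> 3"
    and qD: "\<And>i j. i < length q \<Longrightarrow> j < q ! i \<Longrightarrow> D i j = 0" "\<And>i. i < length q \<Longrightarrow> D i (q ! i) \<noteq> 0"
    and qc: "\<And>i j. length q \<le> i \<Longrightarrow> D i j = 0"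
    and \<alpha>: "\<alpha> > 0" "\<And>i j. \<alpha> * pure_diagram q i j \<le> D i j"
  shows "invar (\<lambda>i j. D i j - \<alpha> * pure_diagram q i j)" (is "invar ?D")
proof -
  note D' = invarD[OF D]
  have le: "0 \<le> ?D i j" "?D i j \<le> D i j" for i j
    using \<alpha> pure_diagram_nonneg[of q i j] by (simp_all add: algebra_simps)
  have qN: "i \<le> q ! i \<and> q ! i \<le> N + i" if "i < length q" for i
    using D'(3)[OF qD(2)[OF that]] by simp
  have z: "?D i j = 0" if "D i j = 0" for i j
    using le[of i j] that by simp
  \<comment> \<open>The first nonzero degree of a column cannot lie below its old threshold, so
    raising the threshold to it loses nothing.\<close>
  have aa: "agrees_above D\<^sub>0 ?D i (q ! i)" if "agrees_above D\<^sub>0 D i p" "i < length q" for i p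
  proof -
    have "p \<le> q ! i" using that qD(2)[OF that(2)] by (meson agrees_above_def linorder_not_le)
    with that qD(1)[OF that(2)] z show ?thesis
      by (auto simp: agrees_above_def pure_diagram_eq_0)
  qed
  have "invar_tail ?D"
    if "i > 0" "?D i j \<noteq> 0" for i j
  proof -
    have "D i j \<noteq> 0" using that z by blast
    with qc have i: "i < length q" by (meson linorder_not_le)
    with \<open>i > 0\<close> have l: "0 < length q" "1 < length q" by auto
    from invar_tail[OF D \<open>i > 0\<close> \<open>D i j \<noteq> 0\<close>] obtain p\<^sub>0 p\<^sub>1 where p: "agrees_above D\<^sub>0 D 0 p\<^sub>0" "agrees_above D\<^sub>0 D 1 p\<^sub>1"
      and r: "euler_sum N (\<lambda>_. 1) D = 1"
      and p2: "(\<exists>j. D 2 j \<noteq> 0) \<Longrightarrow> euler_sum N of_nat D = 0 \<and> (\<exists>p\<^sub>2>p\<^sub>1. agrees_above D\<^sub>0 D 2 p\<^sub>2)"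
      unfolding invar_tail_def by auto
    note q01 = degree_sequence_nth_less[OF q(1), of 0 1] degree_sequence_nth_less[OF q(1), of 1 2]
    show ?thesis
    proof (cases "length q = 2")
      case True
      then have "[q ! 0, q ! 1] = q"
        by (intro nth_equalityI) (auto simp: less_Suc_eq eval_nat_numeral)
      moreover have "euler_sum N (\<lambda>_. 1) (pure_diagram [q ! 0, q ! 1]) = 0"
        using q01(1) l qN[of 1] by (intro euler_sum_pure_2) auto
      ultimately have "euler_sum N (\<lambda>_. 1) (pure_diagram q) = 0"
        by (rule subst)
      with r have "euler_sum N (\<lambda>_. 1) ?D = 1" by (simp add: euler_sum_diff)
      moreover have "?D 2 j = 0" for j
        using qc[of 2] True z by simp
      ultimately show ?thesis
        unfolding invar_tail_def using q01(1) l aa[OF p(1)] aa[OF p(2)]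
        by (intro conjI exI[of _ "q ! 0"] exI[of _ "q ! 1"] impI) (simp_all del: right_minus_eq)
    next
      case False
      with l q(2) have 3: "length q = 3" by simp
      then have *: "[q ! 0, q ! 1, q ! 2] = q"
        by (intro nth_equalityI) (auto simp: less_Suc_eq eval_nat_numeral)
      have "euler_sum N (\<lambda>_. 1) (pure_diagram [q ! 0, q ! 1, q ! 2]) = 0"
        "euler_sum N of_nat (pure_diagram [q ! 0, q ! 1, q ! 2]) = 0"
        using q01 3 qN[of 2] by (intro euler_sum_pure_3; simp)+
      then have "euler_sum N (\<lambda>_. 1) (pure_diagram q) = 0" "euler_sum N of_nat (pure_diagram q) = 0"
        unfolding * .
      moreover obtain p\<^sub>2 where "euler_sum N of_nat D = 0" "agrees_above D\<^sub>0 D 2 p\<^sub>2"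
        using p2 qD(2)[of 2] 3 by auto
      ultimately show ?thesis
        unfolding invar_tail_def euler_sum_diff using q01 3 l r aa[OF p(1)] aa[OF p(2)] aa[of 2 p\<^sub>2]
        by (intro conjI exI[of _ "q ! 0"] exI[of _ "q ! 1"] impI exI[of _ "q ! 2"]) auto
    qed
  qed
  then show ?thesis
    unfolding invar_def using le D'(2) order_trans by blast
qed

text \<open>The lowest degrees of the nonzero columns form a degree sequence by the two preceding
  lemmas. Columns 1 and 2 come first, because the comparison of columns 0 and 1 presupposes that
  column 2 starts above column 1.\<close>

lemma top_sequence_exists:
  assumes D: "invar D" and nz: "D i\<^sub>0 j\<^sub>0 \<noteq> 0"
  obtains q where "degree_sequence q" "length q \<le> 3"
    "\<And>i j. i < length q \<Longrightarrow> j < q ! i \<Longrightarrow> D i j = 0" "\<And>i. i < length q \<Longrightarrow> D i (q ! i) \<noteq> 0"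
    "\<And>i j. length q \<le> i \<Longrightarrow> D i j = 0"
proof -
  have big: "D i j = 0" if "i \<ge> 3" for i j
    using invarD(3)[OF D, of i j] that by force
  define l where "l i = (LEAST j. D i j \<noteq> 0)" for i
  have l: "D i (l i) \<noteq> 0" "j < l i \<Longrightarrow> D i j = 0" "l i \<le> j'" if "D i j' \<noteq> 0" for i j j'
    using that unfolding l_def by (rule LeastI, use not_less_Least in blast, use that in \<open>rule Least_le\<close>)
  have step: "(\<exists>j. D 0 j \<noteq> 0) \<and> l 0 < l 1" if "D 1 j \<noteq> 0" "\<And>j. D 2 j \<noteq> 0 \<Longrightarrow> l 1 < j" for j
  proof -
    have "\<exists>j<l 1. D 0 j \<noteq> 0"
      using l[OF that(1)] that(2) by (intro column0_below_column1[OF D]) fastforce+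
    then show ?thesis using l(3) by (meson order_le_less_trans)
  qed
  consider (3) j where "D 2 j \<noteq> 0" | (2) j where "D 1 j \<noteq> 0" "\<And>j. D 2 j = 0"
    | (1) "\<And>j. D 1 j = 0" "\<And>j. D 2 j = 0" by blast
  then show ?thesis
  proof cases
    case 3
    obtain j1 where j1: "j1 < l 2" "D 1 j1 \<noteq> 0"
      using column1_below_column2[OF D l(1)[OF 3] l(2)[OF 3]] by blast
    then have "l 1 < l 2" using l(3) by (meson order_le_less_trans)
    moreover obtain j where "D 0 j \<noteq> 0" "l 0 < l 1"
      using step[OF j1(2)] l(3)[of 2] \<open>l 1 < l 2\<close> by (meson order_less_le_trans)
    ultimately show ?thesis
      using l[OF 3] l[OF j1(2)] l[of 0 j] big
      by (intro that[of "[l 0, l 1, l 2]"])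
         (auto simp: degree_sequence_def less_Suc_eq eval_nat_numeral)
  next
    case 2
    obtain j where "D 0 j \<noteq> 0" "l 0 < l 1"
      using step[OF 2(1)] 2(2) by metis
    moreover have "D i j = 0" if "i \<ge> 2" for i j
      using big[of i j] 2(2)[of j] that by (cases "i = 2") auto
    ultimately show ?thesis
      using l[OF 2(1)] l[of 0 j]
      by (intro that[of "[l 0, l 1]"]) (auto simp: degree_sequence_def less_Suc_eq eval_nat_numeral)
  next
    case 1
    have z: "D i j = 0" if "i \<ge> 1" for i j
      using big[of i j] 1 that by (cases "i = 1"; cases "i = 2") auto
    with nz have "i\<^sub>0 = 0" by (metis less_one linorder_not_le)
    with nz l[of 0 j\<^sub>0] z show ?thesis
      by (intro that[of "[l 0]"]) (auto simp: degree_sequence_def Suc_le_eq)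
  qed
qed

lemma pure_chain_invar: "invar D \<Longrightarrow> \<exists>xs. pure_chain D xs"
proof (induction "card {(i, j). D i j \<noteq> 0}" arbitrary: D rule: less_induct)
  case less
  note D = \<open>invar D\<close>
  show ?case
  proof (cases "\<exists>i j. D i j \<noteq> 0")
    case False
    then have "pure_chain D []" by (simp add: pure_chain_def)
    then show ?thesis by blast
  next
    case True
    then obtain i\<^sub>0 j\<^sub>0 where "D i\<^sub>0 j\<^sub>0 \<noteq> 0" by blast
    then obtain q where q: "degree_sequence q" "length q \<le> 3"
      "\<And>i j. i < length q \<Longrightarrow> j < q ! i \<Longrightarrow> D i j = 0" "\<And>i. i < length q \<Longrightarrow> D i (q ! i) \<noteq> 0"
      "\<And>i j. length q \<le> i \<Longrightarrow> D i j = 0"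
      using top_sequence_exists[OF D] by metis
    have "D i (q ! i) > 0" if "i < length q" for i
      using invarD(1)[OF D, of i "q ! i"] q(4)[OF that] by simp
    then obtain \<alpha> i where \<alpha>: "\<alpha> > 0" "i < length q" "D i (q ! i) = \<alpha> * pure_diagram q i (q ! i)"
      "\<And>i j. \<alpha> * pure_diagram q i j \<le> D i j"
      using peel_pure_diagram[OF q(1), of D] invarD(1)[OF D] by metis
    let ?D = "\<lambda>i j. D i j - \<alpha> * pure_diagram q i j"
    have inv: "invar ?D" using invar_step[OF D q] \<alpha> by blast
    have "{(i, j). ?D i j \<noteq> 0} \<subset> {(i, j). D i j \<noteq> 0}"
    proof
      show "{(i, j). ?D i j \<noteq> 0} \<subseteq> {(i, j). D i j \<noteq> 0}"
      proof clarify
        fix i j assume "?D i j \<noteq> 0" "D i j = 0"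
        moreover have "0 \<le> \<alpha> * pure_diagram q i j"
          using \<alpha>(1) pure_diagram_nonneg by simp
        ultimately show False using \<alpha>(4)[of i j] by simp
      qed
      have "(i, q ! i) \<in> {(i, j). D i j \<noteq> 0} - {(i, j). ?D i j \<noteq> 0}"
        using \<alpha>(3) q(4)[OF \<alpha>(2)] by simp
      then show "{(i, j). ?D i j \<noteq> 0} \<noteq> {(i, j). D i j \<noteq> 0}" by blast
    qed
    moreover have "finite {(i, j). D i j \<noteq> 0}"
    proof (rule finite_subset)
      show "{(i, j). D i j \<noteq> 0} \<subseteq> {..3} \<times> {..N + 3}"
        using invarD(3)[OF D] by fastforce
    qed simp
    ultimately obtain xs where "pure_chain ?D xs"
      using less.hyps[OF _ inv] psubset_card_mono by blast
    then have "pure_chain D ((\<alpha>, q) # xs)"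
    proof (rule pure_chain_ConsI[where D = D, OF _ \<alpha>(1) q(1) _ \<alpha>(2,3)])
      fix i j assume "D i j \<noteq> 0"
      with q(3,5) show "i < length q \<and> q ! i \<le> j" by (meson not_less)
    qed
    then show ?thesis by blast
  qed
qed

lemma pure_chain_exists: "\<exists>xs. pure_chain D\<^sub>0 xs"
  using pure_chain_invar[OF invar_initial] .

end

section \<open>Splitting off the shifted pure diagrams of length 3\<close>

lemma deg_seq_less_map_Suc: "deg_seq_less d e \<Longrightarrow> deg_seq_less (map Suc d) (map Suc e)"
  using deg_seq_lessD[of d e]
  by (intro deg_seq_lessI) (auto simp: inj_map_eq_map)

lemma euler_sum_diff_sum:
  assumes "finite S"
  shows "euler_sum N f (\<lambda>i j. D i j - (\<Sum>s\<in>S. c s * D' s i j)) =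
    euler_sum N f D - (\<Sum>s\<in>S. c s * euler_sum N f (D' s))"
  using assms
proof (induction S)
  case (insert x S)
  have "euler_sum N f (\<lambda>i j. D i j - (\<Sum>s\<in>insert x S. c s * D' s i j)) =
    euler_sum N f (\<lambda>i j. D i j - (\<Sum>s\<in>S. c s * D' s i j) - c x * D' x i j)"
    using insert.hyps by (simp add: algebra_simps)
  also have "\<dots> = euler_sum N f D - (\<Sum>s\<in>S. c s * euler_sum N f (D' s)) - c x * euler_sum N f (D' x)"
    by (subst euler_sum_diff) (simp add: insert.IH)
  finally show ?case using insert.hyps by simp
qed simp

text \<open>A pair [u, v] puts 1 into column 0 at u and 1 into column 1 at the later degree v, and a
  single entry misses column 1. This is the source of the assumption \<open>low\<close> of
  \<open>linear_tail\<close>.\<close>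

lemma short_pure_column_sums:
  assumes "degree_sequence d" "length d < 3"
  shows "(\<Sum>j\<le>f. pure_diagram d 1 j) \<le> (\<Sum>j<f. pure_diagram d 0 j)"
proof (cases "length d = 2")
  case True
  then obtain u v where d: "d = [u, v]"
    by (auto simp: length_Suc_conv eval_nat_numeral)
  with assms have uv: "u < v" by (simp add: degree_sequence_def)
  have p1: "pure_diagram d 1 j = (if j = v then 1 else 0)" for j
    using pure_diagram_length_2[OF uv] by (auto simp: d pure_diagram_eq_0)
  have p0: "pure_diagram d 0 j = (if j = u then 1 else 0)" for j
    using pure_diagram_length_2[OF uv] by (auto simp: d pure_diagram_eq_0)
  show ?thesis
    unfolding p0 p1 using uv by simp
next
  case False
  with assms(2) have "pure_diagram d 1 j = 0" for j
    by (intro pure_diagram_eq_0) auto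
  then show ?thesis
    by (simp add: sum_nonneg pure_diagram_nonneg)
qed

lemma short_pure_list_column_sums:
  assumes "\<forall>(c, d)\<in>set xs. c > 0 \<and> degree_sequence d \<and> length d < 3"
  shows "(\<Sum>j\<le>f. \<Sum>(c, d)\<leftarrow>xs. c * pure_diagram d 1 j) \<le> (\<Sum>j<f. \<Sum>(c, d)\<leftarrow>xs. (c::rat) * pure_diagram d 0 j)"
  using assms
proof (induction xs)
  case (Cons x xs)
  obtain c d where x: "x = (c, d)" by fastforce
  have "c * (\<Sum>j\<le>f. pure_diagram d 1 j) \<le> c * (\<Sum>j<f. pure_diagram d 0 j)"
    using short_pure_column_sums[of d f] Cons.prems x by (intro mult_left_mono) auto
  with Cons x show ?case
    by (simp add: sum.distrib sum_distrib_left add_mono)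
qed simp

lemma pure_chain_head_less:
  assumes "pure_chain D ((c, q) # ys)" "(c', q') \<in> set ys"
  shows "deg_seq_less q q'"
proof -
  have "sorted_wrt deg_seq_less (q # map snd ys)"
    using assms(1) by (simp add: pure_chain_def)
  with assms(2) show ?thesis by auto
qed

text \<open>Only the head of \<open>xs\<close> can equal \<open>e t\<close>, all other members being
  strictly above the head. So at most the coefficient at \<open>t\<close> changes, and it can only
  grow.\<close>

lemma pure_chain_prepend:
  fixes D\<^sub>0 :: diagram
  assumes xs: "pure_chain D\<^sub>0 xs"
    and pos: "\<And>i. i \<le> t \<Longrightarrow> \<alpha> i > 0 \<and> degree_sequence (e i)"
    and mono: "\<And>i i'. i < i' \<Longrightarrow> i' \<le> t \<Longrightarrow> deg_seq_less (e i) (e i')"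
    and above: "\<And>c q. (c, q) \<in> set xs \<Longrightarrow> q = e t \<or> deg_seq_less (e t) q"
    and D: "\<And>i j. D i j = (\<Sum>s\<le>t. \<alpha> s * pure_diagram (e s) i j) + D\<^sub>0 i j"
  shows "\<exists>\<alpha>' ys. pure_chain D (map (\<lambda>i. (\<alpha>' i, e i)) [0..<Suc t] @ ys) \<and> (\<forall>i<t. \<alpha>' i = \<alpha> i) \<and>
    \<alpha> t \<le> \<alpha>' t \<and> (\<forall>(c, q)\<in>set ys. deg_seq_less (e t) q)"
proof -
  have *: "pure_chain D (map (\<lambda>i. (\<alpha>' i, e i)) [0..<Suc t] @ ys)"
    if ys: "pure_chain D' ys" "\<forall>(c, q)\<in>set ys. deg_seq_less (e t) q" and \<alpha>': "\<And>i. i \<le> t \<Longrightarrow> \<alpha>' i > 0"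
      and D': "\<And>i j. D i j = (\<Sum>s\<le>t. \<alpha>' s * pure_diagram (e s) i j) + D' i j" for \<alpha>' ys D'
  proof -
    have "deg_seq_less (e i) q" if "(c, q) \<in> set ys" "i \<le> t" for i c q
      using that ys(2) mono[of i t] deg_seq_less_trans[of "e i" "e t" q] by (cases "i = t") auto
    moreover have "sorted_wrt deg_seq_less (map e [0..<Suc t])"
      using mono by (auto simp: sorted_wrt_iff_nth_less simp del: upt_Suc)
    moreover have "D i j = (\<Sum>(\<alpha>, d)\<leftarrow>map (\<lambda>i. (\<alpha>' i, e i)) [0..<Suc t] @ ys. \<alpha> * pure_diagram d i j)" for i j
    proof -
      have "(\<Sum>s\<le>t. \<alpha>' s * pure_diagram (e s) i j) = (\<Sum>s\<leftarrow>[0..<Suc t]. \<alpha>' s * pure_diagram (e s) i j)"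
        by (simp add: interv_sum_list_conv_sum_set_nat atLeast0AtMost atLeastLessThanSuc_atLeastAtMost del: upt_Suc)
      with ys(1) D' show ?thesis by (simp add: pure_chain_def o_def del: upt_Suc)
    qed
    ultimately show ?thesis
      using ys(1) \<alpha>' pos unfolding pure_chain_def
      by (intro conjI allI) (auto simp: sorted_wrt_append less_Suc_eq_le o_def simp del: upt_Suc)
  qed
  show ?thesis
  proof (cases "\<exists>\<gamma> ys. xs = (\<gamma>, e t) # ys")
    case True
    then obtain \<gamma> ys where xs_eq: "xs = (\<gamma>, e t) # ys" by blast
    note c = pure_chain_Cons[OF xs[unfolded xs_eq]]
    have above': "\<forall>(c, q)\<in>set ys. deg_seq_less (e t) q"
      using pure_chain_head_less[OF xs[unfolded xs_eq]] by blast
    have "pure_chain D (map (\<lambda>i. ((\<alpha>(t := \<alpha> t + \<gamma>)) i, e i)) [0..<Suc t] @ ys)"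
    proof (rule *[OF c(1) above'])
      show "D i j = (\<Sum>s\<le>t. (\<alpha>(t := \<alpha> t + \<gamma>)) s * pure_diagram (e s) i j)
          + (D\<^sub>0 i j - \<gamma> * pure_diagram (e t) i j)" for i j
      proof -
        have "(\<alpha>(t := \<alpha> t + \<gamma>)) s * pure_diagram (e s) i j = \<alpha> s * pure_diagram (e s) i j +
          (if s = t then \<gamma> * pure_diagram (e t) i j else 0)" for s
          by (simp add: distrib_right)
        then show ?thesis
          unfolding D by (simp add: sum.distrib)
      qed
    qed (use pos c(2) in \<open>auto intro: add_pos_pos\<close>)
    with above' c(2) show ?thesis
      by (intro exI[of _ "\<alpha>(t := \<alpha> t + \<gamma>)"] exI[of _ ys]) auto
  next
    case False
    have "deg_seq_less (e t) q" if "(c, q) \<in> set xs" for c q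
    proof (cases xs)
      case (Cons x zs)
      obtain c' q' where x: "x = (c', q')" by fastforce
      with False Cons above have "deg_seq_less (e t) q'" by auto
      moreover have "q = q' \<or> deg_seq_less q' q"
        using that pure_chain_head_less[OF xs[unfolded Cons x]] by (auto simp: Cons x)
      ultimately show ?thesis using deg_seq_less_trans by blast
    qed (use that in simp)
    then show ?thesis
      using *[OF xs _ _ D] pos by (intro exI[of _ \<alpha>] exI[of _ xs]) auto
  qed
qed

text \<open>Meant for \<open>B\<close> = \<beta>(\<aa>) and \<open>D\<close> = \<beta>(L), with
  \<open>E\<close> the contribution of the generators free of x: y^A and, in degree e,
  \<open>n e\<close> generators divisible by z. The remainder consists of \<open>E\<close> and the
  shifted short part of \<open>B\<close>; it inherits both relations because the subtracted diagrams
  of length 3 satisfy their homogeneous versions.\<close>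

lemma shifted_decomposition:
  fixes B E D :: diagram and n :: "nat \<Rightarrow> rat"
  assumes chain: "pure_chain B (map (\<lambda>i. (\<alpha> i, d i)) [0..<Suc t] @ R)"
    and len: "\<forall>i\<le>t. length (d i) = 3" "\<forall>(c, e)\<in>set R. length e \<noteq> 3"
    and B: "\<And>i j. B i j \<noteq> 0 \<Longrightarrow> i < 3 \<and> j < A + i"
    and E0: "\<And>e. E 0 e = (if e = A then 1 else 0) + n e"
    and E1: "\<And>j. E 1 j = (case j of 0 \<Rightarrow> 0 | Suc e \<Rightarrow> (if e = A then 1 else 0) + 2 * n e)"
    and E2: "\<And>j. E 2 j = (case j of Suc (Suc e) \<Rightarrow> n e | _ \<Rightarrow> 0)"
    and E3: "\<And>i j. 3 \<le> i \<Longrightarrow> E i j = 0"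
    and n: "\<And>e. n e \<ge> 0" "\<And>e. n e \<noteq> 0 \<Longrightarrow> A \<le> e \<and> e \<le> N" and N: "A \<le> N"
    and D: "\<And>i j. D i j = (case j of 0 \<Rightarrow> 0 | Suc j' \<Rightarrow> B i j') + E i j"
    and rank: "euler_sum N (\<lambda>_. 1) D = 1"
    and moment: "euler_sum N of_nat D = 0"
  shows "\<exists>\<alpha>' ys. pure_chain D (map (\<lambda>i. (\<alpha>' i, map Suc (d i))) [0..<Suc t] @ ys) \<and>
    (\<forall>i<t. \<alpha>' i = \<alpha> i) \<and> \<alpha> t \<le> \<alpha>' t \<and> (\<forall>(c, q)\<in>set ys. deg_seq_less (map Suc (d t)) q)"
proof -
  define S where "S i j = (\<Sum>(c, e)\<leftarrow>R. c * pure_diagram (map Suc e) i j)" for i j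
  define D\<^sub>0 where "D\<^sub>0 i j = S i j + E i j" for i j
  have all: "c > 0 \<and> degree_sequence e" if "(c, e) \<in> set (map (\<lambda>i. (\<alpha> i, d i)) [0..<Suc t] @ R)" for c e
    using chain that unfolding pure_chain_def by blast
  have R: "c > 0 \<and> degree_sequence e" if "(c, e) \<in> set R" for c e
    using that by (intro all) simp
  have mem: "(\<alpha> i, d i) \<in> set (map (\<lambda>i. (\<alpha> i, d i)) [0..<Suc t] @ R)" if "i \<le> t" for i
    using that by (auto simp del: upt_Suc)
  have d: "\<alpha> i > 0 \<and> degree_sequence (d i)" if "i \<le> t" for i
    using all[OF mem[OF that]] .
  have R_supp: "e ! i < A + i \<and> i < 3" if "(c, e) \<in> set R" "i < length e" for c e i
    using pure_chain_support[OF chain, of c e i] B[of i "e ! i"] that by simp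
  \<comment> \<open>Lengths above 3 are excluded as well, since \<open>B\<close> has no column
    beyond 2.\<close>
  have R_len: "length e < 3" if "(c, e) \<in> set R" for c e
    using R[OF that] R_supp[OF that, of "length e - 1"] len(2) that
    by (fastforce simp: degree_sequence_def)
  have d_supp: "d s ! i < A + i" if "s \<le> t" "i < 3" for s i
    using pure_chain_support[OF chain mem[OF that(1)], of i] B[of i "d s ! i"] that len by simp
  have S_eq: "S i j = (\<Sum>(c, e)\<leftarrow>map (\<lambda>(c, e). (c, map Suc e)) R. c * pure_diagram e i j)" for i j
    unfolding S_def by (induction R) auto
  have S_nonneg: "S i j \<ge> 0" for i j
    unfolding S_eq using R by (intro sum_pure_nonneg) auto
  have S_supp: "\<exists>c e. (c, e) \<in> set R \<and> i < length e \<and> j = Suc (e ! i)" if "S i j \<noteq> 0" for i j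
  proof (rule ccontr)
    assume "\<not> ?thesis"
    then have "S i j = 0" unfolding S_eq by (intro sum_pure_zero) force
    with that show False by simp
  qed
  \<comment> \<open>The strict bound on \<open>B\<close> turns into A + i after the shift, so the
    short part ends exactly where \<open>tail0\<close> and \<open>tail1\<close> take over.\<close>
  have S0: "S i j = 0" if "i \<ge> 2 \<or> j < Suc i \<or> A + i < j" for i j
  proof (rule ccontr)
    assume "S i j \<noteq> 0"
    then obtain c e where e: "(c, e) \<in> set R" "i < length e" "j = Suc (e ! i)"
      using S_supp by blast
    with R_supp[OF e(1,2)] R_len[OF e(1)] degree_sequence_nth_ge[of e i] R[OF e(1)] that
    show False by auto
  qed
  have E_nonneg: "E i j \<ge> 0" for i j
  proof -
    consider "i = 0" | "i = 1" | "i = 2" | "i \<ge> 3" by linarith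
    then show ?thesis
      by cases (auto simp: E0 E1[unfolded One_nat_def] E2 E3 n split: nat.splits)
  qed
  have E_supp: "i < 3 \<and> A + i \<le> j \<and> j \<le> N + i" if "E i j \<noteq> 0" for i j
  proof -
    consider "i = 0" | "i = 1" | "i = 2" | "i \<ge> 3" by linarith
    then show ?thesis
    proof cases
      case 1
      with that n(2)[of j] N show ?thesis by (auto simp: E0 split: if_splits)
    next
      case 2
      with that n(2)[of "j - 1"] N show ?thesis by (auto simp: E1[unfolded One_nat_def] split: nat.splits if_splits)
    next
      case 3
      with that n(2)[of "j - 2"] N show ?thesis by (auto simp: E2 split: nat.splits if_splits)
    qed (use that E3 in blast)
  qed
  have D_eq: "D i j = (\<Sum>s\<le>t. \<alpha> s * pure_diagram (map Suc (d s)) i j) + D\<^sub>0 i j" for i j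
  proof (cases j)
    case 0
    then show ?thesis
      using S0[of i 0] by (simp add: D D\<^sub>0_def pure_diagram_map_Suc)
  next
    case (Suc j')
    have "B i j' = (\<Sum>s\<leftarrow>[0..<Suc t]. \<alpha> s * pure_diagram (d s) i j') + (\<Sum>(c, e)\<leftarrow>R. c * pure_diagram e i j')"
      using chain by (simp add: pure_chain_def o_def del: upt_Suc)
    with Suc show ?thesis
      by (simp add: D D\<^sub>0_def pure_diagram_map_Suc S_def interv_sum_list_conv_sum_set_nat
          atLeast0AtMost atLeastLessThanSuc_atLeastAtMost del: upt_Suc)
  qed
  \<comment> \<open>Used for both weights. The cut-off at N loses nothing, since the largest shifted
    degree is at most A + 2.\<close>
  have euler: "euler_sum N f D\<^sub>0 = euler_sum N f D"
    if f: "\<And>u v w. u < v \<Longrightarrow> v < w \<Longrightarrow> w \<le> N + 2 \<Longrightarrow> euler_sum N f (pure_diagram [u, v, w]) = 0" for f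
  proof -
    have "euler_sum N f (pure_diagram (map Suc (d s))) = 0" if "s \<le> t" for s
    proof -
      have "length (d s) = 3" using len(1) that by blast
      then obtain u v w where uvw: "d s = [u, v, w]"
        by (auto simp: length_Suc_conv eval_nat_numeral)
      then have "u < v" "v < w"
        using d[OF that] by (auto simp: degree_sequence_def)
      moreover have "w < A + 2"
        using d_supp[OF that, of 2] uvw by simp
      ultimately show ?thesis
        using N f[of "Suc u" "Suc v" "Suc w"] by (simp add: uvw)
    qed
    then have "euler_sum N f (\<lambda>i j. D i j - (\<Sum>s\<le>t. \<alpha> s * pure_diagram (map Suc (d s)) i j)) = euler_sum N f D"
      by (subst euler_sum_diff_sum) simp_all
    moreover have "(\<lambda>i j. D i j - (\<Sum>s\<le>t. \<alpha> s * pure_diagram (map Suc (d s)) i j)) = D\<^sub>0"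
      by (simp add: D_eq)
    ultimately show ?thesis by simp
  qed
  interpret linear_tail D\<^sub>0 n A N
  proof
    show "D\<^sub>0 i j \<ge> 0" for i j
      using S_nonneg E_nonneg by (simp add: D\<^sub>0_def)
    show "i < 3 \<and> i \<le> j \<and> j \<le> N + i" if "D\<^sub>0 i j \<noteq> 0" for i j
    proof (cases "E i j = 0")
      case True
      with that have "S i j \<noteq> 0" by (simp add: D\<^sub>0_def)
      with S0[of i j] N show ?thesis by linarith
    qed (use E_supp[of i j] in auto)
    show "n e = 0" if "e < A" for e using n(2)[of e] that by linarith
    show "D\<^sub>0 2 (Suc (Suc e)) = n e" for e
      using S0[of 2] by (simp add: D\<^sub>0_def E2)
    show "D\<^sub>0 0 e = n e" if "A < e" for e
      using S0[of 0 e] that by (simp add: D\<^sub>0_def E0)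
    show "D\<^sub>0 (Suc 0) (Suc e) = 2 * n e" if "A < e" for e
      using S0[of "Suc 0" "Suc e"] that by (simp add: D\<^sub>0_def E1[unfolded One_nat_def])
    show "(\<Sum>j\<le>f. D\<^sub>0 1 j) \<le> (\<Sum>j<f. D\<^sub>0 0 j)" if "f \<le> A" for f
    proof -
      \<comment> \<open>\<open>E\<close> enters column 1 only from degree A + 1 on, hence above
        \<open>f\<close>.\<close>
      have "(\<Sum>j\<le>f. D\<^sub>0 1 j) = (\<Sum>j\<le>f. S 1 j)"
        unfolding D\<^sub>0_def using E_supp[of 1] that by (intro sum.cong) force+
      also have "\<dots> \<le> (\<Sum>j<f. S 0 j)"
        unfolding S_eq using R R_len degree_sequence_map_Suc
        by (intro short_pure_list_column_sums) auto
      also have "\<dots> \<le> (\<Sum>j<f. D\<^sub>0 0 j)"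
        unfolding D\<^sub>0_def using E_nonneg by (intro sum_mono) simp
      finally show ?thesis .
    qed
    show "euler_sum N (\<lambda>_. 1) D\<^sub>0 = 1" "euler_sum N of_nat D\<^sub>0 = 0"
      using euler euler_sum_pure_3 rank moment by simp_all
  qed
  obtain xs where xs: "pure_chain D\<^sub>0 xs" using pure_chain_exists by blast
  have sorted: "sorted_wrt deg_seq_less (map d [0..<Suc t] @ map snd R)"
    using chain by (simp add: pure_chain_def o_def del: upt_Suc)
  show ?thesis
  proof (rule pure_chain_prepend[OF xs _ _ _ D_eq])
    show "\<alpha> i > 0 \<and> degree_sequence (map Suc (d i))" if "i \<le> t" for i
      using d[OF that] degree_sequence_map_Suc by blast
    show "deg_seq_less (map Suc (d i)) (map Suc (d i'))" if "i < i'" "i' \<le> t" for i i'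
    proof -
      have "sorted_wrt deg_seq_less (map d [0..<Suc t])"
        using sorted unfolding sorted_wrt_append by blast
      then have "deg_seq_less (map d [0..<Suc t] ! i) (map d [0..<Suc t] ! i')"
        by (rule sorted_wrt_nth_less) (use that in auto)
      then show ?thesis using that by (intro deg_seq_less_map_Suc) (simp del: upt_Suc)
    qed
    show "q = map Suc (d t) \<or> deg_seq_less (map Suc (d t)) q" if q: "(c, q) \<in> set xs" for c q
    proof -
      have nz: "D\<^sub>0 i (q ! i) \<noteq> 0" if "i < length q" for i
        using pure_chain_support[OF xs q that] by simp
      have "q \<noteq> []" using xs q by (auto simp: pure_chain_def degree_sequence_def)
      then have len_q: "length q \<le> 3"
        using nz[of "length q - 1"] supp by fastforce
      \<comment> \<open>An entry of the remainder comes either from \<open>R\<close>, whose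
        sequences lie above \<open>d t\<close>, or from \<open>E\<close>, which starts in degree A +
        i, while d t ! i < A + i.\<close>
      have "map Suc (d t) ! i \<le> q ! i" if i: "i < length q" for i
      proof (cases "E i (q ! i) = 0")
        case True
        with nz[OF i] obtain c' e where e: "(c', e) \<in> set R" "i < length e" "q ! i = Suc (e ! i)"
          using S_supp by (force simp: D\<^sub>0_def)
        then have "deg_seq_less (d t) e"
          using sorted by (force simp: sorted_wrt_append)
        with e len i len_q show ?thesis using deg_seq_lessD(2)[of "d t" e i] by simp
      next
        case False
        then show ?thesis
          using E_supp[OF False] d_supp[of t i] i len_q len(1) by simp
      qed
      with len_q len(1) show ?thesis
        using deg_seq_lessI[of q "map Suc (d t)"] by fastforce
    qed
  qed
qed

section \<open>Monomials and homogeneous matrices\<close>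

abbreviation keys :: "('a \<Rightarrow>\<^sub>0 'b::zero) \<Rightarrow> 'a set" where "keys \<equiv> Poly_Mapping.keys"

abbreviation lookup :: "('a \<Rightarrow>\<^sub>0 'b::zero) \<Rightarrow> 'a \<Rightarrow> 'b" where "lookup \<equiv> Poly_Mapping.lookup"

abbreviation single :: "'a \<Rightarrow> 'b \<Rightarrow> 'a \<Rightarrow>\<^sub>0 'b::zero" where "single \<equiv> Poly_Mapping.single"

lemma poly_mapping_sum_singles:
  "f = (\<Sum>k\<in>keys f. single k (lookup f k))"
proof (rule poly_mapping_eqI)
  fix k
  have "lookup (\<Sum>k\<in>keys f. single k (lookup f k)) k =
      (\<Sum>k'\<in>keys f. if k' = k then lookup f k else 0)"
    unfolding lookup_sum by (intro sum.cong) (auto simp: lookup_single when_def)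
  also have "\<dots> = lookup f k"
    by (simp add: in_keys_iff)
  finally show "lookup f k =
    lookup (\<Sum>k\<in>keys f. single k (lookup f k)) k" ..
qed

definition mono_le :: "mono3 \<Rightarrow> mono3 \<Rightarrow> bool" where
  "mono_le m n \<longleftrightarrow> (\<exists>u. n = m + u)"

lemma mono_le_iff [simp]: "mono_le (a, b, c) (a', b', c') \<longleftrightarrow> a \<le> a' \<and> b \<le> b' \<and> c \<le> c'"
proof
  assume "a \<le> a' \<and> b \<le> b' \<and> c \<le> c'"
  then have "(a', b', c') = (a, b, c) + (a' - a, b' - b, c' - c)" by simp
  then show "mono_le (a, b, c) (a', b', c')" unfolding mono_le_def by blast
next
  assume "mono_le (a, b, c) (a', b', c')"
  then obtain u where "(a', b', c') = (a, b, c) + u" unfolding mono_le_def by blast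
  then show "a \<le> a' \<and> b \<le> b' \<and> c \<le> c'" by (cases u) simp
qed

lemma mono_le_refl [simp]: "mono_le m m" by (cases m) simp

lemma mono_le_add [simp]: "mono_le m (m + u)" "mono_le m (u + m)"
  unfolding mono_le_def by (blast, metis add.commute)

lemma mono_le_trans: "mono_le l m \<Longrightarrow> mono_le m n \<Longrightarrow> mono_le l n"
  by (cases l; cases m; cases n) auto

lemma mono_zero_iff: "(a, b, c) = (0::mono3) \<longleftrightarrow> a = 0 \<and> b = 0 \<and> c = 0"
  by (simp add: zero_prod_def)

lemma mono_add_eq_0: "a + b = (0::mono3) \<longleftrightarrow> a = 0 \<and> b = 0"
  by (cases a; cases b) (auto simp: mono_zero_iff)

lemma mdeg_add [simp]: "mdeg (a + b) = mdeg a + mdeg b"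
  by (cases a; cases b) auto

lemma mdeg_zero [simp]: "mdeg 0 = 0"
  by (simp add: zero_prod_def)

lemma mono_le_mdeg: "mono_le m n \<Longrightarrow> mdeg m \<le> mdeg n"
  by (cases m; cases n) auto

lemma mono_le_mdeg_eq: "mono_le m n \<Longrightarrow> mdeg m = mdeg n \<Longrightarrow> m = n"
  by (cases m; cases n) auto

lemma lookup_single_mult:
  fixes f :: "'k::field poly3"
  shows "lookup (single a c * f) (a + k) = c * lookup f k"
proof -
  have "single a c * f = (\<Sum>k\<in>keys f. single (a + k) (c * lookup f k))"
    by (subst (1) poly_mapping_sum_singles[of f]) (simp add: sum_distrib_left mult_single)
  then have "lookup (single a c * f) (a + k) =
      (\<Sum>k'\<in>keys f. if k' = k then c * lookup f k else 0)"
    unfolding lookup_sum by (auto simp: lookup_single when_def lookup_sum intro!: sum.cong)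
  then show ?thesis by (simp add: in_keys_iff)
qed

lemma lookup_single_mult_0:
  fixes f :: "'k::field poly3"
  assumes "\<not> mono_le a k"
  shows "lookup (single a c * f) k = 0"
proof (rule ccontr)
  assume "\<not> ?thesis"
  then have "k \<in> keys (single a c * f)" by (simp add: in_keys_iff)
  then obtain b where "k = a + b"
    using keys_mult[of "single a c" f] by (auto split: if_splits)
  with assms show False by simp
qed

lemma keys_mon [simp]: "keys (mon m :: 'k::field poly3) = {m}"
  by (simp add: mon_def)

lemma mon_mult: "mon m * mon n = (mon (m + n) :: 'k::field poly3)"
  by (simp add: mon_def mult_single)

lemma mon_mult_eq_0: "mon m * f = (0 :: 'k::field poly3) \<Longrightarrow> f = 0"
  by (rule poly_mapping_eqI) (metis lookup_single_mult lookup_zero mon_def mult_1)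

lemma keys_mon_mult: "keys (mon m * f :: 'k::field poly3) = (+) m ` keys f"
proof
  show "keys (mon m * f) \<subseteq> (+) m ` keys f"
    using keys_mult[of "mon m" f] unfolding keys_mon by blast
  show "(+) m ` keys f \<subseteq> keys (mon m * f)"
    by (auto simp: in_keys_iff mon_def lookup_single_mult)
qed

lemma mon_dvd_iff: "(mon m :: 'k::field poly3) dvd mon n \<longleftrightarrow> mono_le m n"
proof
  assume "(mon m :: 'k poly3) dvd mon n"
  then obtain f :: "'k poly3" where "mon n = mon m * f" by (auto simp: dvd_def)
  then have "n \<in> (+) m ` keys f"
    using keys_mon_mult[of m f] by (metis keys_mon insertI1)
  then show "mono_le m n" by auto
next
  assume "mono_le m n"
  then obtain u where "n = m + u" by (auto simp: mono_le_def)
  then show "(mon m :: 'k poly3) dvd mon n" by (auto simp: mon_mult[symmetric])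
qed

text \<open>The condition on the right defines an ideal containing the generators; conversely every
  term of \<open>f\<close> is a multiple of one of them.\<close>

lemma mem_monomial_span_iff:
  fixes f :: "'k::field poly3"
  shows "f \<in> ideal_gen (mon ` S) \<longleftrightarrow> (\<forall>k\<in>keys f. \<exists>s\<in>S. mono_le s k)"
proof
  let ?P = "{f :: 'k poly3. \<forall>k\<in>keys f. \<exists>s\<in>S. mono_le s k}"
  have "is_ideal ?P"
  proof (rule module.subspaceI[OF module_self])
    show "x + y \<in> ?P" if "x \<in> ?P" "y \<in> ?P" for x y
      using that keys_add[of x y] by blast
    show "c * x \<in> ?P" if "x \<in> ?P" for c x
    proof clarify
      fix k assume "k \<in> keys (c * x)"
      then obtain a b where "k = a + b" "b \<in> keys x"
        using keys_mult[of c x] by blast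
      with that show "\<exists>s\<in>S. mono_le s k"
        by (blast intro: mono_le_trans mono_le_add)
    qed
  qed simp
  moreover have "mon ` S \<subseteq> ?P"
    unfolding image_subset_iff mem_Collect_eq keys_mon by (blast intro: mono_le_refl)
  moreover assume "f \<in> ideal_gen (mon ` S)"
  ultimately show "\<forall>k\<in>keys f. \<exists>s\<in>S. mono_le s k"
    using module.span_minimal[OF module_self, of "mon ` S" ?P] by blast
next
  assume R: "\<forall>k\<in>keys f. \<exists>s\<in>S. mono_le s k"
  have "single k c \<in> ideal_gen (mon ` S)" if k: "k \<in> keys f" for k c
  proof -
    obtain s u where s: "s \<in> S" "k = s + u" using R k by (auto simp: mono_le_def)
    have "single u c * mon s \<in> ideal_gen (mon ` S)"
      using s by (intro module.span_scale[OF module_self] module.span_base[OF module_self]) auto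
    then show ?thesis by (simp add: mon_def mult_single s add.commute)
  qed
  then show "f \<in> ideal_gen (mon ` S)"
    by (subst poly_mapping_sum_singles) (intro module.span_sum[OF module_self])
qed

lemma variable_ideal_iff:
  fixes f :: "'k::field poly3"
  shows "f \<in> ideal_gen {var_x, var_y, var_z} \<longleftrightarrow> lookup f 0 = 0"
proof -
  have v: "{var_x, var_y, var_z :: 'k poly3} = mon ` {(1, 0, 0), (0, 1, 0), (0, 0, 1)}"
    by (simp add: var_x_def var_y_def var_z_def)
  have "(\<exists>s\<in>{(1, 0, 0), (0, 1, 0), (0, 0, 1)}. mono_le s k) \<longleftrightarrow> k \<noteq> 0" for k
    by (cases k) (auto simp: mono_zero_iff Suc_le_eq)
  then show ?thesis
    unfolding v mem_monomial_span_iff by (auto simp: in_keys_iff)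
qed

text \<open>Exponent vectors add up to 0 only trivially, so taking the constant term is reduction
  modulo (x, y, z).\<close>

lemma lookup_0_mult:
  fixes f g :: "'k::field poly3"
  shows "lookup (f * g) 0 = lookup f 0 * lookup g 0"
proof -
  have z: "lookup (h * g) 0 = 0" if "lookup h 0 = 0" for h :: "'k poly3"
  proof (rule ccontr)
    assume "lookup (h * g) 0 \<noteq> 0"
    then have "0 \<in> keys (h * g)" by (simp add: in_keys_iff)
    then obtain a b where "0 = a + b" "a \<in> keys h"
      using keys_mult[of h g] by blast
    with that show False by (metis mono_add_eq_0 in_keys_iff)
  qed
  define h where "h = f - single 0 (lookup f 0)"
  have "f * g = h * g + single 0 (lookup f 0) * g"
    by (simp add: h_def algebra_simps)
  moreover have "lookup h 0 = 0" by (simp add: h_def lookup_minus)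
  ultimately show ?thesis
    using z[of h] lookup_single_mult[of 0 "lookup f 0" g 0] by (simp add: lookup_add)
qed

section \<open>Homogeneous components, vectors and matrices\<close>

definition hpart :: "(mono3 \<Rightarrow> bool) \<Rightarrow> 'k::field poly3 \<Rightarrow> 'k poly3" where
  "hpart P f = Poly_Mapping.mapp (\<lambda>k c. if P k then c else 0) f"

lemma lookup_hpart: "lookup (hpart P f) k = (if P k then lookup f k else 0)"
  by (auto simp: hpart_def lookup_mapp when_def in_keys_iff)

lemma keys_hpart: "keys (hpart P f) = {k \<in> keys f. P k}"
  unfolding set_eq_iff by (simp add: in_keys_iff lookup_hpart del: split_paired_All)

lemma hpart_sum: "hpart P (sum f A) = (\<Sum>a\<in>A. hpart P (f a))"
  by (rule poly_mapping_eqI) (simp add: lookup_hpart lookup_sum)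

lemma hpart_id: "(\<And>k. k \<in> keys f \<Longrightarrow> P k) \<Longrightarrow> hpart P f = f"
  by (rule poly_mapping_eqI) (auto simp: lookup_hpart in_keys_iff)

text \<open>A factor translates monomials. If all monomials of \<open>p\<close> translate
  \<open>P\<close> to the same predicate \<open>Q\<close>, as happens for homogeneous
  \<open>p\<close>, then cutting the product amounts to cutting \<open>q\<close>.\<close>

lemma hpart_mult:
  fixes p q :: "'k::field poly3"
  assumes "\<And>a k. a \<in> keys p \<Longrightarrow> P (a + k) \<longleftrightarrow> Q k"
  shows "hpart P (p * q) = p * hpart Q q"
proof -
  have single: "hpart P (single a c * q) = single a c * hpart Q q"
    if "a \<in> keys p" for a c
  proof (rule poly_mapping_eqI)
    fix k
    show "lookup (hpart P (single a c * q)) k =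
      lookup (single a c * hpart Q q) k"
    proof (cases "mono_le a k")
      case True
      then obtain u where "k = a + u" by (auto simp: mono_le_def)
      then show ?thesis using assms[OF that] by (simp add: lookup_hpart lookup_single_mult)
    qed (simp add: lookup_hpart lookup_single_mult_0)
  qed
  have "p * q = (\<Sum>a\<in>keys p. single a (lookup p a) * q)"
    by (subst (1) poly_mapping_sum_singles[of p]) (rule sum_distrib_right)
  then have "hpart P (p * q) = (\<Sum>a\<in>keys p. single a (lookup p a) * hpart Q q)"
    by (simp add: hpart_sum single)
  also have "\<dots> = p * hpart Q q"
    by (subst (3) poly_mapping_sum_singles[of p]) (rule sum_distrib_right[symmetric])
  finally show ?thesis .
qed

text \<open>The grading is a parameter: it is \<open>mdeg\<close> for Betti numbers and the identity
  for the grading by exponent vectors in the mapping cones.\<close>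

definition hom_vec :: "(mono3 \<Rightarrow> 'g::monoid_add) \<Rightarrow> 'g list \<Rightarrow> 'g \<Rightarrow> 'k::field poly3 vec \<Rightarrow> bool" where
  "hom_vec deg d s v \<longleftrightarrow> v \<in> carrier_vec (length d) \<and>
     (\<forall>r<length d. \<forall>m\<in>keys (v $ r). deg m + d ! r = s)"

definition hom_mat :: "(mono3 \<Rightarrow> 'g::monoid_add) \<Rightarrow> 'g list \<Rightarrow> 'g list \<Rightarrow> 'k::field poly3 mat \<Rightarrow> bool" where
  "hom_mat deg e d A \<longleftrightarrow> A \<in> carrier_mat (length d) (length e) \<and>
     (\<forall>c<length e. hom_vec deg d (e ! c) (col A c))"

lemma hom_mat_entry:
  assumes "hom_mat deg e d A" "r < length d" "c < length e" "m \<in> keys (A $$ (r, c))"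
  shows "deg m + d ! r = e ! c"
proof -
  have "col A c $ r = A $$ (r, c)" using assms by (auto simp: hom_mat_def)
  moreover have "hom_vec deg d (e ! c) (col A c)" using assms by (auto simp: hom_mat_def)
  ultimately show ?thesis using assms unfolding hom_vec_def by metis
qed

lemma hom_matI:
  assumes "A \<in> carrier_mat (length d) (length e)"
    and "\<And>r c m. r < length d \<Longrightarrow> c < length e \<Longrightarrow> m \<in> keys (A $$ (r, c)) \<Longrightarrow> deg m + d ! r = e ! c"
  shows "hom_mat deg e d A"
  unfolding hom_mat_def hom_vec_def
proof (intro conjI allI impI ballI)
  fix c assume c: "c < length e"
  show "col A c \<in> carrier_vec (length d)" by (rule col_carrier_vec[OF c assms(1)])
  fix r m assume r: "r < length d" and "m \<in> keys (col A c $ r)"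
  moreover have "col A c $ r = A $$ (r, c)" using r c carrier_matD[OF assms(1)] by simp
  ultimately have "m \<in> keys (A $$ (r, c))" by simp
  with r c show "deg m + d ! r = e ! c" by (rule assms(2))
qed (rule assms(1))

lemma graded_map_eq_hom_mat: "graded_map e d A \<longleftrightarrow> hom_mat mdeg e d A"
proof
  show "hom_mat mdeg e d A" if "graded_map e d A"
    using that unfolding graded_map_def by (intro hom_matI) blast+
  show "graded_map e d A" if "hom_mat mdeg e d A"
    using that hom_mat_entry[OF that] unfolding graded_map_def hom_mat_def by blast
qed

lemma mat_mult_vec_index:
  assumes "A \<in> carrier_mat m n" "w \<in> carrier_vec n" "r < m"
  shows "(A *\<^sub>v w) $ r = (\<Sum>c<n. A $$ (r, c) * w $ c)"
  using assms by (auto simp: scalar_prod_def lessThan_atLeast0 intro!: sum.cong)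

text \<open>Replace each coordinate of an arbitrary preimage by its component of the right degree; a
  homogeneous matrix commutes with taking components.\<close>

lemma hom_lift_vec:
  fixes deg :: "mono3 \<Rightarrow> 'g::comm_monoid_add"
  assumes deg: "\<And>a b. deg (a + b) = deg a + deg b"
    and A: "hom_mat deg e d A" and v: "hom_vec deg d s v" and vA: "v \<in> mat_image A"
  shows "\<exists>w. hom_vec deg e s w \<and> A *\<^sub>v w = v"
proof -
  have Ac: "A \<in> carrier_mat (length d) (length e)" using A by (simp add: hom_mat_def)
  from vA Ac obtain u where u: "u \<in> carrier_vec (length e)" "A *\<^sub>v u = v"
    by (auto simp: mat_image_def)
  define w where "w = vec (length e) (\<lambda>c. hpart (\<lambda>k. deg k + e ! c = s) (u $ c))"
  have w: "w \<in> carrier_vec (length e)" by (simp add: w_def)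
  have "hom_vec deg e s w"
    by (auto simp: hom_vec_def w_def keys_hpart)
  moreover have "A *\<^sub>v w = v"
  proof (rule eq_vecI)
    show "dim_vec (A *\<^sub>v w) = dim_vec v" using Ac v by (auto simp: hom_vec_def)
    fix r assume "r < dim_vec v"
    with v have r: "r < length d" by (auto simp: hom_vec_def)
    have "(A *\<^sub>v w) $ r = (\<Sum>c<length e. A $$ (r, c) * hpart (\<lambda>k. deg k + e ! c = s) (u $ c))"
      using mat_mult_vec_index[OF Ac w r] by (simp add: w_def)
    also have "\<dots> = (\<Sum>c<length e. hpart (\<lambda>k. deg k + d ! r = s) (A $$ (r, c) * u $ c))"
    proof (intro sum.cong refl hpart_mult[symmetric])
      fix c a k assume "c \<in> {..<length e}" "a \<in> keys (A $$ (r, c))"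
      with hom_mat_entry[OF A r, of c a] have "deg (a + k) + d ! r = deg k + e ! c"
        by (simp add: deg) (metis add.assoc add.left_commute)
      then show "deg (a + k) + d ! r = s \<longleftrightarrow> deg k + e ! c = s" by simp
    qed
    also have "\<dots> = hpart (\<lambda>k. deg k + d ! r = s) (v $ r)"
      using mat_mult_vec_index[OF Ac u(1) r] u(2) by (simp add: hpart_sum)
    also have "\<dots> = v $ r"
      using v r by (intro hpart_id) (auto simp: hom_vec_def)
    finally show "(A *\<^sub>v w) $ r = v $ r" .
  qed
  ultimately show ?thesis by blast
qed

lemma mat_by_columns:
  assumes A: "A \<in> carrier_mat m n" and B: "B \<in> carrier_mat m l"
    and w: "\<And>c. c < l \<Longrightarrow> \<exists>w. Q c w \<and> w \<in> carrier_vec n \<and> A *\<^sub>v w = col B c"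
  shows "\<exists>V. V \<in> carrier_mat n l \<and> A * V = B \<and> (\<forall>c<l. Q c (col V c))"
proof -
  from w obtain f where f: "\<And>c. c < l \<Longrightarrow> Q c (f c) \<and> f c \<in> carrier_vec n \<and> A *\<^sub>v f c = col B c"
    by metis
  define V where "V = mat n l (\<lambda>(r, c). f c $ r)"
  have V: "V \<in> carrier_mat n l" by (simp add: V_def)
  have col: "col V c = f c" if "c < l" for c
    using f[OF that] that by (intro eq_vecI) (auto simp: V_def)
  have "A * V = B"
  proof (rule eq_matI)
    show "dim_row (A * V) = dim_row B" "dim_col (A * V) = dim_col B" using A B V by auto
    fix i j assume ij: "i < dim_row B" "j < dim_col B"
    then have "(A * V) $$ (i, j) = (A *\<^sub>v col V j) $ i" using A B V by auto
    also have "\<dots> = B $$ (i, j)" using f[of j] col ij B by auto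
    finally show "(A * V) $$ (i, j) = B $$ (i, j)" .
  qed
  with V col f show ?thesis by auto
qed

lemma hom_lift_mat:
  fixes deg :: "mono3 \<Rightarrow> 'g::comm_monoid_add"
  assumes deg: "\<And>a b. deg (a + b) = deg a + deg b"
    and A: "hom_mat deg e d A" and B: "hom_mat deg e' d B"
    and BA: "\<And>c. c < length e' \<Longrightarrow> col B c \<in> mat_image A"
  shows "\<exists>V. hom_mat deg e' e V \<and> A * V = B"
proof -
  have "\<exists>V. V \<in> carrier_mat (length e) (length e') \<and> A * V = B \<and>
      (\<forall>c<length e'. hom_vec deg e (e' ! c) (col V c))"
  proof (rule mat_by_columns)
    show "A \<in> carrier_mat (length d) (length e)" "B \<in> carrier_mat (length d) (length e')"
      using A B by (simp_all add: hom_mat_def)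
    show "\<exists>w. hom_vec deg e (e' ! c) w \<and> w \<in> carrier_vec (length e) \<and> A *\<^sub>v w = col B c"
      if "c < length e'" for c
      using hom_lift_vec[OF deg A, of "e' ! c" "col B c"] B BA[OF that] that
      by (auto simp: hom_mat_def hom_vec_def)
  qed
  then show ?thesis by (auto simp: hom_mat_def)
qed

text \<open>For homotopies: only their products with constant-free matrices are used later, so no
  degrees are tracked.\<close>

lemma lift_mat:
  assumes A: "A \<in> carrier_mat m n" and B: "B \<in> carrier_mat m l"
    and BA: "\<And>c. c < l \<Longrightarrow> col B c \<in> mat_image A"
  shows "\<exists>V. V \<in> carrier_mat n l \<and> A * V = B"
proof -
  have "\<exists>V. V \<in> carrier_mat n l \<and> A * V = B \<and> (\<forall>c<l. True)"
    using BA A by (intro mat_by_columns[OF A B]) (fastforce simp: mat_image_def)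
  then show ?thesis by blast
qed

lemma hom_mat_mult:
  fixes deg :: "mono3 \<Rightarrow> 'g::comm_monoid_add"
  assumes deg: "\<And>a b. deg (a + b) = deg a + deg b"
    and A: "hom_mat deg e d A" and B: "hom_mat deg f e B"
  shows "hom_mat deg f d (A * B)"
proof -
  have c: "A \<in> carrier_mat (length d) (length e)" "B \<in> carrier_mat (length e) (length f)"
    using A B by (simp_all add: hom_mat_def)
  have "deg m + d ! r = f ! j" if rj: "r < length d" "j < length f" and m: "m \<in> keys ((A * B) $$ (r, j))" for r j m
  proof -
    have "(A * B) $$ (r, j) = (\<Sum>i<length e. A $$ (r, i) * B $$ (i, j))"
      using c rj by (auto simp: scalar_prod_def lessThan_atLeast0 intro!: sum.cong)
    with m obtain i where i: "i < length e" "m \<in> keys (A $$ (r, i) * B $$ (i, j))"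
      using keys_sum[of "\<lambda>i. A $$ (r, i) * B $$ (i, j)" "{..<length e}"] by auto
    then obtain a b where ab: "m = a + b" "a \<in> keys (A $$ (r, i))" "b \<in> keys (B $$ (i, j))"
      using keys_mult[of "A $$ (r, i)" "B $$ (i, j)"] by blast
    have "deg m + d ! r = deg b + (deg a + d ! r)"
      by (simp add: ab deg add.assoc add.left_commute)
    also have "\<dots> = f ! j"
      using hom_mat_entry[OF A rj(1) i(1) ab(2)] hom_mat_entry[OF B i(1) rj(2) ab(3)] by simp
    finally show ?thesis .
  qed
  with c show ?thesis by (intro hom_matI) auto
qed

section \<open>Uniqueness of graded Betti numbers\<close>

text \<open>Padding by zeros makes both matrices square, where a right inverse is also a left
  inverse; but row \<open>m\<close> of the padded \<open>B\<close> is zero.\<close>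

lemma right_inverse_imp_le:
  fixes A B :: "'k::field mat"
  assumes A: "A \<in> carrier_mat n m" and B: "B \<in> carrier_mat m n" and AB: "A * B = 1\<^sub>m n"
  shows "n \<le> m"
proof (rule ccontr)
  assume "\<not> n \<le> m"
  then have mn: "m < n" by simp
  define A' where "A' = mat n n (\<lambda>(i, j). if j < m then A $$ (i, j) else 0)"
  define B' where "B' = mat n n (\<lambda>(i, j). if i < m then B $$ (i, j) else 0)"
  have c: "A' \<in> carrier_mat n n" "B' \<in> carrier_mat n n" by (simp_all add: A'_def B'_def)
  have "A' * B' = A * B"
  proof (rule eq_matI)
    fix i j assume "i < dim_row (A * B)" "j < dim_col (A * B)"
    then have ij: "i < n" "j < n" using A B by auto
    have "(A' * B') $$ (i, j) = (\<Sum>k = 0..<n. A' $$ (i, k) * B' $$ (k, j))"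
      using c ij by (auto simp: scalar_prod_def intro!: sum.cong)
    also have "\<dots> = (\<Sum>k = 0..<m. A $$ (i, k) * B $$ (k, j))"
      using mn ij by (intro sum.mono_neutral_cong_right) (auto simp: A'_def B'_def)
    also have "\<dots> = (A * B) $$ (i, j)"
      using A B ij by (auto simp: scalar_prod_def intro!: sum.cong)
    finally show "(A' * B') $$ (i, j) = (A * B) $$ (i, j)" .
  qed (use A B c in auto)
  then have "B' * A' = 1\<^sub>m n"
    using mat_mult_left_right_inverse[OF c] AB by simp
  moreover have "(B' * A') $$ (m, m) = 0"
    using mn c by (auto simp: scalar_prod_def B'_def A'_def)
  ultimately show False using mn by simp
qed

lemma dual_families_card_le:
  fixes a :: "'p \<Rightarrow> 'q \<Rightarrow> 'k::field"
  assumes P: "finite P" and Q: "finite Q"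
    and dual: "\<And>p p'. p \<in> P \<Longrightarrow> p' \<in> P \<Longrightarrow> (\<Sum>q\<in>Q. a p q * b q p') = (if p = p' then 1 else 0)"
  shows "card P \<le> card Q"
proof -
  obtain f g where f: "bij_betw f {0..<card P} P" and g: "bij_betw g {0..<card Q} Q"
    using ex_bij_betw_nat_finite[OF P] ex_bij_betw_nat_finite[OF Q] by blast
  define A where "A = mat (card P) (card Q) (\<lambda>(i, j). a (f i) (g j))"
  define B where "B = mat (card Q) (card P) (\<lambda>(i, j). b (g i) (f j))"
  have c: "A \<in> carrier_mat (card P) (card Q)" "B \<in> carrier_mat (card Q) (card P)"
    by (simp_all add: A_def B_def)
  have "A * B = 1\<^sub>m (card P)"
  proof (rule eq_matI)
    fix i j assume "i < dim_row (1\<^sub>m (card P))" "j < dim_col (1\<^sub>m (card P))"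
    then have ij: "i < card P" "j < card P" by auto
    have "(A * B) $$ (i, j) = (\<Sum>k = 0..<card Q. a (f i) (g k) * b (g k) (f j))"
      using c ij by (auto simp: scalar_prod_def A_def B_def intro!: sum.cong)
    also have "\<dots> = (\<Sum>q\<in>Q. a (f i) q * b q (f j))"
      by (rule sum.reindex_bij_betw[OF g])
    also have "\<dots> = (if f i = f j then 1 else 0)"
      using f ij by (intro dual) (auto simp: bij_betw_def)
    also have "\<dots> = 1\<^sub>m (card P) $$ (i, j)"
      using f ij by (auto simp: bij_betw_def inj_on_def)
    finally show "(A * B) $$ (i, j) = 1\<^sub>m (card P) $$ (i, j)" .
  qed (use c in auto)
  with c show ?thesis by (rule right_inverse_imp_le)
qed

section \<open>Constant terms of matrices and minimality\<close>

definition const_free :: "'k::field poly3 mat \<Rightarrow> bool" where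
  "const_free A \<longleftrightarrow> (\<forall>i<dim_row A. \<forall>j<dim_col A. lookup (A $$ (i, j)) 0 = 0)"

lemma const_free_iff: "elements_mat A \<subseteq> ideal_gen {var_x, var_y, var_z} \<longleftrightarrow> const_free A"
proof
  assume "elements_mat A \<subseteq> ideal_gen {var_x, var_y, var_z}"
  moreover have "A $$ (i, j) \<in> elements_mat A" if "i < dim_row A" "j < dim_col A" for i j
    using that by (auto intro: elements_matI[of A "dim_row A" "dim_col A"])
  ultimately show "const_free A" unfolding const_free_def using variable_ideal_iff by blast
next
  assume "const_free A"
  then show "elements_mat A \<subseteq> ideal_gen {var_x, var_y, var_z}"
    using elements_matD[of _ A] unfolding const_free_def using variable_ideal_iff by blast
qed

lemma lookup_0_mat_mult:
  fixes A B :: "'k::field poly3 mat"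
  assumes "A \<in> carrier_mat n m" "B \<in> carrier_mat m l" "i < n" "j < l"
  shows "lookup ((A * B) $$ (i, j)) 0 =
    (\<Sum>k<m. lookup (A $$ (i, k)) 0 * lookup (B $$ (k, j)) 0)"
  using assms
  by (auto simp: scalar_prod_def lookup_sum lookup_0_mult lessThan_atLeast0 intro!: sum.cong)

lemma const_free_mult_left:
  assumes "const_free A" "A \<in> carrier_mat n m" "B \<in> carrier_mat m l"
  shows "const_free (A * B)"
  unfolding const_free_def
proof (intro allI impI)
  fix i j assume "i < dim_row (A * B)" "j < dim_col (A * B)"
  with assms have "i < n" "j < l" by auto
  with assms show "lookup ((A * B) $$ (i, j)) 0 = 0"
    by (subst lookup_0_mat_mult) (auto simp: const_free_def)
qed

lemma const_free_mult_right:
  assumes "const_free B" "A \<in> carrier_mat n m" "B \<in> carrier_mat m l"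
  shows "const_free (A * B)"
  unfolding const_free_def
proof (intro allI impI)
  fix i j assume "i < dim_row (A * B)" "j < dim_col (A * B)"
  with assms have "i < n" "j < l" by auto
  with assms show "lookup ((A * B) $$ (i, j)) 0 = 0"
    by (subst lookup_0_mat_mult) (auto simp: const_free_def)
qed

lemma col_mult_mem_image:
  assumes "A \<in> carrier_mat n m" "c < m"
  shows "col A c \<in> mat_image A"
proof -
  have "A *\<^sub>v unit_vec m c = col A c" using assms by (intro eq_vecI) auto
  then show ?thesis using assms unfolding mat_image_def by (metis carrier_matD(2) image_eqI unit_vec_carrier)
qed

lemma mult_eq_0_imp_col_kernel:
  assumes "A \<in> carrier_mat n m" "B \<in> carrier_mat m l" "A * B = 0\<^sub>m n l" "c < l"
  shows "col B c \<in> mat_kernel A"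
proof (rule mat_kernelI[OF assms(1)])
  show "col B c \<in> carrier_vec m" using assms by auto
  have "A *\<^sub>v col B c = col (A * B) c" by (rule col_mult2[OF assms(1,2,4), symmetric])
  also have "\<dots> = 0\<^sub>v n" unfolding assms(3) using assms(4) by (intro eq_vecI) auto
  finally show "A *\<^sub>v col B c = 0\<^sub>v n" .
qed

lemma mult_eq_0I:
  assumes "A \<in> carrier_mat n m" "B \<in> carrier_mat m l" "\<And>c. c < l \<Longrightarrow> A *\<^sub>v col B c = 0\<^sub>v n"
  shows "A * B = 0\<^sub>m n l"
proof (rule eq_matI)
  fix i j assume "i < dim_row (0\<^sub>m n l)" "j < dim_col (0\<^sub>m n l)"
  then have ij: "i < n" "j < l" by auto
  then have "(A * B) $$ (i, j) = (A *\<^sub>v col B j) $ i" using assms(1,2) by auto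
  then show "(A * B) $$ (i, j) = 0\<^sub>m n l $$ (i, j)" using assms(3) ij by simp
qed (use assms in auto)

text \<open>Modulo the variables W V is the identity, and a nonzero constant entry of
  \<open>V\<close> joins positions of equal degree only. So the parts of \<open>W\<close> and
  \<open>V\<close> belonging to degree \<open>j\<close> still compose to an identity matrix.\<close>

lemma graded_count_le:
  fixes F F' :: "nat list" and V W :: "'k::field poly3 mat"
  assumes V: "hom_mat mdeg F F' V" and W: "hom_mat mdeg F' F W"
    and WV: "const_free (1\<^sub>m (length F) - W * V)"
  shows "count_list F j \<le> count_list F' j"
proof -
  define P where "P = {r. r < length F \<and> F ! r = j}"
  define Q where "Q = {r. r < length F' \<and> F' ! r = j}"
  have Vc: "V \<in> carrier_mat (length F') (length F)" and Wc: "W \<in> carrier_mat (length F) (length F')"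
    using V W by (simp_all add: hom_mat_def)
  have fin: "finite P" "finite Q" by (simp_all add: P_def Q_def)
  have "card P \<le> card Q"
  proof (rule dual_families_card_le[OF fin])
    fix p p' assume p: "p \<in> P" "p' \<in> P"
    then have pl: "p < length F" "p' < length F" by (simp_all add: P_def)
    have "(\<Sum>q\<in>Q. lookup (W $$ (p, q)) 0 * lookup (V $$ (q, p')) 0) =
        (\<Sum>q<length F'. lookup (W $$ (p, q)) 0 * lookup (V $$ (q, p')) 0)"
    proof (rule sum.mono_neutral_left)
      show "\<forall>q\<in>{..<length F'} - Q. lookup (W $$ (p, q)) 0 * lookup (V $$ (q, p')) 0 = 0"
      proof
        fix q assume q: "q \<in> {..<length F'} - Q"
        then have "0 \<notin> keys (V $$ (q, p'))"
          using hom_mat_entry[OF V, where r = q and c = p' and m = 0] pl p by (auto simp: P_def Q_def)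
        then show "lookup (W $$ (p, q)) 0 * lookup (V $$ (q, p')) 0 = 0"
          by (simp add: in_keys_iff)
      qed
    qed (auto simp: Q_def)
    also have "\<dots> = lookup ((W * V) $$ (p, p')) 0"
      using lookup_0_mat_mult[OF Wc Vc pl] by simp
    also have "\<dots> = lookup ((1\<^sub>m (length F) :: 'k poly3 mat) $$ (p, p')) 0"
    proof -
      have "lookup ((1\<^sub>m (length F) - W * V) $$ (p, p')) 0 = 0"
        using WV pl Vc Wc unfolding const_free_def by auto
      then show ?thesis using pl Vc Wc by (auto simp: lookup_minus split: if_splits)
    qed
    also have "\<dots> = (if p = p' then 1 else 0)"
      using pl by simp
    finally show "(\<Sum>q\<in>Q. lookup (W $$ (p, q)) 0 * lookup (V $$ (q, p')) 0) =
      (if p = p' then 1 else 0)" .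
  qed
  moreover have "count_list F j = card P" "count_list F' j = card Q"
    unfolding P_def Q_def count_list_eq_length_filter length_filter_conv_card by metis+
  ultimately show ?thesis by simp
qed

section \<open>Comparison of two minimal resolutions\<close>

lemma minimal_resolutionD:
  assumes "minimal_graded_free_resolution I F \<phi>"
  shows "hom_mat mdeg (F 0) [0] (\<phi> 0)" "hom_mat mdeg (F (Suc i)) (F i) (\<phi> (Suc i))"
    "(\<lambda>v. v $ 0) ` mat_image (\<phi> 0) = I" "mat_image (\<phi> (Suc i)) = mat_kernel (\<phi> i)"
    "const_free (\<phi> (Suc i))" "\<phi> (Suc i) \<in> carrier_mat (length (F i)) (length (F (Suc i)))"
    "dim_col (\<phi> i) = length (F i)"
proof -
  show h: "hom_mat mdeg (F 0) [0] (\<phi> 0)" "\<And>i. hom_mat mdeg (F (Suc i)) (F i) (\<phi> (Suc i))"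
    "(\<lambda>v. v $ 0) ` mat_image (\<phi> 0) = I" "mat_image (\<phi> (Suc i)) = mat_kernel (\<phi> i)"
    "const_free (\<phi> (Suc i))" for i
    using assms by (simp_all add: minimal_graded_free_resolution_def graded_map_eq_hom_mat const_free_iff)
  then show "\<phi> (Suc i) \<in> carrier_mat (length (F i)) (length (F (Suc i)))"
    by (simp add: hom_mat_def)
  show "dim_col (\<phi> i) = length (F i)"
    using h(1) h(2)[of "i - 1"] by (cases i) (auto simp: hom_mat_def)
qed

lemma resolution_augmentation_lift:
  fixes \<phi> \<phi>' :: "nat \<Rightarrow> 'k::field poly3 mat"
  assumes F: "minimal_graded_free_resolution I F \<phi>" and F': "minimal_graded_free_resolution I F' \<phi>'"
  shows "\<exists>V. hom_mat mdeg (F 0) (F' 0) V \<and> \<phi>' 0 * V = \<phi> 0"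
proof (rule hom_lift_mat[OF mdeg_add])
  show h: "hom_mat mdeg (F' 0) [0] (\<phi>' 0)" "hom_mat mdeg (F 0) [0] (\<phi> 0)"
    using minimal_resolutionD[OF F] minimal_resolutionD[OF F'] by blast+
  fix c assume "c < length (F 0)"
  then have c: "col (\<phi> 0) c \<in> mat_image (\<phi> 0)"
    using h by (intro col_mult_mem_image[of _ 1 "length (F 0)"]) (auto simp: hom_mat_def)
  then have "col (\<phi> 0) c $ 0 \<in> (\<lambda>v. v $ 0) ` mat_image (\<phi>' 0)"
    using minimal_resolutionD(3)[OF F] minimal_resolutionD(3)[OF F'] by blast
  then obtain u where u: "u \<in> mat_image (\<phi>' 0)" "u $ 0 = col (\<phi> 0) c $ 0" by force
  have "u = col (\<phi> 0) c"
  proof (rule eq_vecI)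
    show "dim_vec u = dim_vec (col (\<phi> 0) c)"
      using u(1) h by (auto simp: mat_image_def hom_mat_def)
    show "u $ i = col (\<phi> 0) c $ i" if "i < dim_vec (col (\<phi> 0) c)" for i
      using that u(2) h by (auto simp: hom_mat_def)
  qed
  with u show "col (\<phi> 0) c \<in> mat_image (\<phi>' 0)" by simp
qed

text \<open>By exactness in the target, \<open>V\<close> sends the columns of
  \<open>\<phi> (Suc i)\<close> into the image of \<open>\<phi>' (Suc i)\<close>, so they lift. The
  last conclusion restores the hypothesis on \<open>V\<close> for the next stage.\<close>

lemma resolution_lift_step:
  fixes \<phi> \<phi>' :: "nat \<Rightarrow> 'k::field poly3 mat"
  assumes F: "minimal_graded_free_resolution I F \<phi>" and F': "minimal_graded_free_resolution I F' \<phi>'"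
    and V: "hom_mat mdeg (F i) (F' i) V" "\<And>v. v \<in> mat_kernel (\<phi> i) \<Longrightarrow> V *\<^sub>v v \<in> mat_kernel (\<phi>' i)"
  obtains V' where "hom_mat mdeg (F (Suc i)) (F' (Suc i)) V'" "\<phi>' (Suc i) * V' = V * \<phi> (Suc i)"
    "\<And>v. v \<in> mat_kernel (\<phi> (Suc i)) \<Longrightarrow> V' *\<^sub>v v \<in> mat_kernel (\<phi>' (Suc i))"
proof -
  note D = minimal_resolutionD[OF F] and D' = minimal_resolutionD[OF F']
  have Vc: "V \<in> carrier_mat (length (F' i)) (length (F i))" using V(1) by (simp add: hom_mat_def)
  have "\<exists>V'. hom_mat mdeg (F (Suc i)) (F' (Suc i)) V' \<and> \<phi>' (Suc i) * V' = V * \<phi> (Suc i)"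
  proof (rule hom_lift_mat[OF mdeg_add D'(2)])
    show "hom_mat mdeg (F (Suc i)) (F' i) (V * \<phi> (Suc i))"
      using hom_mat_mult[OF mdeg_add V(1) D(2)] .
    fix c assume c: "c < length (F (Suc i))"
    have "col (\<phi> (Suc i)) c \<in> mat_kernel (\<phi> i)"
      using col_mult_mem_image[OF D(6) c] D(4) by simp
    then have "V *\<^sub>v col (\<phi> (Suc i)) c \<in> mat_image (\<phi>' (Suc i))"
      using V(2) D'(4) by blast
    then show "col (V * \<phi> (Suc i)) c \<in> mat_image (\<phi>' (Suc i))"
      using col_mult2[OF Vc D(6) c] by simp
  qed
  then obtain V' where V': "hom_mat mdeg (F (Suc i)) (F' (Suc i)) V'" "\<phi>' (Suc i) * V' = V * \<phi> (Suc i)"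
    by blast
  have V'c: "V' \<in> carrier_mat (length (F' (Suc i))) (length (F (Suc i)))" using V'(1) by (simp add: hom_mat_def)
  show ?thesis
  proof (rule that[OF V'])
    fix v assume v: "v \<in> mat_kernel (\<phi> (Suc i))"
    note vk = mat_kernelD[OF D(6) v]
    show "V' *\<^sub>v v \<in> mat_kernel (\<phi>' (Suc i))"
    proof (rule mat_kernelI[OF D'(6)])
      show "V' *\<^sub>v v \<in> carrier_vec (length (F' (Suc i)))" using V'c vk by auto
      have "\<phi>' (Suc i) *\<^sub>v (V' *\<^sub>v v) = (V * \<phi> (Suc i)) *\<^sub>v v"
        using assoc_mult_mat_vec[OF D'(6) V'c vk(1)] V'(2) by simp
      also have "\<dots> = V *\<^sub>v (\<phi> (Suc i) *\<^sub>v v)"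
        by (rule assoc_mult_mat_vec[OF Vc D(6) vk(1)])
      also have "\<dots> = 0\<^sub>v (length (F' i))"
        using vk Vc by auto
      finally show "\<phi>' (Suc i) *\<^sub>v (V' *\<^sub>v v) = 0\<^sub>v (length (F' i))" .
    qed
  qed
qed

text \<open>
  \<open>V\<close> and \<open>W\<close> are the degree \<open>i\<close> parts of comparison maps between two resolutions and \<open>E\<close> is the
  part \<open>h \<phi>\<close> of a homotopy between \<open>W V\<close> and the identity.
\<close>

definition comparison_stage where
  "comparison_stage F \<phi> F' \<phi>' i V W E \<longleftrightarrow>
    hom_mat mdeg (F i) (F' i) V \<and> hom_mat mdeg (F' i) (F i) W \<and>
    (\<forall>v\<in>mat_kernel (\<phi> i). V *\<^sub>v v \<in> mat_kernel (\<phi>' i)) \<and>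
    (\<forall>v\<in>mat_kernel (\<phi>' i). W *\<^sub>v v \<in> mat_kernel (\<phi> i)) \<and>
    E \<in> carrier_mat (length (F i)) (length (F i)) \<and> const_free E \<and>
    (\<forall>v\<in>mat_kernel (\<phi> i). E *\<^sub>v v = 0\<^sub>v (length (F i))) \<and>
    (\<forall>c<length (F i). col (1\<^sub>m (length (F i)) - W * V - E) c \<in> mat_kernel (\<phi> i))"

text \<open>If 1 - W V - E = \<phi> h at stage \<open>i\<close>, the next correction is h \<phi>: it
  kills the kernel of \<phi>, and it has no constant terms because \<phi> has none. Stage 0 needs no
  correction.\<close>

lemma comparison_stage_exists:
  fixes \<phi> \<phi>' :: "nat \<Rightarrow> 'k::field poly3 mat"
  assumes F: "minimal_graded_free_resolution I F \<phi>" and F': "minimal_graded_free_resolution I F' \<phi>'"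
  shows "\<exists>V W E. comparison_stage F \<phi> F' \<phi>' i V W E"
proof (induction i)
  case 0
  note D = minimal_resolutionD[OF F] and D' = minimal_resolutionD[OF F']
  have \<phi>: "\<phi> 0 \<in> carrier_mat 1 (length (F 0))" "\<phi>' 0 \<in> carrier_mat 1 (length (F' 0))"
    using D(1) D'(1) by (simp_all add: hom_mat_def)
  obtain V where V: "hom_mat mdeg (F 0) (F' 0) V" "\<phi>' 0 * V = \<phi> 0"
    using resolution_augmentation_lift[OF F F'] by blast
  obtain W where W: "hom_mat mdeg (F' 0) (F 0) W" "\<phi> 0 * W = \<phi>' 0"
    using resolution_augmentation_lift[OF F' F] by blast
  have c: "V \<in> carrier_mat (length (F' 0)) (length (F 0))" "W \<in> carrier_mat (length (F 0)) (length (F' 0))"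
    using V(1) W(1) by (simp_all add: hom_mat_def)
  let ?n = "length (F 0)" and ?X = "1\<^sub>m (length (F 0)) - W * V - 0\<^sub>m (length (F 0)) (length (F 0))"
  have X: "?X = 1\<^sub>m ?n - W * V" using c by (intro eq_matI) auto
  have "\<phi> 0 * (1\<^sub>m ?n - W * V) = \<phi> 0 * 1\<^sub>m ?n - \<phi> 0 * (W * V)"
    using \<phi> c by (intro mult_minus_distrib_mat) auto
  also have "\<phi> 0 * (W * V) = \<phi> 0"
    using assoc_mult_mat[OF \<phi>(1) c(2,1)] V(2) W(2) by simp
  also have "\<phi> 0 * 1\<^sub>m ?n - \<phi> 0 = 0\<^sub>m 1 ?n" using \<phi> by auto
  finally have z: "\<phi> 0 * (1\<^sub>m ?n - W * V) = 0\<^sub>m 1 ?n" .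
  have "comparison_stage F \<phi> F' \<phi>' 0 V W (0\<^sub>m ?n ?n)"
    unfolding comparison_stage_def
  proof (intro conjI ballI allI impI)
    show "V *\<^sub>v v \<in> mat_kernel (\<phi>' 0)" if "v \<in> mat_kernel (\<phi> 0)" for v
      using mat_kernelD[OF \<phi>(1) that] c(1) V(2) assoc_mult_mat_vec[OF \<phi>(2) c(1), of v]
      by (intro mat_kernelI[OF \<phi>(2)]) auto
    show "W *\<^sub>v v \<in> mat_kernel (\<phi> 0)" if "v \<in> mat_kernel (\<phi>' 0)" for v
      using mat_kernelD[OF \<phi>(2) that] c(2) W(2) assoc_mult_mat_vec[OF \<phi>(1) c(2), of v]
      by (intro mat_kernelI[OF \<phi>(1)]) auto
    show "0\<^sub>m ?n ?n *\<^sub>v v = 0\<^sub>v ?n" if "v \<in> mat_kernel (\<phi> 0)" for v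
      using mat_kernelD[OF \<phi>(1) that] by (intro eq_vecI) (auto simp: scalar_prod_def)
    show "col ?X j \<in> mat_kernel (\<phi> 0)" if "j < ?n" for j
      unfolding X using c z that by (intro mult_eq_0_imp_col_kernel[OF \<phi>(1)]) auto
  qed (use V W in \<open>auto simp: const_free_def\<close>)
  then show ?case by blast
next
  case (Suc i)
  then obtain V W E where S: "comparison_stage F \<phi> F' \<phi>' i V W E" by blast
  note D = minimal_resolutionD[OF F] and D' = minimal_resolutionD[OF F']
  let ?n = "length (F i)" and ?m = "length (F (Suc i))" and ?\<phi> = "\<phi> (Suc i)" and ?\<phi>' = "\<phi>' (Suc i)"
  have V: "hom_mat mdeg (F i) (F' i) V" "\<And>v. v \<in> mat_kernel (\<phi> i) \<Longrightarrow> V *\<^sub>v v \<in> mat_kernel (\<phi>' i)"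
    and W: "hom_mat mdeg (F' i) (F i) W" "\<And>v. v \<in> mat_kernel (\<phi>' i) \<Longrightarrow> W *\<^sub>v v \<in> mat_kernel (\<phi> i)"
    and E: "E \<in> carrier_mat ?n ?n" "\<And>v. v \<in> mat_kernel (\<phi> i) \<Longrightarrow> E *\<^sub>v v = 0\<^sub>v ?n"
    and X: "\<And>c. c < ?n \<Longrightarrow> col (1\<^sub>m ?n - W * V - E) c \<in> mat_kernel (\<phi> i)"
    using S unfolding comparison_stage_def by blast+
  have c: "V \<in> carrier_mat (length (F' i)) ?n" "W \<in> carrier_mat ?n (length (F' i))"
    using V(1) W(1) by (simp_all add: hom_mat_def)
  let ?X = "1\<^sub>m ?n - W * V - E"
  have Xc: "?X \<in> carrier_mat ?n ?n" using E c by auto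
  have "\<exists>h. h \<in> carrier_mat ?m ?n \<and> ?\<phi> * h = ?X"
    using X D(4) by (intro lift_mat[OF D(6) Xc]) blast
  then obtain h where h: "h \<in> carrier_mat ?m ?n" "?\<phi> * h = ?X" by blast
  obtain V' where V': "hom_mat mdeg (F (Suc i)) (F' (Suc i)) V'" "?\<phi>' * V' = V * ?\<phi>"
    "\<And>v. v \<in> mat_kernel ?\<phi> \<Longrightarrow> V' *\<^sub>v v \<in> mat_kernel ?\<phi>'"
    using resolution_lift_step[OF F F' V] by blast
  obtain W' where W': "hom_mat mdeg (F' (Suc i)) (F (Suc i)) W'" "?\<phi> * W' = W * ?\<phi>'"
    "\<And>v. v \<in> mat_kernel ?\<phi>' \<Longrightarrow> W' *\<^sub>v v \<in> mat_kernel ?\<phi>"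
    using resolution_lift_step[OF F' F W] by blast
  have c': "V' \<in> carrier_mat (length (F' (Suc i))) ?m" "W' \<in> carrier_mat ?m (length (F' (Suc i)))"
    using V'(1) W'(1) by (simp_all add: hom_mat_def)
  have h\<phi>: "h * ?\<phi> \<in> carrier_mat ?m ?m" using h D(6) by auto
  have E\<phi>: "E * ?\<phi> = 0\<^sub>m ?n ?m"
    using E D(4) col_mult_mem_image[OF D(6)] by (intro mult_eq_0I[OF _ D(6)]) auto
  have WV\<phi>: "?\<phi> * (W' * V') = W * V * ?\<phi>"
    using assoc_mult_mat[OF D(6) c'(2,1)] assoc_mult_mat[OF c(2) D'(6) c'(1)]
      assoc_mult_mat[OF c(2,1) D(6)] V'(2) W'(2) by simp
  \<comment> \<open>The old correction drops out because E \<phi> = 0.\<close>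
  have \<phi>h\<phi>: "?\<phi> * (h * ?\<phi>) = ?\<phi> - W * V * ?\<phi>"
  proof -
    have "?\<phi> * (h * ?\<phi>) = ?X * ?\<phi>"
      using assoc_mult_mat[OF D(6) h(1) D(6)] h(2) by simp
    also have "\<dots> = (1\<^sub>m ?n - W * V) * ?\<phi> - E * ?\<phi>"
      using c E D(6) by (intro minus_mult_distrib_mat) auto
    also have "(1\<^sub>m ?n - W * V) * ?\<phi> = 1\<^sub>m ?n * ?\<phi> - W * V * ?\<phi>"
      using c D(6) by (intro minus_mult_distrib_mat) auto
    also have "1\<^sub>m ?n * ?\<phi> - W * V * ?\<phi> - E * ?\<phi> = ?\<phi> - W * V * ?\<phi>"
      using minus_carrier_mat[of "W * V * ?\<phi>" ?n ?m ?\<phi>] c D(6)[of i]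
      unfolding E\<phi> left_mult_one_mat[OF D(6)] by (intro eq_matI) (auto simp del: index_mult_mat(1))
    finally show ?thesis .
  qed
  let ?X' = "1\<^sub>m ?m - W' * V' - h * ?\<phi>"
  have "?\<phi> * ?X' = ?\<phi> * (1\<^sub>m ?m - W' * V') - ?\<phi> * (h * ?\<phi>)"
    using c' h\<phi> by (intro mult_minus_distrib_mat[OF D(6)]) auto
  also have "?\<phi> * (1\<^sub>m ?m - W' * V') = ?\<phi> * 1\<^sub>m ?m - ?\<phi> * (W' * V')"
    using c' by (intro mult_minus_distrib_mat[OF D(6)]) auto
  also have "?\<phi> * 1\<^sub>m ?m - ?\<phi> * (W' * V') - ?\<phi> * (h * ?\<phi>) = 0\<^sub>m ?n ?m"
    using D(6)[of i] c unfolding WV\<phi> \<phi>h\<phi> right_mult_one_mat[OF D(6)] by (intro eq_matI) (auto simp del: index_mult_mat(1))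
  finally have z: "?\<phi> * ?X' = 0\<^sub>m ?n ?m" .
  have "comparison_stage F \<phi> F' \<phi>' (Suc i) V' W' (h * ?\<phi>)"
    unfolding comparison_stage_def
  proof (intro conjI ballI allI impI)
    show "const_free (h * ?\<phi>)" by (rule const_free_mult_right[OF D(5) h(1) D(6)])
    show "h * ?\<phi> *\<^sub>v v = 0\<^sub>v ?m" if "v \<in> mat_kernel ?\<phi>" for v
      using mat_kernelD[OF D(6) that] h(1) assoc_mult_mat_vec[OF h(1) D(6), of v] by auto
    show "col ?X' j \<in> mat_kernel ?\<phi>" if "j < ?m" for j
      by (rule mult_eq_0_imp_col_kernel[OF D(6) minus_carrier_mat[OF h\<phi>] z that])
  qed (use V' W' h\<phi> in auto)
  then show ?case by blast
qed

text \<open>Here 1 - W V = E + \<phi> h, and both summands are free of constants, the second because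
  the resolution is minimal.\<close>

lemma minimal_resolution_count_le:
  fixes \<phi> \<phi>' :: "nat \<Rightarrow> 'k::field poly3 mat"
  assumes F: "minimal_graded_free_resolution I F \<phi>" and F': "minimal_graded_free_resolution I F' \<phi>'"
  shows "count_list (F i) j \<le> count_list (F' i) j"
proof -
  note D = minimal_resolutionD[OF F]
  obtain V W E where S: "comparison_stage F \<phi> F' \<phi>' i V W E"
    using comparison_stage_exists[OF F F'] by blast
  let ?n = "length (F i)" and ?m = "length (F (Suc i))"
  have V: "hom_mat mdeg (F i) (F' i) V" and W: "hom_mat mdeg (F' i) (F i) W"
    and E: "E \<in> carrier_mat ?n ?n" "const_free E"
    and X: "\<And>c. c < ?n \<Longrightarrow> col (1\<^sub>m ?n - W * V - E) c \<in> mat_kernel (\<phi> i)"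
    using S unfolding comparison_stage_def by blast+
  have c: "V \<in> carrier_mat (length (F' i)) ?n" "W \<in> carrier_mat ?n (length (F' i))"
    using V W by (simp_all add: hom_mat_def)
  let ?X = "1\<^sub>m ?n - W * V - E"
  have Xc: "?X \<in> carrier_mat ?n ?n" using E c by auto
  have "\<exists>h. h \<in> carrier_mat ?m ?n \<and> \<phi> (Suc i) * h = ?X"
    using X D(4) by (intro lift_mat[OF D(6) Xc]) blast
  then have "const_free ?X"
    using const_free_mult_left[OF D(5) D(6)] by metis
  then have "const_free (1\<^sub>m ?n - W * V)"
    using E c unfolding const_free_def by (auto simp: lookup_minus)
  with V W show ?thesis by (rule graded_count_le)
qed

theorem betti_eq_count:
  assumes "minimal_graded_free_resolution I F \<phi>"
  shows "betti I i j = of_nat (count_list (F i) j)"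
proof -
  let ?F = "SOME F. \<exists>\<phi>. minimal_graded_free_resolution I F \<phi>"
  have "\<exists>\<phi>. minimal_graded_free_resolution I ?F \<phi>"
    using assms by (intro someI_ex[of "\<lambda>F. \<exists>\<phi>. minimal_graded_free_resolution I F \<phi>"]) blast
  then obtain \<psi> where "minimal_graded_free_resolution I ?F \<psi>" ..
  with assms have "count_list (?F i) j = count_list (F i) j"
    using minimal_resolution_count_le antisym by metis
  then show ?thesis by (simp add: betti_def)
qed

section \<open>Mapping cones\<close>

definition multigraded_resolution ::
  "'k::field poly3 set \<Rightarrow> (nat \<Rightarrow> mono3 list) \<Rightarrow> (nat \<Rightarrow> 'k poly3 mat) \<Rightarrow> bool" where
  "multigraded_resolution J F \<phi> \<longleftrightarrow>
    hom_mat (\<lambda>m. m) (F 0) [0] (\<phi> 0) \<and> (\<forall>i. hom_mat (\<lambda>m. m) (F (Suc i)) (F i) (\<phi> (Suc i))) \<and>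
    (\<lambda>v. v $ 0) ` mat_image (\<phi> 0) = J \<and> (\<forall>i. mat_image (\<phi> (Suc i)) = mat_kernel (\<phi> i))"

text \<open>A free resolution of the cyclic module \<open>(R/\<cc>)(-g)\<close>, with an initial zero module.\<close>

definition cyclic_resolution ::
  "mono3 \<Rightarrow> 'k::field poly3 set \<Rightarrow> (nat \<Rightarrow> mono3 list) \<Rightarrow> (nat \<Rightarrow> 'k poly3 mat) \<Rightarrow> bool" where
  "cyclic_resolution g \<cc> K \<kappa> \<longleftrightarrow> K 0 = [] \<and> K 1 = [g] \<and>
    (\<forall>i. hom_mat (\<lambda>m. m) (K (Suc i)) (K i) (\<kappa> i)) \<and>
    (\<lambda>v. v $ 0) ` mat_image (\<kappa> 1) = \<cc> \<and>
    (\<forall>i. mat_image (\<kappa> (Suc (Suc i))) = mat_kernel (\<kappa> (Suc i)))"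

lemma hom_mat_four_block:
  assumes A: "hom_mat deg e d A" and B: "hom_mat deg e' d B" and D: "hom_mat deg e' d' D"
  shows "hom_mat deg (e @ e') (d @ d') (four_block_mat A B (0\<^sub>m (length d') (length e)) D)"
proof (rule hom_matI)
  have c: "A \<in> carrier_mat (length d) (length e)" "B \<in> carrier_mat (length d) (length e')"
    "D \<in> carrier_mat (length d') (length e')"
    using assms by (simp_all add: hom_mat_def)
  then show "four_block_mat A B (0\<^sub>m (length d') (length e)) D \<in>
      carrier_mat (length (d @ d')) (length (e @ e'))"
    using four_block_carrier_mat[OF c(1,3)] by simp
  fix r j m assume rj: "r < length (d @ d')" "j < length (e @ e')"
    and "m \<in> keys (four_block_mat A B (0\<^sub>m (length d') (length e)) D $$ (r, j))"
  then show "deg m + (d @ d') ! r = (e @ e') ! j"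
    using c hom_mat_entry[OF A, of r j m] hom_mat_entry[OF B, of r "j - length e" m]
      hom_mat_entry[OF D, of "r - length d" "j - length e" m]
    by (auto simp: nth_append split: if_splits)
qed

text \<open>Exactness of a mapping cone at one spot. The hypothesis \<open>lift\<close> is weaker
  than exactness of the second complex, which has homology R/\<cc> at its bottom; there it becomes
  the colon condition.\<close>

lemma four_block_exact:
  fixes A :: "'a::comm_ring_1 mat"
  assumes A: "A \<in> carrier_mat m n" and B: "B \<in> carrier_mat m n'" and D: "D \<in> carrier_mat m' n'"
    and A': "A' \<in> carrier_mat n l" and B': "B' \<in> carrier_mat n l'" and D': "D' \<in> carrier_mat n' l'"
    and ker: "mat_image A' = mat_kernel A" and DD: "mat_image D' \<subseteq> mat_kernel D"
    and lift: "\<And>\<gamma>. \<gamma> \<in> mat_kernel D \<Longrightarrow> B *\<^sub>v \<gamma> \<in> mat_image A \<Longrightarrow> \<gamma> \<in> mat_image D'"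
    and comm: "A * B' = - (B * D')"
  shows "mat_image (four_block_mat A' B' (0\<^sub>m n' l) D') = mat_kernel (four_block_mat A B (0\<^sub>m m' n) D)"
    (is "mat_image ?M' = mat_kernel ?M")
proof -
  have M: "?M \<in> carrier_mat (m + m') (n + n')" "?M' \<in> carrier_mat (n + n') (l + l')"
    using four_block_carrier_mat[OF A D] four_block_carrier_mat[OF A' D'] by auto
  have Mv: "?M *\<^sub>v (v @\<^sub>v w) = (A *\<^sub>v v + B *\<^sub>v w) @\<^sub>v (D *\<^sub>v w)"
    if "v \<in> carrier_vec n" "w \<in> carrier_vec n'" for v w
  proof -
    have "0\<^sub>m m' n *\<^sub>v v + D *\<^sub>v w = D *\<^sub>v w" using that D by (intro eq_vecI) (auto simp: scalar_prod_def)
    then show ?thesis using four_block_mat_mult_vec[OF A B _ D that, of "0\<^sub>m m' n"] by simp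
  qed
  have M'v: "?M' *\<^sub>v (v @\<^sub>v w) = (A' *\<^sub>v v + B' *\<^sub>v w) @\<^sub>v (D' *\<^sub>v w)"
    if "v \<in> carrier_vec l" "w \<in> carrier_vec l'" for v w
  proof -
    have "0\<^sub>m n' l *\<^sub>v v + D' *\<^sub>v w = D' *\<^sub>v w" using that D' by (intro eq_vecI) (auto simp: scalar_prod_def)
    then show ?thesis using four_block_mat_mult_vec[OF A' B' _ D' that, of "0\<^sub>m n' l"] by simp
  qed
  have AB': "A *\<^sub>v (B' *\<^sub>v w) = - (B *\<^sub>v (D' *\<^sub>v w))" if "w \<in> carrier_vec l'" for w
  proof -
    have "A *\<^sub>v (B' *\<^sub>v w) = (- (B * D')) *\<^sub>v w"
      using assoc_mult_mat_vec[OF A B' that] comm by simp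
    also have "\<dots> = - ((B * D') *\<^sub>v w)"
      using B D' that by (intro uminus_mult_mat_vec) auto
    finally show ?thesis using assoc_mult_mat_vec[OF B D' that] by simp
  qed
  show ?thesis
  proof
    show "mat_image ?M' \<subseteq> mat_kernel ?M"
    proof
      fix u assume "u \<in> mat_image ?M'"
      then obtain x where x: "x \<in> carrier_vec (l + l')" "u = ?M' *\<^sub>v x"
        using M by (auto simp: mat_image_def)
      define v w where "v = vec_first x l" and "w = vec_last x l'"
      have vw: "v \<in> carrier_vec l" "w \<in> carrier_vec l'" "x = v @\<^sub>v w"
        using x(1) by (simp_all add: v_def w_def)
      have u: "u = (A' *\<^sub>v v + B' *\<^sub>v w) @\<^sub>v (D' *\<^sub>v w)" using x(2) M'v[OF vw(1,2)] vw(3) by simp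
      have c: "A' *\<^sub>v v \<in> carrier_vec n" "B' *\<^sub>v w \<in> carrier_vec n" "D' *\<^sub>v w \<in> carrier_vec n'"
        using A' B' D' vw by auto
      have "A' *\<^sub>v v \<in> mat_image A'" using A' vw by (auto simp: mat_image_def)
      then have z: "A *\<^sub>v (A' *\<^sub>v v) = 0\<^sub>v m" using ker mat_kernelD[OF A] by blast
      have "D' *\<^sub>v w \<in> mat_image D'" using D' vw by (auto simp: mat_image_def)
      then have z': "D *\<^sub>v (D' *\<^sub>v w) = 0\<^sub>v m'" using DD mat_kernelD[OF D] by blast
      have "A *\<^sub>v (A' *\<^sub>v v + B' *\<^sub>v w) + B *\<^sub>v (D' *\<^sub>v w) = 0\<^sub>v m"
        unfolding mult_add_distrib_mat_vec[OF A c(1,2)] z AB'[OF vw(2)]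
        using B c by (intro eq_vecI) auto
      then have "?M *\<^sub>v u = 0\<^sub>v (m + m')"
        unfolding u using Mv[of "A' *\<^sub>v v + B' *\<^sub>v w" "D' *\<^sub>v w"] c z' by (auto intro!: eq_vecI)
      moreover have "u \<in> carrier_vec (n + n')" unfolding u using c by auto
      ultimately show "u \<in> mat_kernel ?M" by (intro mat_kernelI[OF M(1)])
    qed
    show "mat_kernel ?M \<subseteq> mat_image ?M'"
    proof
      fix u assume "u \<in> mat_kernel ?M"
      note uk = mat_kernelD[OF M(1) this]
      define v w where "v = vec_first u n" and "w = vec_last u n'"
      have vw: "v \<in> carrier_vec n" "w \<in> carrier_vec n'" "u = v @\<^sub>v w"
        using uk(1) by (simp_all add: v_def w_def)
      have c: "A *\<^sub>v v \<in> carrier_vec m" "B *\<^sub>v w \<in> carrier_vec m" using A B vw by auto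
      have "(A *\<^sub>v v + B *\<^sub>v w) @\<^sub>v (D *\<^sub>v w) = 0\<^sub>v m @\<^sub>v 0\<^sub>v m'"
        using Mv[OF vw(1,2)] uk(2) vw(3) by (auto intro!: eq_vecI)
      then have k: "A *\<^sub>v v + B *\<^sub>v w = 0\<^sub>v m" "D *\<^sub>v w = 0\<^sub>v m'"
        using append_vec_eq[of "A *\<^sub>v v + B *\<^sub>v w" m "0\<^sub>v m"] c by auto
      have "B *\<^sub>v w = - (A *\<^sub>v v)"
      proof (rule eq_vecI)
        fix i assume "i < dim_vec (- (A *\<^sub>v v))"
        then have i: "i < m" using A by auto
        then have "(A *\<^sub>v v) $ i + (B *\<^sub>v w) $ i = 0"
          using arg_cong[OF k(1), of "\<lambda>v. v $ i"] A B by auto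
        then show "(B *\<^sub>v w) $ i = (- (A *\<^sub>v v)) $ i" using i A by (simp add: eq_neg_iff_add_eq_0 add.commute)
      qed (use A B in auto)
      also have "\<dots> = A *\<^sub>v (- v)" using A vw by (intro eq_vecI) auto
      finally have "B *\<^sub>v w \<in> mat_image A" using A vw by (auto simp: mat_image_def)
      moreover have "w \<in> mat_kernel D" using k(2) vw by (intro mat_kernelI[OF D])
      ultimately have "w \<in> mat_image D'" by (rule lift[rotated])
      \<comment> \<open>Diagram chase: \<open>w\<close> comes from \<open>w'\<close>, and correcting
        \<open>v\<close> by B' w' moves it into the kernel of \<open>A\<close>, hence into the image
        of \<open>A'\<close>.\<close>
      then obtain w' where w': "w' \<in> carrier_vec l'" "w = D' *\<^sub>v w'"
        using D' by (auto simp: mat_image_def)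
      have B'c: "B' *\<^sub>v w' \<in> carrier_vec n" using B' w' by auto
      have "A *\<^sub>v (v - B' *\<^sub>v w') = A *\<^sub>v v - A *\<^sub>v (B' *\<^sub>v w')"
        by (rule mult_minus_distrib_mat_vec[OF A vw(1) B'c])
      also have "\<dots> = A *\<^sub>v v + B *\<^sub>v w"
        unfolding AB'[OF w'(1)] w'(2)[symmetric] using c by (intro eq_vecI) auto
      finally have "v - B' *\<^sub>v w' \<in> mat_kernel A"
        using k vw B'c by (intro mat_kernelI[OF A]) auto
      then obtain v' where v': "v' \<in> carrier_vec l" "v - B' *\<^sub>v w' = A' *\<^sub>v v'"
        using ker A' by (force simp: mat_image_def)
      have "v = A' *\<^sub>v v' + B' *\<^sub>v w'"
        unfolding v'(2)[symmetric] using vw B' by (intro eq_vecI) auto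
      then have "u = ?M' *\<^sub>v (v' @\<^sub>v w')"
        using M'v[OF v'(1) w'(1)] vw(3) w'(2) by simp
      moreover have "v' @\<^sub>v w' \<in> carrier_vec (l + l')" using v' w' by simp
      ultimately show "u \<in> mat_image ?M'"
        using M(2) unfolding mat_image_def by auto
    qed
  qed
qed

text \<open>As (J + (g)) / J is isomorphic to (R/\<cc>)(-g) for \<cc> = J : g, a lift of
  multiplication by the monomial g to the two complexes has a cone that resolves J + (g).\<close>

lemma mapping_cone:
  fixes \<phi> \<kappa> :: "nat \<Rightarrow> 'k::field poly3 mat"
  assumes F: "multigraded_resolution J F \<phi>" and K: "cyclic_resolution g \<cc> K \<kappa>"
    and colon: "\<And>r. r * mon g \<in> J \<longleftrightarrow> r \<in> \<cc>"
  shows "\<exists>\<phi>'. multigraded_resolution {j + r * mon g | j r. j \<in> J} (\<lambda>i. F i @ K (Suc i)) \<phi>'"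
proof -
  \<comment> \<open>Prepending R to \<open>F\<close> makes the augmentation a map like the others.
    The initial zero module of \<open>K\<close> matches it, so one block shape fits all
    indices.\<close>
  define C where "C i = (case i of 0 \<Rightarrow> [0] | Suc i' \<Rightarrow> F i')" for i
  have C [simp]: "C 0 = [0]" "C (Suc i) = F i" for i by (simp_all add: C_def)
  have \<phi>: "hom_mat (\<lambda>m. m) (C (Suc i)) (C i) (\<phi> i)" for i
    using F by (cases i) (simp_all add: multigraded_resolution_def)
  have \<phi>_ker: "mat_image (\<phi> (Suc i)) = mat_kernel (\<phi> i)"
    and \<phi>_J: "(\<lambda>v. v $ 0) ` mat_image (\<phi> 0) = J" for i
    using F by (simp_all add: multigraded_resolution_def)
  have K01: "K 0 = []" "K (Suc 0) = [g]" and \<kappa>: "hom_mat (\<lambda>m. m) (K (Suc i)) (K i) (\<kappa> i)"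
    and \<kappa>_ker: "mat_image (\<kappa> (Suc (Suc i))) = mat_kernel (\<kappa> (Suc i))"
    and \<kappa>_c: "(\<lambda>v. v $ 0) ` mat_image (\<kappa> (Suc 0)) = \<cc>" for i
    using K by (simp_all add: cyclic_resolution_def)
  have \<phi>c: "\<phi> i \<in> carrier_mat (length (C i)) (length (C (Suc i)))"
    and \<kappa>c: "\<kappa> i \<in> carrier_mat (length (K i)) (length (K (Suc i)))" for i
    using \<phi>[of i] \<kappa>[of i] by (simp_all add: hom_mat_def)
  have \<kappa>\<kappa>: "mat_image (\<kappa> (Suc i)) \<subseteq> mat_kernel (\<kappa> i)" for i
  proof (cases i)
    case 0
    have "v \<in> mat_kernel (\<kappa> 0)" if "v \<in> mat_image (\<kappa> (Suc 0))" for v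
      using that \<kappa>c[of 0] \<kappa>c[of 1] K01 by (auto simp: mat_image_def mat_kernel_def intro!: eq_vecI)
    with 0 show ?thesis by blast
  qed (simp add: \<kappa>_ker)
  have J_mem: "v \<in> mat_image (\<phi> 0) \<longleftrightarrow> v $ 0 \<in> J" if "v \<in> carrier_vec 1" for v
  proof
    assume "v $ 0 \<in> J"
    then obtain u where u: "u \<in> mat_image (\<phi> 0)" "u $ 0 = v $ 0" using \<phi>_J by force
    then have "u = v" using that \<phi>c[of 0] by (intro eq_vecI) (auto simp: mat_image_def)
    with u show "v \<in> mat_image (\<phi> 0)" by simp
  qed (use \<phi>_J in blast)
  have c_mem: "v \<in> mat_image (\<kappa> (Suc 0)) \<longleftrightarrow> v $ 0 \<in> \<cc>" if "v \<in> carrier_vec 1" for v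
  proof
    assume "v $ 0 \<in> \<cc>"
    then obtain u where u: "u \<in> mat_image (\<kappa> (Suc 0))" "u $ 0 = v $ 0" using \<kappa>_c by force
    then have "u = v" using that \<kappa>c[of 1] K01 by (intro eq_vecI) (auto simp: mat_image_def)
    with u show "v \<in> mat_image (\<kappa> (Suc 0))" by simp
  qed (use \<kappa>_c in blast)
  define W\<^sub>0 :: "'k poly3 mat" where "W\<^sub>0 = mat 1 1 (\<lambda>_. mon g)"
  have W0c: "W\<^sub>0 \<in> carrier_mat 1 1" by (simp add: W\<^sub>0_def)
  have W0v: "W\<^sub>0 *\<^sub>v v \<in> carrier_vec 1" "(W\<^sub>0 *\<^sub>v v) $ 0 = v $ 0 * mon g" if "v \<in> carrier_vec 1" for v
    using mult_mat_vec_carrier[OF W0c that] mat_mult_vec_index[OF W0c that, of 0]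
    by (simp_all add: W\<^sub>0_def mult.commute)
  define good where "good i W \<longleftrightarrow> hom_mat (\<lambda>m. m) (K (Suc i)) (C i) W \<and>
    (\<forall>v\<in>mat_image (\<kappa> (Suc i)). W *\<^sub>v v \<in> mat_image (\<phi> i))" for i W
  \<comment> \<open>The sign is put into the lifts instead of into \<kappa>, so that consecutive
    block matrices multiply to zero.\<close>
  have step: "\<exists>W'. good (Suc i) W' \<and> \<phi> i * W' = - (W * \<kappa> (Suc i))" if "good i W" for i W
  proof -
    have W: "hom_mat (\<lambda>m. m) (K (Suc i)) (C i) W"
      and Wv: "\<And>v. v \<in> mat_image (\<kappa> (Suc i)) \<Longrightarrow> W *\<^sub>v v \<in> mat_image (\<phi> i)"
      using that by (simp_all add: good_def)
    have Wc: "W \<in> carrier_mat (length (C i)) (length (K (Suc i)))" using W by (simp add: hom_mat_def)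
    have W\<kappa>: "W * \<kappa> (Suc i) \<in> carrier_mat (length (C i)) (length (K (Suc (Suc i))))"
      using Wc \<kappa>c[of "Suc i"] by auto
    have "\<exists>W'. hom_mat (\<lambda>m. m) (K (Suc (Suc i))) (C (Suc i)) W' \<and> \<phi> i * W' = - (W * \<kappa> (Suc i))"
    proof (rule hom_lift_mat[OF refl \<phi>])
      have h: "hom_mat (\<lambda>m. m) (K (Suc (Suc i))) (C i) (W * \<kappa> (Suc i))"
        using hom_mat_mult[OF refl W \<kappa>] .
      show "hom_mat (\<lambda>m. m) (K (Suc (Suc i))) (C i) (- (W * \<kappa> (Suc i)))"
      proof (rule hom_matI)
        fix r c m assume rc: "r < length (C i)" "c < length (K (Suc (Suc i)))"
          and "m \<in> keys ((- (W * \<kappa> (Suc i))) $$ (r, c))"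
        then have "m \<in> keys ((W * \<kappa> (Suc i)) $$ (r, c))"
          using carrier_matD[OF W\<kappa>] by (simp add: in_keys_iff del: index_mult_mat)
        with hom_mat_entry[OF h rc] show "m + C i ! r = K (Suc (Suc i)) ! c" by blast
      qed (use W\<kappa> in simp)
      fix c assume c: "c < length (K (Suc (Suc i)))"
      have "col (W * \<kappa> (Suc i)) c \<in> mat_image (\<phi> i)"
        using Wv[OF col_mult_mem_image[OF \<kappa>c c]] col_mult2[OF Wc \<kappa>c c] by simp
      then obtain u where u: "u \<in> carrier_vec (length (C (Suc i)))" "\<phi> i *\<^sub>v u = col (W * \<kappa> (Suc i)) c"
        using \<phi>c[of i] by (auto simp: mat_image_def)
      have "col (- (W * \<kappa> (Suc i))) c = - col (W * \<kappa> (Suc i)) c"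
        using W\<kappa> c by (intro eq_vecI) (auto simp del: index_mult_mat(1))
      also have "\<dots> = \<phi> i *\<^sub>v (- u)"
        unfolding u(2)[symmetric] using u(1) \<phi>c[of i] by (intro eq_vecI) auto
      finally show "col (- (W * \<kappa> (Suc i))) c \<in> mat_image (\<phi> i)"
        using u(1) \<phi>c[of i] by (auto simp: mat_image_def)
    qed
    then obtain W' where W': "hom_mat (\<lambda>m. m) (K (Suc (Suc i))) (C (Suc i)) W'" "\<phi> i * W' = - (W * \<kappa> (Suc i))"
      by blast
    have W'c: "W' \<in> carrier_mat (length (C (Suc i))) (length (K (Suc (Suc i))))"
      using W'(1) by (simp add: hom_mat_def)
    have "W' *\<^sub>v v \<in> mat_image (\<phi> (Suc i))" if v: "v \<in> mat_image (\<kappa> (Suc (Suc i)))" for v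
    proof -
      note vk = mat_kernelD[OF \<kappa>c v[unfolded \<kappa>_ker]]
      have "\<phi> i *\<^sub>v (W' *\<^sub>v v) = - (W * \<kappa> (Suc i)) *\<^sub>v v"
        using assoc_mult_mat_vec[OF \<phi>c W'c vk(1)] W'(2) by simp
      also have "\<dots> = - (W *\<^sub>v (\<kappa> (Suc i) *\<^sub>v v))"
        using uminus_mult_mat_vec[of v "W * \<kappa> (Suc i)"] W\<kappa> vk(1) assoc_mult_mat_vec[OF Wc \<kappa>c vk(1)]
        by auto
      also have "\<dots> = 0\<^sub>v (length (C i))"
        unfolding vk(2) using Wc by (intro eq_vecI) auto
      finally show ?thesis
        unfolding \<phi>_ker using W'c vk(1) by (intro mat_kernelI[OF \<phi>c]) auto
    qed
    with W' show ?thesis unfolding good_def by blast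
  qed
  have "good 0 W\<^sub>0"
    unfolding good_def
  proof
    show "hom_mat (\<lambda>m. m) (K (Suc 0)) (C 0) W\<^sub>0"
      by (rule hom_matI) (auto simp: K01 W\<^sub>0_def)
    show "\<forall>v\<in>mat_image (\<kappa> (Suc 0)). W\<^sub>0 *\<^sub>v v \<in> mat_image (\<phi> 0)"
    proof
      fix v assume v: "v \<in> mat_image (\<kappa> (Suc 0))"
      then have vc: "v \<in> carrier_vec 1" using \<kappa>c[of 1] K01 by (auto simp: mat_image_def)
      with v have "v $ 0 \<in> \<cc>" using c_mem by blast
      then show "W\<^sub>0 *\<^sub>v v \<in> mat_image (\<phi> 0)" using W0v[OF vc] J_mem colon by simp
    qed
  qed
  then obtain W where W: "\<And>i. good i (W i)" "\<And>i. \<phi> i * W (Suc i) = - (W i * \<kappa> (Suc i))" and W0: "W 0 = W\<^sub>0"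
    using dependent_nat_choice[of "\<lambda>i W. good i W \<and> (i = 0 \<longrightarrow> W = W\<^sub>0)" "\<lambda>i W W'. \<phi> i * W' = - (W * \<kappa> (Suc i))"]
      step by (metis nat.distinct(1))
  have Wh: "hom_mat (\<lambda>m. m) (K (Suc i)) (C i) (W i)" for i
    using W(1) by (simp add: good_def)
  then have Wc: "W i \<in> carrier_mat (length (C i)) (length (K (Suc i)))" for i
    by (simp add: hom_mat_def)
  define \<phi>' where "\<phi>' i = four_block_mat (\<phi> i) (W i) (0\<^sub>m (length (K i)) (length (C (Suc i)))) (\<kappa> i)" for i
  have "multigraded_resolution {j + r * mon g | j r. j \<in> J} (\<lambda>i. F i @ K (Suc i)) \<phi>'"
    unfolding multigraded_resolution_def
  proof (intro conjI allI)
    have h: "hom_mat (\<lambda>m. m) (C (Suc i) @ K (Suc i)) (C i @ K i) (\<phi>' i)" for i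
      unfolding \<phi>'_def by (rule hom_mat_four_block[OF \<phi> Wh \<kappa>])
    from h[of 0] K01 show "hom_mat (\<lambda>m. m) (F 0 @ K (Suc 0)) [0] (\<phi>' 0)" by simp
    from h[of "Suc i" for i] show "hom_mat (\<lambda>m. m) (F (Suc i) @ K (Suc (Suc i))) (F i @ K (Suc i)) (\<phi>' (Suc i))" for i
      by simp
    show "mat_image (\<phi>' (Suc i)) = mat_kernel (\<phi>' i)" for i
      unfolding \<phi>'_def
    proof (rule four_block_exact[OF \<phi>c Wc \<kappa>c \<phi>c Wc \<kappa>c \<phi>_ker \<kappa>\<kappa> _ W(2)])
      fix \<gamma> assume \<gamma>: "\<gamma> \<in> mat_kernel (\<kappa> i)" "W i *\<^sub>v \<gamma> \<in> mat_image (\<phi> i)"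
      show "\<gamma> \<in> mat_image (\<kappa> (Suc i))"
      \<comment> \<open>Only at index 0 does exactness of \<open>K\<close> fail; there
        multiplication by g lands in \<open>J\<close> exactly on \<cc>.\<close>
      proof (cases i)
        case 0
        then have \<gamma>c: "\<gamma> \<in> carrier_vec 1" using \<gamma>(1) mat_kernelD(1)[OF \<kappa>c] K01 by fastforce
        from \<gamma>(2) have "\<gamma> $ 0 * mon g \<in> J" using 0 W0 W0v[OF \<gamma>c] J_mem by auto
        with 0 show ?thesis using c_mem[OF \<gamma>c] colon by simp
      qed (use \<gamma>(1) \<kappa>_ker in simp)
    qed
    have e: "(\<phi>' 0 *\<^sub>v (v @\<^sub>v w)) $ 0 = (\<phi> 0 *\<^sub>v v) $ 0 + w $ 0 * mon g"
      if "v \<in> carrier_vec (length (F 0))" "w \<in> carrier_vec 1" for v w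
    proof -
      have "\<phi>' 0 *\<^sub>v (v @\<^sub>v w) = (\<phi> 0 *\<^sub>v v + W 0 *\<^sub>v w) @\<^sub>v (0\<^sub>m (length (K 0)) (length (C (Suc 0))) *\<^sub>v v + \<kappa> 0 *\<^sub>v w)"
        unfolding \<phi>'_def using that K01 by (intro four_block_mat_mult_vec[OF \<phi>c Wc _ \<kappa>c]) auto
      then show ?thesis using that \<phi>c[of 0] W0c W0 W0v(2)[OF that(2)] K01 \<kappa>c[of 0] by auto
    qed
    have dim: "dim_col (\<phi>' 0) = length (F 0) + 1"
      unfolding \<phi>'_def using \<phi>c[of 0] \<kappa>c[of 0] K01 by auto
    show "(\<lambda>v. v $ 0) ` mat_image (\<phi>' 0) = {j + r * mon g | j r. j \<in> J}"
    proof (rule subset_antisym; rule subsetI)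
      fix f assume "f \<in> (\<lambda>v. v $ 0) ` mat_image (\<phi>' 0)"
      then obtain u where u: "u \<in> carrier_vec (length (F 0) + 1)" "f = (\<phi>' 0 *\<^sub>v u) $ 0"
        using dim by (auto simp: mat_image_def)
      have "u = vec_first u (length (F 0)) @\<^sub>v vec_last u 1" using u(1) by simp
      with u(2) e[of "vec_first u (length (F 0))" "vec_last u 1"]
      have "f = (\<phi> 0 *\<^sub>v vec_first u (length (F 0))) $ 0 + vec_last u 1 $ 0 * mon g" by simp
      moreover have "\<phi> 0 *\<^sub>v vec_first u (length (F 0)) \<in> mat_image (\<phi> 0)"
        using \<phi>c[of 0] by (auto simp: mat_image_def)
      then have "(\<phi> 0 *\<^sub>v vec_first u (length (F 0))) $ 0 \<in> J"
        using \<phi>_J by blast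
      ultimately show "f \<in> {j + r * mon g | j r. j \<in> J}" by blast
    next
      fix f assume "f \<in> {j + r * mon g | j r. j \<in> J}"
      then obtain j r where jr: "f = j + r * mon g" "j \<in> J" by blast
      then obtain v where v: "v \<in> carrier_vec (length (F 0))" "(\<phi> 0 *\<^sub>v v) $ 0 = j"
        using \<phi>_J \<phi>c[of 0] by (fastforce simp: mat_image_def)
      define w where "w = vec 1 (\<lambda>_. r)"
      have w: "w \<in> carrier_vec 1" "w $ 0 = r" by (simp_all add: w_def)
      have "(\<phi>' 0 *\<^sub>v (v @\<^sub>v w)) $ 0 = f" using e[OF v(1) w(1)] v(2) w(2) jr(1) by simp
      moreover have "v @\<^sub>v w \<in> carrier_vec (dim_col (\<phi>' 0))"
        unfolding dim using v(1) w(1) by (rule append_carrier_vec)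
      ultimately show "f \<in> (\<lambda>v. v $ 0) ` mat_image (\<phi>' 0)"
        unfolding mat_image_def by blast
    qed
  qed
  then show ?thesis by blast
qed

section \<open>Resolutions of R, R/(x) and R/(x, y)\<close>

lemma mat_image_empty:
  assumes "A \<in> carrier_mat n 0"
  shows "mat_image (A :: 'a::comm_ring_1 mat) = {0\<^sub>v n}"
proof -
  have "A *\<^sub>v v = 0\<^sub>v n" if "v \<in> carrier_vec 0" for v
    using assms that by (intro eq_vecI) (auto simp: scalar_prod_def)
  then have "(\<lambda>v. A *\<^sub>v v) ` carrier_vec 0 = (\<lambda>_. 0\<^sub>v n) ` (carrier_vec 0 :: 'a vec set)"
    by (intro image_cong) simp_all
  also have "\<dots> = {0\<^sub>v n}" using zero_carrier_vec[of 0] by (rule image_constant)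
  finally show ?thesis using assms unfolding mat_image_def by simp
qed

lemma mult_mat_zero_vec:
  assumes "A \<in> carrier_mat m n"
  shows "A *\<^sub>v 0\<^sub>v n = (0\<^sub>v m :: 'a::comm_ring_1 vec)"
  using assms by (intro eq_vecI) (auto simp: scalar_prod_def)

lemma mat_kernel_empty:
  assumes "A \<in> carrier_mat n 0"
  shows "mat_kernel (A :: 'a::comm_ring_1 mat) = {0\<^sub>v 0}"
proof -
  have "A *\<^sub>v v = 0\<^sub>v n" if "v \<in> carrier_vec 0" for v
    using assms that by (intro eq_vecI) (auto simp: scalar_prod_def)
  then show ?thesis using assms unfolding mat_kernel_def by auto
qed

lemma hom_mat_zero: "hom_mat deg e d (0\<^sub>m (length d) (length e))"
  by (rule hom_matI) auto

lemma mem_principal_monomial: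
  fixes f :: "'k::field poly3"
  assumes "\<And>k. k \<in> keys f \<Longrightarrow> mono_le m k"
  shows "\<exists>c. f = mon m * c"
proof -
  have "f \<in> ideal_gen (mon ` {m})"
    unfolding mem_monomial_span_iff using assms by blast
  then show ?thesis
    unfolding module.span_insert[OF module_self] image_insert image_empty module.span_empty[OF module_self]
    by (auto simp: mult.commute)
qed

lemma mem_pair_monomial:
  fixes f :: "'k::field poly3"
  assumes "\<And>k. k \<in> keys f \<Longrightarrow> mono_le m k \<or> mono_le n k"
  shows "\<exists>a b. f = mon m * a + mon n * b"
proof -
  have "f \<in> ideal_gen (mon ` {m, n})"
    unfolding mem_monomial_span_iff using assms by blast
  then obtain a b where "f - a * mon m - b * mon n = 0"
    unfolding module.span_insert[OF module_self] image_insert image_empty module.span_empty[OF module_self]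
    by blast
  then have "f = mon m * a + mon n * b" by (simp add: algebra_simps)
  then show ?thesis by blast
qed

text \<open>Since x and y are coprime, x a = - y b forces y to divide every monomial of
  \<open>a\<close>; then y cancels.\<close>

lemma koszul_relation:
  fixes a b :: "'k::field poly3"
  assumes "mon (1, 0, 0) * a + mon (0, 1, 0) * b = 0"
  shows "\<exists>c. a = mon (0, 1, 0) * c \<and> b = - (mon (1, 0, 0) * c)"
proof -
  have e: "mon (1, 0, 0) * a = mon (0, 1, 0) * (- b)"
    using assms by (simp add: eq_neg_iff_add_eq_0)
  have "mono_le (0, 1, 0) k" if "k \<in> keys a" for k
  proof -
    have "(1, 0, 0) + k \<in> keys (mon (0, 1, 0) * (- b))"
      using that e keys_mon_mult[of "(1, 0, 0)" a] by auto
    then have "mono_le (0, 1, 0) ((1, 0, 0) + k)"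
      unfolding keys_mon_mult by (auto simp: mono_le_def)
    then show ?thesis by (cases k) simp
  qed
  then obtain c where c: "a = mon (0, 1, 0) * c"
    using mem_principal_monomial by blast
  have "mon (0, 1, 0) * (mon (1, 0, 0) * c + b) = 0"
    using assms by (simp add: c algebra_simps)
  then have "mon (1, 0, 0) * c + b = 0"
    by (rule mon_mult_eq_0)
  with c show ?thesis by (metis add.commute eq_neg_iff_add_eq_0)
qed

lemma cyclic_resolution_zero:
  "\<exists>K \<kappa>. cyclic_resolution g ({0} :: 'k::field poly3 set) K \<kappa> \<and> (\<forall>i\<ge>2. K i = [])"
proof -
  define K where "K i = (if i = 1 then [g] else [])" for i :: nat
  define \<kappa> :: "nat \<Rightarrow> 'k poly3 mat" where "\<kappa> i = 0\<^sub>m (length (K i)) (length (K (Suc i)))" for i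
  have "cyclic_resolution g {0} K \<kappa>"
    unfolding cyclic_resolution_def
  proof (intro conjI allI)
    show "hom_mat (\<lambda>m. m) (K (Suc i)) (K i) (\<kappa> i)" for i
      unfolding \<kappa>_def by (rule hom_mat_zero)
    have "\<kappa> 1 \<in> carrier_mat 1 0" by (simp add: \<kappa>_def K_def)
    from mat_image_empty[OF this] show "(\<lambda>v. v $ 0) ` mat_image (\<kappa> 1) = {0}" by simp
    have "\<kappa> (Suc i) \<in> carrier_mat (length (K (Suc i))) 0" for i by (simp add: \<kappa>_def K_def)
    from mat_image_empty[OF this[of "Suc i" for i]] mat_kernel_empty[OF this]
    show "mat_image (\<kappa> (Suc (Suc i))) = mat_kernel (\<kappa> (Suc i))" for i by (simp add: K_def)
  qed (simp_all add: K_def)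
  then show ?thesis by (auto simp: K_def intro!: exI[of _ K] exI[of _ \<kappa>])
qed

lemma vec_1_eqI: "v \<in> carrier_vec 1 \<Longrightarrow> w \<in> carrier_vec 1 \<Longrightarrow> v $ 0 = w $ 0 \<Longrightarrow> v = w"
  by (intro eq_vecI) auto

lemma cyclic_resolution_x:
  "\<exists>K \<kappa>. cyclic_resolution g (range ((*) (mon (1, 0, 0))) :: 'k::field poly3 set) K \<kappa> \<and>
    K 2 = [g + (1, 0, 0)] \<and> (\<forall>i\<ge>3. K i = [])"
proof -
  define K where "K i = (if i = 1 then [g] else if i = 2 then [g + (1, 0, 0)] else [])" for i :: nat
  define \<kappa> :: "nat \<Rightarrow> 'k poly3 mat" where
    "\<kappa> i = (if i = 1 then mat 1 1 (\<lambda>_. mon (1, 0, 0)) else 0\<^sub>m (length (K i)) (length (K (Suc i))))" for i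
  have K: "K 0 = []" "K 1 = [g]" "K 2 = [g + (1, 0, 0)]" "i \<ge> 3 \<Longrightarrow> K i = []" for i
    by (simp_all add: K_def)
  have c1: "\<kappa> 1 \<in> carrier_mat 1 1" by (simp add: \<kappa>_def)
  have v1: "(\<kappa> 1 *\<^sub>v v) $ 0 = mon (1, 0, 0) * v $ 0" if "v \<in> carrier_vec 1" for v
    using mat_mult_vec_index[OF c1 that, of 0] by (simp add: \<kappa>_def)
  have "cyclic_resolution g (range ((*) (mon (1, 0, 0)))) K \<kappa>"
    unfolding cyclic_resolution_def
  proof (intro conjI allI)
    show "hom_mat (\<lambda>m. m) (K (Suc i)) (K i) (\<kappa> i)" for i
    proof (cases "i = 1")
      case True
      show ?thesis
        unfolding True by (rule hom_matI) (auto simp: K_def \<kappa>_def add.commute)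
    qed (simp add: \<kappa>_def hom_mat_zero)
    show "(\<lambda>v. v $ 0) ` mat_image (\<kappa> 1) = range ((*) (mon (1, 0, 0)))"
    proof (rule subset_antisym; rule subsetI)
      fix f assume "f \<in> (\<lambda>v. v $ 0) ` mat_image (\<kappa> 1)"
      then obtain v where "v \<in> carrier_vec 1" "f = (\<kappa> 1 *\<^sub>v v) $ 0"
        unfolding mat_image_def carrier_matD(2)[OF c1] by blast
      with v1 show "f \<in> range ((*) (mon (1, 0, 0)))" by simp
    next
      fix f assume "f \<in> range ((*) (mon (1, 0, 0) :: 'k poly3))"
      then obtain c where "f = mon (1, 0, 0) * c" by blast
      then have "f = (\<kappa> 1 *\<^sub>v vec 1 (\<lambda>_. c)) $ 0" using v1[of "vec 1 (\<lambda>_. c)"] by simp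
      moreover have "vec 1 (\<lambda>_. c) \<in> carrier_vec (dim_col (\<kappa> 1))" using c1 by simp
      ultimately show "f \<in> (\<lambda>v. v $ 0) ` mat_image (\<kappa> 1)"
        unfolding mat_image_def by blast
    qed
    have c: "\<kappa> i \<in> carrier_mat (length (K i)) 0" if "i \<ge> 2" for i
      using that by (simp add: \<kappa>_def K)
    have "mat_kernel (\<kappa> 1) = {0\<^sub>v 1}"
    proof (rule subset_antisym; rule subsetI)
      fix v assume "v \<in> mat_kernel (\<kappa> 1)"
      note vk = mat_kernelD[OF c1 this]
      have "mon (1, 0, 0) * v $ 0 = 0" using v1[OF vk(1)] vk(2) by simp
      from mon_mult_eq_0[OF this] vk(1) show "v \<in> {0\<^sub>v 1}" by (auto intro!: vec_1_eqI)
    next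
      show "v \<in> mat_kernel (\<kappa> 1)" if "v \<in> {0\<^sub>v 1}" for v
        using that mult_mat_zero_vec[OF c1] by (intro mat_kernelI[OF c1]) auto
    qed
    moreover have "mat_kernel (\<kappa> (Suc i)) = {0\<^sub>v 0}" if "i \<ge> 1" for i
      using mat_kernel_empty[OF c[of "Suc i"]] that by simp
    moreover have "mat_image (\<kappa> (Suc (Suc i))) = {0\<^sub>v (length (K (Suc (Suc i))))}" for i
      using mat_image_empty[OF c[of "Suc (Suc i)"]] by simp
    ultimately show "mat_image (\<kappa> (Suc (Suc i))) = mat_kernel (\<kappa> (Suc i))" for i
      by (cases i) (simp_all add: K_def)
  qed (simp_all add: K_def)
  then show ?thesis using K by blast
qed

text \<open>The Koszul complex on x and y, moved up by one index because of the initial zero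
  module.\<close>

lemma cyclic_resolution_xy:
  "\<exists>K \<kappa>. cyclic_resolution g ({mon (1, 0, 0) * a + mon (0, 1, 0) * b | a b. True} :: 'k::field poly3 set) K \<kappa> \<and>
    K 2 = [g + (1, 0, 0), g + (0, 1, 0)] \<and> K 3 = [g + (1, 1, 0)] \<and> (\<forall>i\<ge>4. K i = [])"
proof -
  let ?x = "mon (1, 0, 0) :: 'k poly3" and ?y = "mon (0, 1, 0) :: 'k poly3"
  define K where "K i = (if i = 1 then [g] else if i = 2 then [g + (1, 0, 0), g + (0, 1, 0)]
    else if i = 3 then [g + (1, 1, 0)] else [])" for i :: nat
  define \<kappa> :: "nat \<Rightarrow> 'k poly3 mat" where
    "\<kappa> i = (if i = 1 then mat 1 2 (\<lambda>(r, c). if c = 0 then ?x else ?y)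
      else if i = 2 then mat 2 1 (\<lambda>(r, c). if r = 0 then ?y else - ?x)
      else 0\<^sub>m (length (K i)) (length (K (Suc i))))" for i
  have K: "K 0 = []" "K 1 = [g]" "K 2 = [g + (1, 0, 0), g + (0, 1, 0)]" "K 3 = [g + (1, 1, 0)]"
    "i \<ge> 4 \<Longrightarrow> K i = []" for i
    by (simp_all add: K_def)
  have c1: "\<kappa> 1 \<in> carrier_mat 1 2" and c2: "\<kappa> 2 \<in> carrier_mat 2 1" by (simp_all add: \<kappa>_def)
  have v1: "(\<kappa> 1 *\<^sub>v v) $ 0 = ?x * v $ 0 + ?y * v $ 1" if "v \<in> carrier_vec 2" for v
    using mat_mult_vec_index[OF c1 that, of 0] by (simp add: \<kappa>_def eval_nat_numeral)
  have v2: "(\<kappa> 2 *\<^sub>v v) $ 0 = ?y * v $ 0" "(\<kappa> 2 *\<^sub>v v) $ 1 = - (?x * v $ 0)" if "v \<in> carrier_vec 1" for v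
    using mat_mult_vec_index[OF c2 that, of 0] mat_mult_vec_index[OF c2 that, of 1] by (simp_all add: \<kappa>_def)
  have "cyclic_resolution g {?x * a + ?y * b | a b. True} K \<kappa>"
    unfolding cyclic_resolution_def
  proof (intro conjI allI)
    show "hom_mat (\<lambda>m. m) (K (Suc i)) (K i) (\<kappa> i)" for i
    proof -
      consider "i = 1" | "i = 2" | "i \<noteq> 1" "i \<noteq> 2" by blast
      then show ?thesis
      proof cases
        case 1
        have "m + K 1 ! r = K 2 ! c"
          if "r < length (K 1)" "c < length (K 2)" "m \<in> keys (\<kappa> 1 $$ (r, c))" for r c m
          using that unfolding K by (cases c; cases g) (auto simp: \<kappa>_def)
        then show ?thesis unfolding 1 using c1 by (intro hom_matI) (simp_all add: K_def numeral_2_eq_2)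
      next
        case 2
        have "m + K 2 ! r = K 3 ! c"
          if "r < length (K 2)" "c < length (K 3)" "m \<in> keys (\<kappa> 2 $$ (r, c))" for r c m
          using that unfolding K by (cases r; cases g) (auto simp: \<kappa>_def in_keys_iff mon_def lookup_single when_def split: if_splits)
        then show ?thesis unfolding 2 using c2 by (intro hom_matI) (simp_all add: K_def eval_nat_numeral)
      qed (simp add: \<kappa>_def hom_mat_zero)
    qed
    show "(\<lambda>v. v $ 0) ` mat_image (\<kappa> 1) = {?x * a + ?y * b | a b. True}"
    proof (rule subset_antisym; rule subsetI)
      fix f assume "f \<in> (\<lambda>v. v $ 0) ` mat_image (\<kappa> 1)"
      then obtain v where "v \<in> carrier_vec 2" "f = (\<kappa> 1 *\<^sub>v v) $ 0"
        unfolding mat_image_def carrier_matD(2)[OF c1] by blast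
      with v1 show "f \<in> {?x * a + ?y * b | a b. True}" by blast
    next
      fix f assume "f \<in> {?x * a + ?y * b | a b. True}"
      then obtain a b where f: "f = ?x * a + ?y * b" by blast
      define v where "v = vec 2 (\<lambda>i. if i = 0 then a else b)"
      have "v \<in> carrier_vec 2" "v $ 0 = a" "v $ 1 = b" by (simp_all add: v_def)
      then have "f = (\<kappa> 1 *\<^sub>v v) $ 0" "v \<in> carrier_vec (dim_col (\<kappa> 1))" using v1 f c1 by simp_all
      then show "f \<in> (\<lambda>v. v $ 0) ` mat_image (\<kappa> 1)"
        unfolding mat_image_def by blast
    qed
    have c: "\<kappa> i \<in> carrier_mat (length (K i)) 0" if "i \<ge> 3" for i
      using that by (simp add: \<kappa>_def K)
    have k1: "mat_image (\<kappa> 2) = mat_kernel (\<kappa> 1)"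
    proof (rule subset_antisym; rule subsetI)
      fix v assume "v \<in> mat_image (\<kappa> 2)"
      then obtain w where w: "w \<in> carrier_vec 1" "v = \<kappa> 2 *\<^sub>v w"
        unfolding mat_image_def carrier_matD(2)[OF c2] by blast
      have v: "v \<in> carrier_vec 2" using w c2 by auto
      have "(\<kappa> 1 *\<^sub>v v) $ 0 = 0"
        unfolding v1[OF v] v2[OF w(1), folded w(2)] by (simp add: algebra_simps)
      then show "v \<in> mat_kernel (\<kappa> 1)"
        using v c1 by (intro mat_kernelI[OF c1]) (auto intro!: vec_1_eqI)
    next
      fix v assume "v \<in> mat_kernel (\<kappa> 1)"
      note vk = mat_kernelD[OF c1 this]
      have "?x * v $ 0 + ?y * v $ 1 = 0" using v1[OF vk(1)] vk(2) by simp
      from koszul_relation[OF this] obtain c where "v $ 0 = ?y * c" "v $ 1 = - (?x * c)" by blast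
      then have "v = \<kappa> 2 *\<^sub>v vec 1 (\<lambda>_. c)"
        using v2[of "vec 1 (\<lambda>_. c)"] vk(1) c2 by (intro eq_vecI) (auto simp: less_2_cases_iff simp del: index_mult_mat_vec)
      moreover have "vec 1 (\<lambda>_. c) \<in> carrier_vec (dim_col (\<kappa> 2))" using c2 by simp
      ultimately show "v \<in> mat_image (\<kappa> 2)" unfolding mat_image_def by blast
    qed
    have k2: "mat_kernel (\<kappa> 2) = {0\<^sub>v 1}"
    proof (rule subset_antisym; rule subsetI)
      fix v assume "v \<in> mat_kernel (\<kappa> 2)"
      note vk = mat_kernelD[OF c2 this]
      have "?y * v $ 0 = 0" using v2(1)[OF vk(1)] vk(2) by simp
      from mon_mult_eq_0[OF this] vk(1) show "v \<in> {0\<^sub>v 1}" by (auto intro!: vec_1_eqI)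
    next
      show "v \<in> mat_kernel (\<kappa> 2)" if "v \<in> {0\<^sub>v 1}" for v
        using that mult_mat_zero_vec[OF c2] by (intro mat_kernelI[OF c2]) auto
    qed
    have "mat_kernel (\<kappa> (Suc i)) = {0\<^sub>v 0}" if "i \<ge> 2" for i
      using mat_kernel_empty[OF c[of "Suc i"]] that by simp
    moreover have "mat_image (\<kappa> (Suc (Suc i))) = {0\<^sub>v (length (K (Suc (Suc i))))}" if "i \<ge> 1" for i
      using mat_image_empty[OF c[of "Suc (Suc i)"]] that by simp
    moreover have "mat_image (\<kappa> 2) = mat_kernel (\<kappa> (Suc 0))" "mat_image (\<kappa> 3) = mat_kernel (\<kappa> 2)"
      using k1 k2 mat_image_empty[OF c[of 3]] K by simp_all
    ultimately show "mat_image (\<kappa> (Suc (Suc i))) = mat_kernel (\<kappa> (Suc i))" for i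
      by (cases "i = 0"; cases "i = 1") (simp_all add: K_def numeral_2_eq_2 numeral_3_eq_3)
  qed (simp_all add: K_def)
  then show ?thesis using K by blast
qed

section \<open>The Eliahou--Kervaire resolution\<close>

text \<open>
  For a stable ideal, \<open>x g\<close> (and \<open>y g\<close> if \<open>z\<close> divides \<open>g\<close>) is a multiple of a generator that comes
  before \<open>g\<close> when generators are ordered by their \<open>z\<close>-exponents, then by their \<open>y\<close>-exponents. This is
  what the iterated mapping cone needs, and unlike stability it survives the removal of the last
  generator.
\<close>

definition ek_closed :: "mono3 set \<Rightarrow> bool" where
  "ek_closed G \<longleftrightarrow> finite G \<and> (\<forall>g\<in>G. \<forall>h\<in>G. mono_le g h \<longrightarrow> g = h) \<and>
    (\<forall>a b c. (a, b, c) \<in> G \<and> c > 0 \<longrightarrow>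
      (\<exists>a' b' c'. (a', b', c') \<in> G \<and> c' < c \<and> a' \<le> Suc a \<and> b' \<le> b) \<and>
      (\<exists>a' b' c'. (a', b', c') \<in> G \<and> c' < c \<and> a' \<le> a \<and> b' \<le> Suc b)) \<and>
    (\<forall>a b. (a, b, 0) \<in> G \<and> b > 0 \<longrightarrow> (\<exists>a' b'. (a', b', 0) \<in> G \<and> b' < b \<and> a' \<le> Suc a))"

abbreviation non_x_power :: "mono3 set \<Rightarrow> mono3 set" where
  "non_x_power G \<equiv> {g \<in> G. snd g \<noteq> (0, 0)}"

abbreviation z_divisible :: "mono3 set \<Rightarrow> mono3 set" where
  "z_divisible G \<equiv> {g \<in> G. snd (snd g) > 0}"

text \<open>Each generator contributes the Koszul complex on the variables before its last one: none
  for a power of x, then x, and x and y if z divides it.\<close>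

definition ek_resolution :: "mono3 set \<Rightarrow> (nat \<Rightarrow> mono3 list) \<Rightarrow> (nat \<Rightarrow> 'k::field poly3 mat) \<Rightarrow> bool" where
  "ek_resolution G F \<phi> \<longleftrightarrow> multigraded_resolution (ideal_gen (mon ` G)) F \<phi> \<and>
    mset (F 0) = mset_set G \<and>
    mset (F 1) = image_mset (\<lambda>g. g + (1, 0, 0)) (mset_set (non_x_power G)) +
      image_mset (\<lambda>g. g + (0, 1, 0)) (mset_set (z_divisible G)) \<and>
    mset (F 2) = image_mset (\<lambda>g. g + (1, 1, 0)) (mset_set (z_divisible G)) \<and>
    (\<forall>i\<ge>3. F i = [])"

lemma multigraded_resolution_insert:
  fixes \<phi> \<kappa> :: "nat \<Rightarrow> 'k::field poly3 mat"
  assumes F: "multigraded_resolution (ideal_gen (mon ` G)) F \<phi>" and K: "cyclic_resolution g \<cc> K \<kappa>"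
    and colon: "\<And>r. r \<in> \<cc> \<longleftrightarrow> (\<forall>k\<in>keys r. \<exists>s\<in>G. mono_le s (g + k))"
  shows "\<exists>\<phi>'. multigraded_resolution (ideal_gen (mon ` insert g G) :: 'k poly3 set) (\<lambda>i. F i @ K (Suc i)) \<phi>'"
proof -
  have c: "r * mon g \<in> ideal_gen (mon ` G) \<longleftrightarrow> r \<in> \<cc>" for r
    unfolding mem_monomial_span_iff colon mult.commute[of r] keys_mon_mult by blast
  have "\<exists>\<phi>'. multigraded_resolution {j + r * mon g | j r. j \<in> (ideal_gen (mon ` G) :: 'k poly3 set)} (\<lambda>i. F i @ K (Suc i)) \<phi>'"
    by (rule mapping_cone[OF F K c])
  moreover have "{j + r * mon g | j r. j \<in> ideal_gen (mon ` G)} = (ideal_gen (mon ` insert g G) :: 'k poly3 set)"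
    unfolding image_insert module.span_insert[OF module_self]
  proof (rule subset_antisym; rule subsetI)
    fix f assume "f \<in> {j + r * mon g | j r. j \<in> (ideal_gen (mon ` G) :: 'k poly3 set)}"
    then obtain j r where "f = j + r * mon g" and j: "j \<in> ideal_gen (mon ` G)" by blast
    then have "f - r * mon g \<in> ideal_gen (mon ` G)" by simp
    then show "f \<in> {x. \<exists>k. x - k * mon g \<in> ideal_gen (mon ` G)}" by blast
  next
    fix f assume "f \<in> {x. \<exists>k. x - k * mon g \<in> (ideal_gen (mon ` G) :: 'k poly3 set)}"
    then obtain r where "f - r * mon g \<in> ideal_gen (mon ` G)" by blast
    moreover have "f = (f - r * mon g) + r * mon g" by simp
    ultimately show "f \<in> {j + r * mon g | j r. j \<in> ideal_gen (mon ` G)}" by blast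
  qed
  ultimately show ?thesis by simp
qed

lemma multigraded_resolution_empty:
  "multigraded_resolution (ideal_gen (mon ` {}) :: 'k::field poly3 set) (\<lambda>_. []) (\<lambda>i. 0\<^sub>m (if i = 0 then 1 else 0) 0)"
proof -
  let ?\<phi> = "\<lambda>i. 0\<^sub>m (if i = 0 then 1 else 0) 0 :: 'k poly3 mat"
  have c: "?\<phi> i \<in> carrier_mat (if i = 0 then 1 else 0) 0" for i :: nat by simp
  show ?thesis
    unfolding multigraded_resolution_def
  proof (intro conjI allI)
    show "hom_mat (\<lambda>m. m) [] [0] (?\<phi> 0)" using hom_mat_zero[of _ "[]" "[0]"] by simp
    show "hom_mat (\<lambda>m. m) [] [] (?\<phi> (Suc i))" for i using hom_mat_zero[of _ "[]" "[]"] by simp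
    show "(\<lambda>v. v $ 0) ` mat_image (?\<phi> 0) = ideal_gen (mon ` {})"
      unfolding image_empty module.span_empty[OF module_self] using mat_image_empty[OF c[of 0]] by simp
    show "mat_image (?\<phi> (Suc i)) = mat_kernel (?\<phi> i)" for i
      using mat_image_empty[OF c[of "Suc i"]] mat_kernel_empty[OF c[of i]] by simp
  qed
qed

lemma range_x_iff:
  "f \<in> range ((*) (mon (1, 0, 0))) \<longleftrightarrow> (\<forall>k\<in>keys (f :: 'k::field poly3). mono_le (1, 0, 0) k)"
proof
  assume "f \<in> range ((*) (mon (1, 0, 0)))"
  then obtain c where "f = mon (1, 0, 0) * c" by blast
  then show "\<forall>k\<in>keys f. mono_le (1, 0, 0) k"
    by (auto simp: keys_mon_mult simp del: mono_le_iff)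
next
  assume "\<forall>k\<in>keys f. mono_le (1, 0, 0) k"
  then show "f \<in> range ((*) (mon (1, 0, 0)))" using mem_principal_monomial[of f "(1, 0, 0)"] by blast
qed

lemma span_xy_iff:
  "f \<in> {mon (1, 0, 0) * a + mon (0, 1, 0) * b | a b. True} \<longleftrightarrow>
    (\<forall>k\<in>keys (f :: 'k::field poly3). mono_le (1, 0, 0) k \<or> mono_le (0, 1, 0) k)"
proof
  assume "f \<in> {mon (1, 0, 0) * a + mon (0, 1, 0) * b | a b. True}"
  then obtain a b where "f = mon (1, 0, 0) * a + mon (0, 1, 0) * b" by blast
  then have "keys f \<subseteq> (+) (1, 0, 0) ` keys a \<union> (+) (0, 1, 0) ` keys b"
    using keys_add[of "mon (1, 0, 0) * a" "mon (0, 1, 0) * b"] by (simp add: keys_mon_mult)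
  then show "\<forall>k\<in>keys f. mono_le (1, 0, 0) k \<or> mono_le (0, 1, 0) k"
    using mono_le_add by blast
next
  assume "\<forall>k\<in>keys f. mono_le (1, 0, 0) k \<or> mono_le (0, 1, 0) k"
  then show "f \<in> {mon (1, 0, 0) * a + mon (0, 1, 0) * b | a b. True}"
    using mem_pair_monomial[of f "(1, 0, 0)" "(0, 1, 0)"] by blast
qed

lemma mset_set_filter_insert:
  assumes "finite G" "g \<notin> G"
  shows "mset_set {h \<in> insert g G. P h} = (if P g then {#g#} else {#}) + mset_set {h \<in> G. P h}"
proof -
  have "{h \<in> insert g G. P h} = (if P g then insert g {h \<in> G. P h} else {h \<in> G. P h})" by auto
  then show ?thesis using assms by simp
qed

text \<open>Remove a generator with the largest z-exponent or, if z divides none, with the largest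
  y-exponent. The colon ideal at it is (x, y) or (x), so the cone adds the Koszul complex on these
  variables. If only powers of x occur, there is at most one.\<close>

lemma ek_resolution_exists:
  "ek_closed G \<Longrightarrow> \<exists>F (\<phi> :: nat \<Rightarrow> 'k::field poly3 mat). ek_resolution G F \<phi>"
proof (induction "card G" arbitrary: G rule: less_induct)
  case less
  note G = \<open>ek_closed G\<close>
  have fin: "finite G" and anti: "\<And>g h. g \<in> G \<Longrightarrow> h \<in> G \<Longrightarrow> mono_le g h \<Longrightarrow> g = h"
    using G unfolding ek_closed_def by blast+
  have zx: "\<exists>a' b' c'. (a', b', c') \<in> G \<and> c' < c \<and> a' \<le> Suc a \<and> b' \<le> b"
    and zy: "\<exists>a' b' c'. (a', b', c') \<in> G \<and> c' < c \<and> a' \<le> a \<and> b' \<le> Suc b" if "(a, b, c) \<in> G" "c > 0" for a b c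
    using G that unfolding ek_closed_def by blast+
  have yx: "\<exists>a' b'. (a', b', 0) \<in> G \<and> b' < b \<and> a' \<le> Suc a" if "(a, b, 0) \<in> G" "b > 0" for a b
    using G that unfolding ek_closed_def by blast
  consider (z) a b c where "(a, b, c) \<in> G" "c > 0"
    | (y) a b where "(a, b, 0) \<in> G" "b > 0" "\<And>a b c. (a, b, c) \<in> G \<Longrightarrow> c = 0"
    | (x) "\<And>a b c. (a, b, c) \<in> G \<Longrightarrow> b = 0 \<and> c = 0"
    by (metis gr0I)
  then show ?case
  proof cases
    case z
    define c where "c = Max ((\<lambda>g. snd (snd g)) ` G)"
    have c_max: "c' \<le> c" if "(a', b', c') \<in> G" for a' b' c'
      unfolding c_def using fin that by (intro Max_ge) force+
    have "c \<in> (\<lambda>g. snd (snd g)) ` G"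
      unfolding c_def using fin z(1) by (intro Max_in) auto
    then obtain a b where g: "(a, b, c) \<in> G" by force
    have c0: "c > 0" using c_max[OF z(1)] z(2) by simp
    let ?g = "(a, b, c)"
    define G' where "G' = G - {?g}"
    have ins: "G = insert ?g G'" "?g \<notin> G'" and fin': "finite G'" using g fin by (auto simp: G'_def)
    \<comment> \<open>Witnesses have a z-exponent below that of some generator, hence below the
      maximum \<open>c\<close>; the removed generator is never one of them.\<close>
    have "ek_closed G'"
      unfolding ek_closed_def
    proof (intro conjI allI impI ballI)
      show "h = h'" if "h \<in> G'" "h' \<in> G'" "mono_le h h'" for h h'
        using that anti by (auto simp: G'_def)
    next
      fix a1 b1 c1 assume h: "(a1, b1, c1) \<in> G' \<and> 0 < c1"
      then have "(a1, b1, c1) \<in> G" "c1 \<le> c" using c_max by (auto simp: G'_def)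
      with h zx[of a1 b1 c1] show "\<exists>a' b' c'. (a', b', c') \<in> G' \<and> c' < c1 \<and> a' \<le> Suc a1 \<and> b' \<le> b1"
        unfolding G'_def by fastforce
      from h \<open>(a1, b1, c1) \<in> G\<close> \<open>c1 \<le> c\<close> zy[of a1 b1 c1]
      show "\<exists>a' b' c'. (a', b', c') \<in> G' \<and> c' < c1 \<and> a' \<le> a1 \<and> b' \<le> Suc b1"
        unfolding G'_def by fastforce
    next
      fix a1 b1 assume h: "(a1, b1, 0) \<in> G' \<and> 0 < b1"
      with yx[of a1 b1] c0 show "\<exists>a' b'. (a', b', 0) \<in> G' \<and> b' < b1 \<and> a' \<le> Suc a1"
        by (auto simp: G'_def)
    qed (rule fin')
    moreover have "card G' < card G" unfolding G'_def using fin g by (rule card_Diff1_less)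
    ultimately obtain F and \<phi> :: "nat \<Rightarrow> 'k poly3 mat" where F: "ek_resolution G' F \<phi>"
      using less.hyps by blast
    obtain K and \<kappa> :: "nat \<Rightarrow> 'k poly3 mat"
      where K: "cyclic_resolution ?g {mon (1, 0, 0) * a + mon (0, 1, 0) * b | a b. True} K \<kappa>"
        and K': "K 2 = [?g + (1, 0, 0), ?g + (0, 1, 0)]" "K 3 = [?g + (1, 1, 0)]" "\<forall>i\<ge>4. K i = []"
      using cyclic_resolution_xy[of ?g] by blast
    \<comment> \<open>If \<open>k\<close> involved neither x nor y, then \<open>s\<close> would
      divide the removed generator, as its z-exponent is at most \<open>c\<close>; this contradicts
      the antichain property.\<close>
    have colon: "(\<exists>s\<in>G'. mono_le s (?g + k)) \<longleftrightarrow> mono_le (1, 0, 0) k \<or> mono_le (0, 1, 0) k" for k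
    proof (cases k)
      case (fields k1 k2 k3)
      show ?thesis
      proof
        assume "\<exists>s\<in>G'. mono_le s (?g + k)"
        then obtain a' b' c' where s: "(a', b', c') \<in> G'" "a' \<le> a + k1" "b' \<le> b + k2" unfolding fields by auto
        then have "(a', b', c') \<in> G" "c' \<le> c" "(a', b', c') \<noteq> ?g" using c_max by (auto simp: G'_def)
        with anti[OF _ g, of "(a', b', c')"] s show "mono_le (1, 0, 0) k \<or> mono_le (0, 1, 0) k"
          by (cases "k1 = 0"; cases "k2 = 0") (auto simp: fields)
      next
        assume "mono_le (1, 0, 0) k \<or> mono_le (0, 1, 0) k"
        then consider "k1 \<ge> 1" | "k2 \<ge> 1" by (auto simp: fields)
        then show "\<exists>s\<in>G'. mono_le s (?g + k)"
        proof cases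
          case 1
          obtain a' b' c' where "(a', b', c') \<in> G" "c' < c" "a' \<le> Suc a" "b' \<le> b" using zx[OF g c0] by blast
          with 1 show ?thesis by (intro bexI[of _ "(a', b', c')"]) (auto simp: fields G'_def)
        next
          case 2
          obtain a' b' c' where "(a', b', c') \<in> G" "c' < c" "a' \<le> a" "b' \<le> Suc b" using zy[OF g c0] by blast
          with 2 show ?thesis by (intro bexI[of _ "(a', b', c')"]) (auto simp: fields G'_def)
        qed
      qed
    qed
    have "\<exists>\<phi>'. multigraded_resolution (ideal_gen (mon ` insert ?g G') :: 'k poly3 set) (\<lambda>i. F i @ K (Suc i)) \<phi>'"
      using F unfolding ek_resolution_def
      by (intro multigraded_resolution_insert[OF _ K]) (blast, unfold colon span_xy_iff, rule refl)
    then obtain \<phi>' where "multigraded_resolution (ideal_gen (mon ` G) :: 'k poly3 set) (\<lambda>i. F i @ K (Suc i)) \<phi>'"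
      unfolding ins(1)[symmetric] by blast
    moreover have "K (Suc 0) = [?g]" using K by (simp add: cyclic_resolution_def)
    moreover have "mset_set G = add_mset ?g (mset_set G')"
      unfolding ins(1) using fin' ins(2) by simp
    moreover have "mset_set (non_x_power G) = add_mset ?g (mset_set (non_x_power G'))"
      unfolding ins(1) mset_set_filter_insert[OF fin' ins(2)] using c0 by simp
    moreover have "mset_set (z_divisible G) = add_mset ?g (mset_set (z_divisible G'))"
      unfolding ins(1) mset_set_filter_insert[OF fin' ins(2)] using c0 by simp
    ultimately have "ek_resolution G (\<lambda>i. F i @ K (Suc i)) \<phi>'"
      using F K' unfolding ek_resolution_def
      by (simp add: numeral_2_eq_2 numeral_3_eq_3)
    then show ?thesis by blast
  next
    case y
    define b where "b = Max ((\<lambda>g. fst (snd g)) ` G)"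
    have b_max: "b' \<le> b" if "(a', b', c') \<in> G" for a' b' c'
      unfolding b_def using fin that by (intro Max_ge) force+
    have "b \<in> (\<lambda>g. fst (snd g)) ` G"
      unfolding b_def using fin y(1) by (intro Max_in) auto
    then obtain a where g: "(a, b, 0) \<in> G" using y(3) by force
    have b0: "b > 0" using b_max[OF y(1)] y(2) by simp
    let ?g = "(a, b, 0)"
    define G' where "G' = G - {?g}"
    have ins: "G = insert ?g G'" "?g \<notin> G'" and fin': "finite G'" using g fin by (auto simp: G'_def)
    have "ek_closed G'"
      unfolding ek_closed_def
    proof (intro conjI allI impI ballI)
      show "h = h'" if "h \<in> G'" "h' \<in> G'" "mono_le h h'" for h h'
        using that anti by (auto simp: G'_def)
    next
      fix a1 b1 c1 assume h: "(a1, b1, c1) \<in> G' \<and> 0 < c1"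
      then have "c1 = 0" using y(3) by (auto simp: G'_def)
      with h show "\<exists>a' b' c'. (a', b', c') \<in> G' \<and> c' < c1 \<and> a' \<le> Suc a1 \<and> b' \<le> b1"
        "\<exists>a' b' c'. (a', b', c') \<in> G' \<and> c' < c1 \<and> a' \<le> a1 \<and> b' \<le> Suc b1" by simp_all
    next
      fix a1 b1 assume h: "(a1, b1, 0) \<in> G' \<and> 0 < b1"
      then have "(a1, b1, 0) \<in> G" "b1 \<le> b" using b_max by (auto simp: G'_def)
      with h yx[of a1 b1] show "\<exists>a' b'. (a', b', 0) \<in> G' \<and> b' < b1 \<and> a' \<le> Suc a1"
        unfolding G'_def by fastforce
    qed (rule fin')
    moreover have "card G' < card G" unfolding G'_def using fin g by (rule card_Diff1_less)
    ultimately obtain F and \<phi> :: "nat \<Rightarrow> 'k poly3 mat" where F: "ek_resolution G' F \<phi>"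
      using less.hyps by blast
    obtain K and \<kappa> :: "nat \<Rightarrow> 'k poly3 mat"
      where K: "cyclic_resolution ?g (range ((*) (mon (1, 0, 0)))) K \<kappa>"
        and K': "K 2 = [?g + (1, 0, 0)]" "\<forall>i\<ge>3. K i = []"
      using cyclic_resolution_x[of ?g] by blast
    have colon: "(\<exists>s\<in>G'. mono_le s (?g + k)) \<longleftrightarrow> mono_le (1, 0, 0) k" for k
    proof (cases k)
      case (fields k1 k2 k3)
      show ?thesis
      proof
        assume "\<exists>s\<in>G'. mono_le s (?g + k)"
        then obtain a' b' c' where s: "(a', b', c') \<in> G'" "a' \<le> a + k1" unfolding fields by auto
        then have "(a', b', c') \<in> G" "b' \<le> b" "c' = 0" "(a', b', c') \<noteq> ?g" using b_max y(3) by (auto simp: G'_def)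
        with anti[OF _ g, of "(a', b', c')"] s show "mono_le (1, 0, 0) k"
          by (cases "k1 = 0") (auto simp: fields)
      next
        assume "mono_le (1, 0, 0) k"
        then have 1: "k1 \<ge> 1" by (simp add: fields)
        obtain a' b' where "(a', b', 0) \<in> G" "b' < b" "a' \<le> Suc a" using yx[OF g b0] by blast
        with 1 show "\<exists>s\<in>G'. mono_le s (?g + k)" by (intro bexI[of _ "(a', b', 0)"]) (auto simp: fields G'_def)
      qed
    qed
    have "\<exists>\<phi>'. multigraded_resolution (ideal_gen (mon ` insert ?g G') :: 'k poly3 set) (\<lambda>i. F i @ K (Suc i)) \<phi>'"
      using F unfolding ek_resolution_def
      by (intro multigraded_resolution_insert[OF _ K]) (blast, unfold colon range_x_iff, rule refl)
    then obtain \<phi>' where "multigraded_resolution (ideal_gen (mon ` G) :: 'k poly3 set) (\<lambda>i. F i @ K (Suc i)) \<phi>'"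
      unfolding ins(1)[symmetric] by blast
    moreover have "K (Suc 0) = [?g]" using K by (simp add: cyclic_resolution_def)
    moreover have "mset_set G = add_mset ?g (mset_set G')"
      unfolding ins(1) using fin' ins(2) by simp
    moreover have "mset_set (non_x_power G) = add_mset ?g (mset_set (non_x_power G'))"
      unfolding ins(1) mset_set_filter_insert[OF fin' ins(2)] using b0 by simp
    moreover have "mset_set (z_divisible G) = mset_set (z_divisible G')"
      unfolding ins(1) mset_set_filter_insert[OF fin' ins(2)] using b0 by simp
    ultimately have "ek_resolution G (\<lambda>i. F i @ K (Suc i)) \<phi>'"
      using F K' unfolding ek_resolution_def
      by (simp add: numeral_2_eq_2 numeral_3_eq_3)
    then show ?thesis by blast
  next
    case x
    show ?thesis
    proof (cases "G = {}")
      case True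
      have "ek_resolution G (\<lambda>_. []) (\<lambda>i. 0\<^sub>m (if i = 0 then 1 else 0) 0 :: 'k poly3 mat)"
        using multigraded_resolution_empty unfolding True ek_resolution_def by simp
      then show ?thesis by blast
    next
      case False
      then obtain a b c where "(a, b, c) \<in> G" by auto
      with x have g: "(a, 0, 0) \<in> G" by blast
      have "h = (a, 0, 0)" if "h \<in> G" for h
      proof (cases h)
        case (fields a' b' c')
        with x that have "h = (a', 0, 0)" by blast
        with anti[OF that g] anti[OF g that] show ?thesis by (cases "a' \<le> a") auto
      qed
      with g have G_eq: "G = {(a, 0, 0)}" by blast
      obtain K and \<kappa> :: "nat \<Rightarrow> 'k poly3 mat"
        where K: "cyclic_resolution (a, 0, 0) {0} K \<kappa>" and K': "\<forall>i\<ge>2. K i = []"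
        using cyclic_resolution_zero[of "(a, 0, 0)"] by blast
      have "\<exists>\<phi>'. multigraded_resolution (ideal_gen (mon ` insert (a, 0, 0) {}) :: 'k poly3 set) (\<lambda>i. [] @ K (Suc i)) \<phi>'"
      proof (rule multigraded_resolution_insert[OF multigraded_resolution_empty K])
        fix r :: "'k poly3"
        have "r = 0 \<longleftrightarrow> keys r = {}"
          by (metis keys_zero poly_mapping_eqI in_keys_iff lookup_zero empty_iff)
        then show "r \<in> {0} \<longleftrightarrow> (\<forall>k\<in>keys r. \<exists>s\<in>{}. mono_le s ((a, 0, 0) + k))" by blast
      qed
      then obtain \<phi>' where "multigraded_resolution (ideal_gen (mon ` G) :: 'k poly3 set) (\<lambda>i. K (Suc i)) \<phi>'"
        unfolding G_eq by auto
      moreover have "K (Suc 0) = [(a, 0, 0)]" using K by (simp add: cyclic_resolution_def)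
      moreover have e: "non_x_power G = {}" "z_divisible G = {}" unfolding G_eq by auto
      moreover have "mset_set G = {#(a, 0, 0)#}" unfolding G_eq by simp
      ultimately have "ek_resolution G (\<lambda>i. K (Suc i)) \<phi>'"
        using K' unfolding ek_resolution_def e by simp
      then show ?thesis by blast
    qed
  qed
qed

text \<open>A constant entry needs equal multidegrees in neighbouring modules. That would make one
  generator a proper multiple of another: h + (1, 0, 0) = g + (1, 1, 0), for instance, says h = g +
  (0, 1, 0).\<close>

lemma ek_resolution_minimal:
  fixes \<phi> :: "nat \<Rightarrow> 'k::field poly3 mat"
  assumes G: "ek_closed G" and F: "ek_resolution G F \<phi>"
  shows "minimal_graded_free_resolution (ideal_gen (mon ` G)) (\<lambda>i. map mdeg (F i)) \<phi>"
proof -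
  have fin: "finite G" and anti: "\<And>g h. g \<in> G \<Longrightarrow> h \<in> G \<Longrightarrow> mono_le g h \<Longrightarrow> g = h"
    using G unfolding ek_closed_def by blast+
  have R: "multigraded_resolution (ideal_gen (mon ` G)) F \<phi>"
    and F0: "mset (F 0) = mset_set G"
    and F1: "mset (F 1) = image_mset (\<lambda>g. g + (1, 0, 0)) (mset_set (non_x_power G)) +
      image_mset (\<lambda>g. g + (0, 1, 0)) (mset_set (z_divisible G))"
    and F2: "mset (F 2) = image_mset (\<lambda>g. g + (1, 1, 0)) (mset_set (z_divisible G))"
    and F3: "\<And>i. i \<ge> 3 \<Longrightarrow> F i = []"
    using F unfolding ek_resolution_def by blast+
  have S0: "set (F 0) = G" using arg_cong[OF F0, of set_mset] fin by simp
  have S1: "set (F 1) = (\<lambda>g. g + (1, 0, 0)) ` non_x_power G \<union> (\<lambda>g. g + (0, 1, 0)) ` z_divisible G"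
    using arg_cong[OF F1, of set_mset] fin by simp
  have S2: "set (F 2) = (\<lambda>g. g + (1, 1, 0)) ` z_divisible G"
    using arg_cong[OF F2, of set_mset] fin by simp
  have shift: "g + u \<notin> G" if "g \<in> G" "u \<noteq> 0" for g u
  proof
    assume "g + u \<in> G"
    with anti[OF that(1) this] have "g = g + u" by simp
    with that(2) show False by (metis add.right_neutral add_left_cancel)
  qed
  have disjoint: "set (F i) \<inter> set (F (Suc i)) = {}" for i
  proof -
    consider "i = 0" | "i = 1" | "i \<ge> 2" by linarith
    then show ?thesis
    proof cases
      case 1
      have "(1, 0, 0) \<noteq> (0 :: mono3)" "(0, 1, 0) \<noteq> (0 :: mono3)" by (simp_all add: mono_zero_iff)
      with shift have "set (F 0) \<inter> set (F 1) = {}" unfolding S0 S1 by blast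
      with 1 show ?thesis by simp
    next
      case 2
      have "h + (1, 0, 0) \<noteq> g + (1, 1, 0)" if "g \<in> G" "h \<in> G" for g h
        using shift[OF that(1), of "(0, 1, 0)"] that(2) by (cases g; cases h) (auto simp: mono_zero_iff)
      moreover have "h + (0, 1, 0) \<noteq> g + (1, 1, 0)" if "g \<in> G" "h \<in> G" for g h
        using shift[OF that(1), of "(1, 0, 0)"] that(2) by (cases g; cases h) (auto simp: mono_zero_iff)
      ultimately have "set (F 1) \<inter> set (F 2) = {}" unfolding S1 S2 by blast
      with 2 show ?thesis by (simp add: numeral_2_eq_2)
    qed (simp add: F3)
  qed
  have h0: "hom_mat (\<lambda>m. m) (F 0) [0] (\<phi> 0)" and h: "\<And>i. hom_mat (\<lambda>m. m) (F (Suc i)) (F i) (\<phi> (Suc i))"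
    using R unfolding multigraded_resolution_def by blast+
  have graded: "graded_map (map mdeg e) (map mdeg d) A" if A: "hom_mat (\<lambda>m. m) e d A" for e d and A :: "'k poly3 mat"
    unfolding graded_map_eq_hom_mat
  proof (rule hom_matI)
    show "A \<in> carrier_mat (length (map mdeg d)) (length (map mdeg e))" using A by (simp add: hom_mat_def)
    show "mdeg m + map mdeg d ! r = map mdeg e ! c"
      if "r < length (map mdeg d)" "c < length (map mdeg e)" "m \<in> keys (A $$ (r, c))" for r c m
      using hom_mat_entry[OF A _ _ that(3)] that(1,2) by (simp flip: mdeg_add)
  qed
  have "const_free (\<phi> (Suc i))" for i
    unfolding const_free_def
  proof (intro allI impI)
    fix r c assume "r < dim_row (\<phi> (Suc i))" "c < dim_col (\<phi> (Suc i))"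
    then have rc: "r < length (F i)" "c < length (F (Suc i))" using h[of i] by (auto simp: hom_mat_def)
    show "lookup (\<phi> (Suc i) $$ (r, c)) 0 = 0"
    proof (rule ccontr)
      assume "\<not> ?thesis"
      then have "0 \<in> keys (\<phi> (Suc i) $$ (r, c))" by (simp add: in_keys_iff)
      from hom_mat_entry[OF h rc this] have "F i ! r = F (Suc i) ! c" by simp
      with rc disjoint[of i] show False by (metis disjoint_iff nth_mem)
    qed
  qed
  moreover have "graded_map (map mdeg (F 0)) [0] (\<phi> 0)" using graded[OF h0] by simp
  ultimately show ?thesis
    unfolding minimal_graded_free_resolution_def const_free_iff
    using graded[OF h] R unfolding multigraded_resolution_def by blast
qed

lemma count_list_map_mset:
  assumes "mset xs = image_mset f (mset_set S)" "finite S"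
  shows "count_list (map g xs) j = card {s \<in> S. g (f s) = j}"
proof -
  have "count_list (map g xs) j = count (image_mset g (mset xs)) j"
    by (simp flip: count_mset)
  also have "\<dots> = count (image_mset (g \<circ> f) (mset_set S)) j"
    unfolding assms(1) by (simp add: image_mset.compositionality)
  also have "\<dots> = card {s \<in> S. (g \<circ> f) s = j}"
    unfolding count_image_mset' using assms(2) by (auto intro!: arg_cong[of _ _ card] simp: eq_commute)
  finally show ?thesis by simp
qed

theorem betti_ek_closed:
  assumes G: "ek_closed G"
  shows "betti (ideal_gen (mon ` G) :: 'k::field poly3 set) 0 j = of_nat (card {g \<in> G. mdeg g = j})"
    and "betti (ideal_gen (mon ` G) :: 'k::field poly3 set) 1 j =
      of_nat (card {g \<in> non_x_power G. mdeg g + 1 = j}) + of_nat (card {g \<in> z_divisible G. mdeg g + 1 = j})"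
    and "betti (ideal_gen (mon ` G) :: 'k::field poly3 set) 2 j = of_nat (card {g \<in> z_divisible G. mdeg g + 2 = j})"
    and "3 \<le> i \<Longrightarrow> betti (ideal_gen (mon ` G) :: 'k::field poly3 set) i j = 0"
proof -
  obtain F and \<phi> :: "nat \<Rightarrow> 'k poly3 mat" where F: "ek_resolution G F \<phi>"
    using ek_resolution_exists[OF G] by blast
  have fin: "finite G" using G by (simp add: ek_closed_def)
  note b = betti_eq_count[OF ek_resolution_minimal[OF G F]]
  have F0: "mset (F 0) = image_mset (\<lambda>g. g) (mset_set G)"
    and F1: "mset (F 1) = image_mset (\<lambda>g. g + (1, 0, 0)) (mset_set (non_x_power G)) +
      image_mset (\<lambda>g. g + (0, 1, 0)) (mset_set (z_divisible G))"
    and F2: "mset (F 2) = image_mset (\<lambda>g. g + (1, 1, 0)) (mset_set (z_divisible G))"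
    and F3: "\<And>i. i \<ge> 3 \<Longrightarrow> F i = []"
    using F unfolding ek_resolution_def by simp_all
  show "betti (ideal_gen (mon ` G) :: 'k poly3 set) 0 j = of_nat (card {g \<in> G. mdeg g = j})"
    unfolding b count_list_map_mset[OF F0 fin] ..
  show "betti (ideal_gen (mon ` G) :: 'k poly3 set) 2 j = of_nat (card {g \<in> z_divisible G. mdeg g + 2 = j})"
    unfolding b using count_list_map_mset[OF F2, of mdeg j] fin by simp
  show "betti (ideal_gen (mon ` G) :: 'k poly3 set) i j = 0" if "3 \<le> i"
    unfolding b using F3[OF that] by simp
  obtain xs where xs: "mset xs = image_mset (\<lambda>g. g + (1, 0, 0)) (mset_set (non_x_power G))"
    using ex_mset by blast
  obtain ys where ys: "mset ys = image_mset (\<lambda>g. g + (0, 1, 0)) (mset_set (z_divisible G))"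
    using ex_mset by blast
  have "mset (F 1) = mset (xs @ ys)" using F1 xs ys by simp
  then have "count_list (map mdeg (F 1)) j = count_list (map mdeg (xs @ ys)) j"
    unfolding count_mset[symmetric] by (simp only: mset_map)
  also have "\<dots> = count_list (map mdeg xs) j + count_list (map mdeg ys) j"
    by simp
  finally show "betti (ideal_gen (mon ` G) :: 'k poly3 set) 1 j =
      of_nat (card {g \<in> non_x_power G. mdeg g + 1 = j}) + of_nat (card {g \<in> z_divisible G. mdeg g + 1 = j})"
    unfolding b using count_list_map_mset[OF xs, of mdeg j] count_list_map_mset[OF ys, of mdeg j] fin by simp
qed

section \<open>Stable ideals containing a power of \<open>y\<close>\<close>

lemma monomial_ideal_mem_iff:
  assumes "monomial_ideal (I :: 'k::field poly3 set)"
  shows "f \<in> I \<longleftrightarrow> (\<forall>k\<in>keys f. mon k \<in> I)"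
proof -
  obtain S where "I = ideal_gen (mon ` S)" using assms unfolding monomial_ideal_def by blast
  then show ?thesis by (simp add: mem_monomial_span_iff)
qed

lemma monomial_ideal_upward:
  assumes "monomial_ideal (I :: 'k::field poly3 set)" "mon m \<in> I" "mono_le m n"
  shows "mon n \<in> I"
proof -
  obtain S where S: "I = ideal_gen (mon ` S)" using assms(1) unfolding monomial_ideal_def by blast
  from assms(2) obtain s where "s \<in> S" "mono_le s m" by (auto simp: S mem_monomial_span_iff)
  with assms(3) mono_le_trans show ?thesis unfolding S mem_monomial_span_iff keys_mon by blast
qed

lemma min_gens_iff:
  "m \<in> min_gens (I :: 'k::field poly3 set) \<longleftrightarrow> mon m \<in> I \<and> (\<forall>n. mon n \<in> I \<and> mono_le n m \<longrightarrow> n = m)"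
  unfolding min_gens_def mon_dvd_iff by blast

lemma min_gens_mem: "m \<in> min_gens (I :: 'k::field poly3 set) \<Longrightarrow> mon m \<in> I"
  unfolding min_gens_iff by blast

lemma min_gens_below:
  assumes "mon m \<in> (I :: 'k::field poly3 set)"
  obtains g where "g \<in> min_gens I" "mono_le g m"
proof -
  have "\<exists>g. g \<in> min_gens I \<and> mono_le g m"
    using assms
  proof (induction "mdeg m" arbitrary: m rule: less_induct)
    case less
    show ?case
    proof (cases "m \<in> min_gens I")
      case False
      with less.prems obtain n where n: "mon n \<in> I" "mono_le n m" "n \<noteq> m"
        unfolding min_gens_iff by blast
      then have "mdeg n < mdeg m"
        using mono_le_mdeg mono_le_mdeg_eq by (metis le_neq_implies_less)
      with less.hyps n show ?thesis by (blast intro: mono_le_trans)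
    qed (blast intro: mono_le_refl)
  qed
  with that show ?thesis by blast
qed

lemma min_gens_below_components:
  assumes "mon (a, b, c) \<in> (I :: 'k::field poly3 set)"
  shows "\<exists>g\<^sub>1 g\<^sub>2 g\<^sub>3. (g\<^sub>1, g\<^sub>2, g\<^sub>3) \<in> min_gens I \<and> g\<^sub>1 \<le> a \<and> g\<^sub>2 \<le> b \<and> g\<^sub>3 \<le> c"
proof -
  obtain g where g: "g \<in> min_gens I" "mono_le g (a, b, c)"
    by (rule min_gens_below[OF assms])
  then show ?thesis by (cases g) auto
qed

lemma min_gens_antichain:
  "g \<in> min_gens I \<Longrightarrow> h \<in> min_gens (I :: 'k::field poly3 set) \<Longrightarrow> mono_le g h \<Longrightarrow> g = h"
  unfolding min_gens_iff by blast

lemma monomial_ideal_eq_span_min_gens: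
  assumes "monomial_ideal (I :: 'k::field poly3 set)"
  shows "I = ideal_gen (mon ` min_gens I)"
proof (rule Set.set_eqI)
  fix f
  have "mon k \<in> I \<longleftrightarrow> (\<exists>g\<in>min_gens I. mono_le g k)" for k
  proof
    assume "mon k \<in> I"
    then show "\<exists>g\<in>min_gens I. mono_le g k" by (meson min_gens_below)
  next
    assume "\<exists>g\<in>min_gens I. mono_le g k"
    then show "mon k \<in> I" using monomial_ideal_upward[OF assms min_gens_mem] by blast
  qed
  then show "f \<in> I \<longleftrightarrow> f \<in> ideal_gen (mon ` min_gens I)"
    unfolding mem_monomial_span_iff monomial_ideal_mem_iff[OF assms, of f] by blast
qed

text \<open>This is strong stability: y may be exchanged for x even if z divides the
  monomial.\<close>

definition stable_ideal :: "'k::field poly3 set \<Rightarrow> bool" where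
  "stable_ideal I \<longleftrightarrow> monomial_ideal I \<and>
    (\<forall>a b c. mon (a, b, Suc c) \<in> I \<longrightarrow> mon (Suc a, b, c) \<in> I \<and> mon (a, Suc b, c) \<in> I) \<and>
    (\<forall>a b c. mon (a, Suc b, c) \<in> I \<longrightarrow> mon (Suc a, b, c) \<in> I)"

text \<open>Lexicity speaks only about the degrees of generators, so the exchange is made in a
  generator dividing the monomial. Either that generator has the full power of the exchanged
  variable and becomes lex-greater in the same degree, or it still divides the exchanged
  monomial.\<close>

lemma lex_segment_imp_stable:
  assumes "lex_segment_ideal (I :: 'k::field poly3 set)"
  shows "stable_ideal I"
proof -
  have M: "monomial_ideal I"
    and lex: "\<And>m n. n \<in> min_gens I \<Longrightarrow> mdeg m = mdeg n \<Longrightarrow> glex_greater m n \<Longrightarrow> mon m \<in> I"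
    using assms unfolding lex_segment_ideal_def by blast+
  have "mon (Suc a, b, c) \<in> I \<and> mon (a, Suc b, c) \<in> I" if m: "mon (a, b, Suc c) \<in> I" for a b c
  proof -
    obtain g1 g2 g3 where g: "(g1, g2, g3) \<in> min_gens I" "g1 \<le> a" "g2 \<le> b" "g3 \<le> Suc c"
      using min_gens_below_components[OF m] by blast
    show ?thesis
    proof (cases "g3 = Suc c")
      case True
      then have m': "mon (Suc g1, g2, c) \<in> I" "mon (g1, Suc g2, c) \<in> I"
        using g(1) by (auto intro!: lex[OF g(1)])
      show ?thesis
        using monomial_ideal_upward[OF M m'(1), of "(Suc a, b, c)"]
          monomial_ideal_upward[OF M m'(2), of "(a, Suc b, c)"] g by simp
    next
      case False
      with g have "mono_le (g1, g2, g3) (Suc a, b, c)" "mono_le (g1, g2, g3) (a, Suc b, c)" by auto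
      with g(1) show ?thesis using monomial_ideal_upward[OF M min_gens_mem] by blast
    qed
  qed
  moreover have "mon (Suc a, b, c) \<in> I" if m: "mon (a, Suc b, c) \<in> I" for a b c
  proof -
    obtain g1 g2 g3 where g: "(g1, g2, g3) \<in> min_gens I" "g1 \<le> a" "g2 \<le> Suc b" "g3 \<le> c"
      using min_gens_below_components[OF m] by blast
    show ?thesis
    proof (cases "g2 = Suc b")
      case True
      then have m': "mon (Suc g1, b, g3) \<in> I"
        using g(1) by (auto intro!: lex[OF g(1)])
      show ?thesis
        using monomial_ideal_upward[OF M m', of "(Suc a, b, c)"] g by simp
    next
      case False
      with g have "mono_le (g1, g2, g3) (Suc a, b, c)" by auto
      with g(1) show ?thesis using monomial_ideal_upward[OF M min_gens_mem] by blast
    qed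
  qed
  ultimately show ?thesis unfolding stable_ideal_def using M by blast
qed

text \<open>Serves for both L and \<aa> with the same \<open>A\<close>; y^A is a minimal generator
  of L only, so here it is merely an element.\<close>

locale stable_xy =
  fixes I :: "'k::field poly3 set" and q A :: nat
  assumes stable: "stable_ideal I"
    and x_power: "(q, 0, 0) \<in> min_gens I" and y_power: "mon (0, A, 0) \<in> I"
begin

lemma mono: "monomial_ideal I"
  using stable by (simp add: stable_ideal_def)

lemma shift_zx: "mon (a, b, Suc c) \<in> I \<Longrightarrow> mon (Suc a, b, c) \<in> I"
  and shift_zy: "mon (a, b, Suc c) \<in> I \<Longrightarrow> mon (a, Suc b, c) \<in> I"
  and shift_yx: "mon (a, Suc b, c) \<in> I \<Longrightarrow> mon (Suc a, b, c) \<in> I"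
  using stable unfolding stable_ideal_def by blast+

lemma min_gens_bound:
  assumes "(a, b, c) \<in> min_gens I"
  shows "a \<le> q" "b \<le> A"
proof -
  show "a \<le> q"
    using min_gens_antichain[OF x_power assms] by (cases "a \<le> q") auto
  show "b \<le> A"
  proof (rule ccontr)
    assume "\<not> b \<le> A"
    then have "(0, A, 0) = (a, b, c)" using assms y_power unfolding min_gens_iff by fastforce
    with \<open>\<not> b \<le> A\<close> show False by simp
  qed
qed

text \<open>The x- and y-exponents lie in a box, and an antichain has at most one member with given
  x- and y-exponents.\<close>

lemma finite_min_gens: "finite (min_gens I)"
proof (rule finite_imageD)
  show "finite ((\<lambda>(a, b, c). (a, b)) ` min_gens I)"
    by (rule finite_subset[of _ "{..q} \<times> {..A}"]) (auto dest: min_gens_bound)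
  show "inj_on (\<lambda>(a, b, c). (a, b)) (min_gens I)"
  proof (rule inj_onI, clarsimp)
    fix a b c c' assume "(a, b, c) \<in> min_gens I" "(a, b, c') \<in> min_gens I"
    then show "c = c'"
      using min_gens_antichain[of "(a, b, c)" I "(a, b, c')"] min_gens_antichain[of "(a, b, c')" I "(a, b, c)"]
      by (cases "c \<le> c'") auto
  qed
qed

text \<open>Exchange one variable and take a generator dividing the result: its exponent of the
  exchanged variable has dropped.\<close>

lemma ek_closed_min_gens: "ek_closed (min_gens I)"
  unfolding ek_closed_def
proof (intro conjI allI impI ballI)
  show "g = h" if "g \<in> min_gens I" "h \<in> min_gens I" "mono_le g h" for g h
    using that by (rule min_gens_antichain)
next
  fix a b c assume "(a, b, c) \<in> min_gens I \<and> 0 < c"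
  then obtain c1 where c: "c = Suc c1" and m: "mon (a, b, Suc c1) \<in> I"
    unfolding min_gens_iff by (metis gr0_conv_Suc)
  obtain g1 g2 g3 where "(g1, g2, g3) \<in> min_gens I" "g1 \<le> Suc a" "g2 \<le> b" "g3 \<le> c1"
    using min_gens_below_components[OF shift_zx[OF m]] by blast
  then show "\<exists>a' b' c'. (a', b', c') \<in> min_gens I \<and> c' < c \<and> a' \<le> Suc a \<and> b' \<le> b"
    unfolding c by (metis less_Suc_eq_le)
  obtain g1 g2 g3 where "(g1, g2, g3) \<in> min_gens I" "g1 \<le> a" "g2 \<le> Suc b" "g3 \<le> c1"
    using min_gens_below_components[OF shift_zy[OF m]] by blast
  then show "\<exists>a' b' c'. (a', b', c') \<in> min_gens I \<and> c' < c \<and> a' \<le> a \<and> b' \<le> Suc b"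
    unfolding c by (metis less_Suc_eq_le)
next
  fix a b assume "(a, b, 0) \<in> min_gens I \<and> 0 < b"
  then obtain b1 where b: "b = Suc b1" and m: "mon (a, Suc b1, 0) \<in> I"
    unfolding min_gens_iff by (metis gr0_conv_Suc)
  obtain g1 g2 g3 where "(g1, g2, g3) \<in> min_gens I" "g1 \<le> Suc a" "g2 \<le> b1" "g3 \<le> 0"
    using min_gens_below_components[OF shift_yx[OF m]] by blast
  then show "\<exists>a' b'. (a', b', 0) \<in> min_gens I \<and> b' < b \<and> a' \<le> Suc a"
    unfolding b by (metis less_Suc_eq_le le_zero_eq)
qed (rule finite_min_gens)

lemma x_power_gens: "min_gens I - non_x_power (min_gens I) = {(q, 0, 0)}"
proof -
  have "g = (q, 0, 0)" if "g \<in> min_gens I" "snd g = (0, 0)" for g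
  proof (cases g)
    case (fields a b c)
    with that have g: "g = (a, 0, 0)" by simp
    then show ?thesis
      using min_gens_antichain[OF x_power that(1)] min_gens_antichain[OF that(1) x_power]
      by (cases "a \<le> q") auto
  qed
  then have "min_gens I - non_x_power (min_gens I) \<subseteq> {(q, 0, 0)}" by blast
  moreover have "(q, 0, 0) \<in> min_gens I - non_x_power (min_gens I)" using x_power by simp
  ultimately show ?thesis by blast
qed

text \<open>For each a < q the generator is x^a y^b with the least possible b. The resulting number
  q is what makes the first moment vanish.\<close>

lemma y_gens_bij:
  "bij_betw fst (non_x_power (min_gens I) - z_divisible (min_gens I)) {..<q}"
  unfolding bij_betw_def
proof
  let ?Y = "non_x_power (min_gens I) - z_divisible (min_gens I)"
  have Y: "(a, b, c) \<in> ?Y \<longleftrightarrow> (a, b, c) \<in> min_gens I \<and> 0 < b \<and> c = 0" for a b c by auto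
  show "inj_on fst ?Y"
  proof (rule inj_onI)
    fix g h assume gh: "g \<in> ?Y" "h \<in> ?Y" "fst g = fst h"
    obtain a b c where e1: "g = (a, b, c)" by (rule prod_cases3)
    obtain a' b' c' where e2: "h = (a', b', c')" by (rule prod_cases3)
    note e = e1 e2
    with gh have "(a, b, 0) \<in> min_gens I" "(a, b', 0) \<in> min_gens I" "a' = a" "c = 0" "c' = 0"
      using Y by auto
    then show "g = h" unfolding e
      using min_gens_antichain[of "(a, b, 0)" I "(a, b', 0)"] min_gens_antichain[of "(a, b', 0)" I "(a, b, 0)"]
      by (cases "b \<le> b'") auto
  qed
  show "fst ` ?Y = {..<q}"
  proof
    show "fst ` ?Y \<subseteq> {..<q}"
    proof
      fix a assume "a \<in> fst ` ?Y"
      then obtain b where b: "(a, b, 0) \<in> min_gens I" "0 < b" using Y by fastforce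
      then have "a \<noteq> q" using min_gens_antichain[OF x_power b(1)] by auto
      with min_gens_bound(1)[OF b(1)] show "a \<in> {..<q}" by simp
    qed
    show "{..<q} \<subseteq> fst ` ?Y"
    proof
      fix a assume "a \<in> {..<q}"
      then have "a < q" by simp
      define b where "b = (LEAST b. mon (a, b, 0) \<in> I)"
      have "mon (a, A, 0) \<in> I" using monomial_ideal_upward[OF mono y_power] by simp
      then have b: "mon (a, b, 0) \<in> I" unfolding b_def by (rule LeastI)
      have low: "b \<le> b'" if "mon (a, b', 0) \<in> I" for b'
        unfolding b_def using that by (rule Least_le)
      have "b \<noteq> 0"
      proof
        assume "b = 0"
        with b have "mon (a, 0, 0) \<in> I" by simp
        with x_power \<open>a < q\<close> show False unfolding min_gens_iff by fastforce
      qed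
      then obtain b1 where b1: "b = Suc b1" by (cases b) auto
      have "(a, b, 0) \<in> min_gens I"
        unfolding min_gens_iff
      proof (intro conjI allI impI b)
        fix n assume n: "mon n \<in> I \<and> mono_le n (a, b, 0)"
        obtain n1 n2 n3 where n': "n = (n1, n2, n3)" by (rule prod_cases3)
        with n have n'': "n1 \<le> a" "n2 \<le> b" "n3 = 0" "mon (n1, n2, 0) \<in> I" by auto
        have "mon (a, n2, 0) \<in> I" using monomial_ideal_upward[OF mono n''(4)] n''(1) by simp
        with low n''(2) have "n2 = b" by (simp add: antisym)
        \<comment> \<open>Otherwise trading one y for x would put x^a y^(b - 1) into
          \<open>I\<close>, against the choice of \<open>b\<close>.\<close>
        moreover have "n1 = a"
        proof (rule ccontr)
          assume "n1 \<noteq> a"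
          with n'' have "Suc n1 \<le> a" by simp
          have "mon (Suc n1, b1, 0) \<in> I" using n''(4) \<open>n2 = b\<close> b1 shift_yx by simp
          then have "mon (a, b1, 0) \<in> I" using monomial_ideal_upward[OF mono] \<open>Suc n1 \<le> a\<close> by fastforce
          with low b1 show False by fastforce
        qed
        ultimately show "n = (a, b, 0)" using n' n'' by simp
      qed
      with \<open>b \<noteq> 0\<close> have "(a, b, 0) \<in> ?Y" by auto
      then show "a \<in> fst ` ?Y" by force
    qed
  qed
qed

lemmas betti_formula = betti_ek_closed[OF ek_closed_min_gens, where ?'k = 'k,
  folded monomial_ideal_eq_span_min_gens[OF mono]]

end

lemma exists_divisor_of_degree:
  assumes "d \<le> mdeg m"
  shows "\<exists>n. mono_le n m \<and> mdeg n = d"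
proof (cases m)
  case (fields a b c)
  define a' where "a' = min a d"
  define b' where "b' = min b (d - a')"
  have "mono_le (a', b', d - a' - b') m" "mdeg (a', b', d - a' - b') = d"
    using assms by (auto simp: fields a'_def b'_def)
  then show ?thesis by blast
qed

section \<open>The prime ideal (x) and the codimension\<close>

lemma prime_x: "is_prime_ideal (ideal_gen (mon ` {(1, 0, 0)}) :: 'k::field poly3 set)" (is "is_prime_ideal ?P")
proof -
  have P: "f \<in> ?P \<longleftrightarrow> (\<forall>k\<in>keys f. fst k \<noteq> 0)" for f
  proof -
    have "mono_le (1, 0, 0) k \<longleftrightarrow> fst k \<noteq> 0" for k by (cases k) auto
    then show ?thesis unfolding mem_monomial_span_iff by simp
  qed
  \<comment> \<open>The exponents (p1, p2) belong to the leading monomial of \<open>f\<close> modulo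
    x, for the lex order on monomials in y and z. Leading terms multiply, which gives
    primality.\<close>
  have lead: "\<exists>p1 p2. (0, p1, p2) \<in> keys f \<and>
      (\<forall>k1 k2. (0, k1, k2) \<in> keys f \<longrightarrow> k1 < p1 \<or> k1 = p1 \<and> k2 \<le> p2)"
    if f: "f \<notin> ?P" for f :: "'k poly3"
  proof -
    define X where "X = {(k1, k2). (0, k1, k2) \<in> keys f}"
    have "finite ((\<lambda>(k1, k2). (0 :: nat, k1, k2)) ` X)"
      by (rule finite_subset[of _ "keys f"]) (auto simp: X_def)
    then have fin: "finite X" by (rule finite_imageD) (auto simp: inj_on_def)
    obtain k where "k \<in> keys f" "fst k = 0" using f unfolding P by blast
    then have ne: "X \<noteq> {}" unfolding X_def by (cases k) auto
    define p1 where "p1 = Max (fst ` X)"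
    have p1: "p1 \<in> fst ` X" "\<And>k. k \<in> X \<Longrightarrow> fst k \<le> p1" unfolding p1_def using fin ne by auto
    define Y where "Y = {k2. (p1, k2) \<in> X}"
    have finY: "finite Y"
      by (rule finite_subset[of _ "snd ` X"]) (use fin in \<open>force simp: Y_def\<close>)+
    have neY: "Y \<noteq> {}" using p1(1) by (force simp: Y_def)
    define p2 where "p2 = Max Y"
    have p2: "p2 \<in> Y" "\<And>k. k \<in> Y \<Longrightarrow> k \<le> p2" unfolding p2_def using finY neY by auto
    have "k1 < p1 \<or> k1 = p1 \<and> k2 \<le> p2" if "(0, k1, k2) \<in> keys f" for k1 k2
      using p1(2)[of "(k1, k2)"] p2(2)[of k2] that by (auto simp: X_def Y_def)
    moreover have "(0, p1, p2) \<in> keys f" using p2(1) by (simp add: Y_def X_def)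
    ultimately show ?thesis by blast
  qed
  have "a * b \<notin> ?P" if ab: "a \<notin> ?P" "b \<notin> ?P" for a b
  proof -
    obtain p1 p2 where p: "(0, p1, p2) \<in> keys a"
        "\<And>k1 k2. (0, k1, k2) \<in> keys a \<Longrightarrow> k1 < p1 \<or> k1 = p1 \<and> k2 \<le> p2"
      using lead[OF ab(1)] by blast
    obtain q1 q2 where q: "(0, q1, q2) \<in> keys b"
        "\<And>k1 k2. (0, k1, k2) \<in> keys b \<Longrightarrow> k1 < q1 \<or> k1 = q1 \<and> k2 \<le> q2"
      using lead[OF ab(2)] by blast
    let ?p = "(0, p1, p2)" and ?q = "(0, q1, q2)"
    define a' where "a' = a - single ?p (lookup a ?p)"
    have a': "k \<in> keys a \<and> k \<noteq> ?p" if "k \<in> keys a'" for k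
      using that unfolding in_keys_iff a'_def by (auto simp: lookup_minus lookup_single when_def split: if_splits)
    \<comment> \<open>No other pair of terms reaches the product of the leading monomials: both
      factors would be at most leading in the first exponent, hence equal there, and then also in
      the second.\<close>
    have "lookup (a' * b) (?p + ?q) = 0"
    proof (rule ccontr)
      assume "lookup (a' * b) (?p + ?q) \<noteq> 0"
      then have "?p + ?q \<in> keys (a' * b)" unfolding in_keys_iff .
      then obtain k l where kl: "?p + ?q = k + l" "k \<in> keys a'" "l \<in> keys b"
        using keys_mult[of a' b] by blast
      obtain k0 k1 k2 where e1: "k = (k0, k1, k2)" by (rule prod_cases3)
      obtain l0 l1 l2 where e2: "l = (l0, l1, l2)" by (rule prod_cases3)
      note e = e1 e2
      have z: "k0 = 0" "l0 = 0" "p1 + q1 = k1 + l1" "p2 + q2 = k2 + l2" using kl(1) by (simp_all add: e)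
      have "k1 < p1 \<or> k1 = p1 \<and> k2 \<le> p2" "l1 < q1 \<or> l1 = q1 \<and> l2 \<le> q2" "k \<noteq> ?p"
        using p(2) q(2) a'[OF kl(2)] kl(3) e z by blast+
      with z e show False by auto
    qed
    moreover have "a * b = single ?p (lookup a ?p) * b + a' * b"
      by (simp add: a'_def algebra_simps)
    ultimately have "lookup (a * b) (?p + ?q) = lookup a ?p * lookup b ?q"
      using lookup_single_mult[of ?p "lookup a ?p" b ?q] by (simp add: lookup_add)
    also have "\<dots> \<noteq> 0" using p(1) q(1) by (simp add: in_keys_iff)
    finally have "?p + ?q \<in> keys (a * b)" by (simp add: in_keys_iff)
    then show ?thesis unfolding P by (metis add_0 fst_add fst_conv)
  qed
  moreover have "?P \<noteq> UNIV"
  proof -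
    have "mon 0 \<notin> ?P" unfolding P by simp
    then show ?thesis by blast
  qed
  ultimately show ?thesis
    unfolding is_prime_ideal_def using module.subspace_span[OF module_self] by blast
qed

text \<open>A prime strictly inside (x) does not contain x, so x can be divided out of its elements
  forever, and only 0 allows that. A chain of length 2 ending in (x) would thus contain {0}
  twice.\<close>

lemma prime_height_x: "prime_height (ideal_gen (mon ` {(1, 0, 0)}) :: 'k::field poly3 set) \<le> 1" (is "prime_height ?P \<le> 1")
proof -
  have zero: "Q = {0}" if Q: "is_prime_ideal Q" "Q \<subset> ?P" for Q :: "'k poly3 set"
  proof -
    have sub: "is_ideal Q" using Q by (simp add: is_prime_ideal_def)
    have x: "mon (1, 0, 0) \<notin> Q"
    proof
      assume "mon (1, 0, 0) \<in> Q"
      then have "?P \<subseteq> Q" using module.span_minimal[OF module_self _ sub] by simp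
      with Q(2) show False by blast
    qed
    have deep: "f \<in> Q \<Longrightarrow> k \<in> keys f \<Longrightarrow> n \<le> fst k" for f k n
    proof (induction n arbitrary: f k)
      case (Suc n)
      have "\<forall>k\<in>keys f. mono_le (1, 0, 0) k"
        using Suc.prems(1) Q(2) unfolding psubset_eq subset_iff mem_monomial_span_iff by blast
      then obtain h where h: "f = mon (1, 0, 0) * h" using mem_principal_monomial by blast
      with Suc.prems(1) Q(1) x have "h \<in> Q" unfolding is_prime_ideal_def by blast
      moreover obtain l where "k = (1, 0, 0) + l" "l \<in> keys h"
        using Suc.prems(2) unfolding h keys_mon_mult by blast
      ultimately show ?case using Suc.IH[of h l] by simp
    qed simp
    have "f = 0" if "f \<in> Q" for f
    proof (rule ccontr)
      assume "f \<noteq> 0"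
      then obtain k where "k \<in> keys f"
        by (metis poly_mapping_eqI lookup_zero in_keys_iff)
      with deep[OF that this, of "Suc (fst k)"] show False by simp
    qed
    moreover have "0 \<in> Q" using module.subspace_0[OF module_self sub] .
    ultimately show ?thesis by blast
  qed
  have "n \<le> 1" if Q: "\<forall>i\<le>n. is_prime_ideal (Q i)" "\<forall>i<n. Q i \<subset> Q (Suc i)" "Q n = ?P"
    for n and Q :: "nat \<Rightarrow> 'k poly3 set"
  proof (rule ccontr)
    assume "\<not> n \<le> 1"
    then obtain m where n: "n = Suc (Suc m)" by (cases n; cases "n - 1") auto
    have "Q (Suc m) \<subset> ?P" "Q m \<subset> Q (Suc m)" using Q n by auto
    moreover have "is_prime_ideal (Q (Suc m))" "is_prime_ideal (Q m)" using Q(1) n by auto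
    ultimately have "Q (Suc m) = {0}" "Q m = {0}" using zero by blast+
    with \<open>Q m \<subset> Q (Suc m)\<close> show False by simp
  qed
  then show ?thesis
    unfolding prime_height_def by (intro Sup_least) (auto simp: one_enat_def)
qed

text \<open>Exchanging z for y turns an x-free monomial of \<open>I\<close> into a power of y.
  Without such powers \<open>I\<close> would lie in (x), whose height is at most 1.\<close>

lemma codim_3_imp_y_power:
  assumes I: "stable_ideal (I :: 'k::field poly3 set)" and "codim I = 3"
  shows "\<exists>A. mon (0, A, 0) \<in> I"
proof (rule ccontr)
  assume no: "\<not> ?thesis"
  have M: "monomial_ideal I" using I by (simp add: stable_ideal_def)
  have "mon (0, b, c) \<notin> I" for b c
  proof (induction c arbitrary: b)
    case (Suc c)
    then show ?case using I unfolding stable_ideal_def by blast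
  qed (use no in blast)
  then have "mono_le (1, 0, 0) k" if "mon k \<in> I" for k
    using that by (cases k; cases "fst k") auto
  then have "f \<in> ideal_gen (mon ` {(1, 0, 0)})" if "f \<in> I" for f
    using that monomial_ideal_mem_iff[OF M, of f] unfolding mem_monomial_span_iff by blast
  then have "I \<subseteq> ideal_gen (mon ` {(1, 0, 0)})" by blast
  with prime_x have "codim I \<le> prime_height (ideal_gen (mon ` {(1, 0, 0)}) :: 'k poly3 set)"
    unfolding codim_def by (intro Inf_lower) blast
  also have "\<dots> \<le> 1" by (rule prime_height_x)
  finally show False using assms(2) by (simp add: one_enat_def numeral_eq_enat)
qed

section \<open>The colon ideal of a lex-segment ideal\<close>

text \<open>The predicate sees only the y- and z-exponents, which g and x g share, so the counts for
  \<aa> and L can be compared for all predicates at once.\<close>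

definition gen_count :: "mono3 set \<Rightarrow> (nat \<times> nat \<Rightarrow> bool) \<Rightarrow> nat \<Rightarrow> rat" where
  "gen_count G P e = of_nat (card {g \<in> G. P (snd g) \<and> mdeg g = e})"

lemma gen_count_nonneg: "gen_count G P e \<ge> 0"
  by (simp add: gen_count_def)

lemma gen_count_nonzeroD:
  assumes "gen_count G P e \<noteq> 0"
  shows "\<exists>g\<in>G. P (snd g) \<and> mdeg g = e"
proof -
  have "{g \<in> G. P (snd g) \<and> mdeg g = e} \<noteq> {}"
    using assms unfolding gen_count_def by (metis card.empty of_nat_0)
  then show ?thesis by blast
qed

lemma sum_gen_count:
  assumes "finite G" "\<And>g. g \<in> G \<Longrightarrow> mdeg g \<le> N"
  shows "(\<Sum>e\<le>N. h e * gen_count G P e) = (\<Sum>g\<in>{g \<in> G. P (snd g)}. h (mdeg g))"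
proof -
  let ?S = "{g \<in> G. P (snd g)}"
  have "(\<Sum>g\<in>?S. h (mdeg g)) = (\<Sum>e\<le>N. \<Sum>g\<in>{g \<in> ?S. mdeg g = e}. h (mdeg g))"
    using assms by (intro sum.group[symmetric]) auto
  also have "\<dots> = (\<Sum>e\<le>N. h e * gen_count G P e)"
  proof (intro sum.cong refl)
    fix e
    have "{g \<in> ?S. mdeg g = e} = {g \<in> G. P (snd g) \<and> mdeg g = e}" by blast
    then show "(\<Sum>g\<in>{g \<in> ?S. mdeg g = e}. h (mdeg g)) = h e * gen_count G P e"
      by (simp add: gen_count_def)
  qed
  finally show ?thesis ..
qed

context stable_xy
begin

lemma betti_0: "betti I 0 e = gen_count (min_gens I) (\<lambda>_. True) e"
  using betti_formula(1)[of e] by (simp add: gen_count_def)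

lemma betti_1: "betti I 1 j = (case j of 0 \<Rightarrow> 0 | Suc e \<Rightarrow>
    gen_count (min_gens I) (\<lambda>s. s \<noteq> (0, 0)) e + gen_count (min_gens I) (\<lambda>s. 0 < snd s) e)"
proof (cases j)
  case (Suc e)
  have "{g \<in> non_x_power (min_gens I). mdeg g + 1 = Suc e} = {g \<in> min_gens I. snd g \<noteq> (0, 0) \<and> mdeg g = e}"
    "{g \<in> z_divisible (min_gens I). mdeg g + 1 = Suc e} = {g \<in> min_gens I. 0 < snd (snd g) \<and> mdeg g = e}"
    by auto
  then show ?thesis unfolding betti_formula(2) gen_count_def Suc by simp
qed (simp add: betti_formula(2)[unfolded One_nat_def])

lemma betti_2: "betti I 2 j = (case j of Suc (Suc e) \<Rightarrow> gen_count (min_gens I) (\<lambda>s. 0 < snd s) e | _ \<Rightarrow> 0)"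
proof -
  consider "j < 2" | e where "j = Suc (Suc e)"
    by (metis One_nat_def Suc_1 less_2_cases_iff not0_implies_Suc)
  then show ?thesis
  proof cases
    case 1
    then have "{g \<in> z_divisible (min_gens I). mdeg g + 2 = j} = {}" by auto
    with 1 show ?thesis unfolding betti_formula(3) by (auto split: nat.split)
  next
    case 2
    have "{g \<in> z_divisible (min_gens I). mdeg g + 2 = j} = {g \<in> min_gens I. 0 < snd (snd g) \<and> mdeg g = e}"
      using 2 by auto
    then show ?thesis unfolding betti_formula(3) gen_count_def by (simp add: 2)
  qed
qed

lemma betti_3: "3 \<le> i \<Longrightarrow> betti I i j = 0"
  by (rule betti_formula(4))

text \<open>Let X be the generators other than the power of x, and Z those divisible by z. Weight 1
  leaves |G| - |X| = 1; the degree as weight leaves q - |X| + |Z|, which is 0 because X - Z has q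
  elements.\<close>

lemma euler_sum_betti:
  assumes N: "\<And>g. g \<in> min_gens I \<Longrightarrow> mdeg g \<le> N"
  shows "euler_sum N (\<lambda>_. 1) (betti I) = 1" "euler_sum N of_nat (betti I) = 0"
proof -
  let ?G = "min_gens I" and ?S = "\<lambda>e. rat_of_nat (Suc e)"
  let ?X = "non_x_power ?G" and ?Z = "z_divisible ?G"
  have fin: "finite ?X" "finite ?Z" using finite_min_gens by auto
  have *: "euler_sum N f (betti I) = (\<Sum>g\<in>?G. f (mdeg g)) - (\<Sum>g\<in>?X. f (Suc (mdeg g)))
      - (\<Sum>g\<in>?Z. f (Suc (mdeg g))) + (\<Sum>g\<in>?Z. f (Suc (Suc (mdeg g))))" for f
  proof -
    have "euler_sum N f (betti I) = (\<Sum>e\<le>N. f e * gen_count ?G (\<lambda>_. True) e)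
        - (\<Sum>e\<le>N. f (Suc e) * gen_count ?G (\<lambda>s. s \<noteq> (0, 0)) e)
        - (\<Sum>e\<le>N. f (Suc e) * gen_count ?G (\<lambda>s. 0 < snd s) e)
        + (\<Sum>e\<le>N. f (Suc (Suc e)) * gen_count ?G (\<lambda>s. 0 < snd s) e)"
      unfolding euler_sum_def betti_0 betti_1 betti_2 sum_subtractf[symmetric] sum.distrib[symmetric]
      by (intro sum.cong refl) (simp add: algebra_simps)
    also have "\<dots> = (\<Sum>g\<in>{g \<in> ?G. True}. f (mdeg g)) - (\<Sum>g\<in>?X. f (Suc (mdeg g)))
      - (\<Sum>g\<in>?Z. f (Suc (mdeg g))) + (\<Sum>g\<in>?Z. f (Suc (Suc (mdeg g))))"
      by (simp only: sum_gen_count[OF finite_min_gens N, where h = "\<lambda>e. f e"]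
          sum_gen_count[OF finite_min_gens N, where h = "\<lambda>e. f (Suc e)"]
          sum_gen_count[OF finite_min_gens N, where h = "\<lambda>e. f (Suc (Suc e))"])
    finally show ?thesis by simp
  qed
  have G: "?G = insert (q, 0, 0) ?X" "(q, 0, 0) \<notin> ?X" using x_power_gens by auto
  have ZX: "?Z \<subseteq> ?X" by auto
  have "card (?X - ?Z) = q" using bij_betw_same_card[OF y_gens_bij] by simp
  then have c: "rat_of_nat (card ?X) = of_nat q + of_nat (card ?Z)"
    using card_Diff_subset[OF fin(2) ZX] card_mono[OF fin(1) ZX] by (simp add: of_nat_diff)
  have sumG: "(\<Sum>g\<in>?G. f (mdeg g)) = f q + (\<Sum>g\<in>?X. f (mdeg g))" for f :: "nat \<Rightarrow> rat"
  proof -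
    have "(\<Sum>g\<in>?G. f (mdeg g)) = (\<Sum>g\<in>insert (q, 0, 0) ?X. f (mdeg g))"
      using G(1) by (rule arg_cong)
    also have "\<dots> = f (mdeg (q, 0, 0)) + (\<Sum>g\<in>?X. f (mdeg g))"
      using fin(1) G(2) by (rule sum.insert)
    finally show ?thesis by simp
  qed
  show "euler_sum N (\<lambda>_. 1) (betti I) = 1"
    unfolding * using sumG[of "\<lambda>_. 1"] by simp
  show "euler_sum N of_nat (betti I) = 0"
    unfolding * using sumG[of of_nat] c by (simp add: sum.distrib)
qed

end

text \<open>The pair (c, d) selects the variable, so powers of x and of y are treated
  together.\<close>

lemma least_power_min_gen:
  assumes "monomial_ideal (I :: 'k::field poly3 set)"
    and c: "mon (c * n, d * n, 0) \<in> I" "(c, d) = (1, 0) \<or> (c, d) = (0, 1)"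
  shows "\<exists>m. (c * m, d * m, 0) \<in> min_gens I"
proof -
  define m where "m = (LEAST m. mon (c * m, d * m, 0) \<in> I)"
  have m: "mon (c * m, d * m, 0) \<in> I" unfolding m_def using c(1) by (rule LeastI)
  have low: "m \<le> m'" if "mon (c * m', d * m', 0) \<in> I" for m'
    unfolding m_def using that by (rule Least_le)
  have "n = (c * m, d * m, 0)" if n: "mon n \<in> I" "mono_le n (c * m, d * m, 0)" for n
  proof -
    obtain n1 n2 n3 where e: "n = (n1, n2, n3)" by (rule prod_cases3)
    show ?thesis
      using c(2) low[of n1] low[of n2] n by (auto simp: e)
  qed
  with m show ?thesis unfolding min_gens_iff by blast
qed

section \<open>The colon ideal by x\<close>

lemma colon_x_mem_iff:
  assumes "monomial_ideal (I :: 'k::field poly3 set)"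
  shows "f \<in> colon_ideal I (ideal_gen {var_x}) \<longleftrightarrow> mon (1, 0, 0) * f \<in> I"
proof -
  obtain S where S: "I = ideal_gen (mon ` S)" using assms unfolding monomial_ideal_def by blast
  have span: "s \<in> ideal_gen {var_x} \<longleftrightarrow> (\<exists>c. s = c * var_x)" for s :: "'k poly3"
    unfolding module.span_insert[OF module_self] module.span_empty[OF module_self] by simp
  show ?thesis
  proof
    assume "f \<in> colon_ideal I (ideal_gen {var_x})"
    moreover have "var_x \<in> ideal_gen {var_x :: 'k poly3}"
      by (rule module.span_base[OF module_self]) simp
    ultimately show "mon (1, 0, 0) * f \<in> I"
      unfolding colon_ideal_def by (auto simp: var_x_def mult.commute)
  next
    assume "mon (1, 0, 0) * f \<in> I"
    then have scaled: "c * (mon (1, 0, 0) * f) \<in> I" for c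
      unfolding S by (rule module.span_scale[OF module_self])
    have "f * s \<in> I" if "s \<in> ideal_gen {var_x}" for s
    proof -
      obtain c where "s = c * var_x" using \<open>s \<in> _\<close> unfolding span by blast
      with scaled[of c] show ?thesis by (simp add: var_x_def ac_simps)
    qed
    then show "f \<in> colon_ideal I (ideal_gen {var_x})"
      unfolding colon_ideal_def by blast
  qed
qed

lemma colon_x_mon_iff:
  assumes "monomial_ideal (I :: 'k::field poly3 set)"
  shows "mon (a, b, c) \<in> colon_ideal I (ideal_gen {var_x}) \<longleftrightarrow> mon (Suc a, b, c) \<in> I"
  by (simp add: colon_x_mem_iff[OF assms] mon_mult)

lemma colon_x_stable:
  assumes "stable_ideal (I :: 'k::field poly3 set)"
  shows "stable_ideal (colon_ideal I (ideal_gen {var_x}))" (is "stable_ideal ?J")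
proof -
  have M: "monomial_ideal I" using assms by (simp add: stable_ideal_def)
  have mem: "f \<in> ?J \<longleftrightarrow> (\<forall>k\<in>keys f. mon ((1, 0, 0) + k) \<in> I)" for f
    unfolding colon_x_mem_iff[OF M] monomial_ideal_mem_iff[OF M, of "mon (1, 0, 0) * f"] keys_mon_mult by blast
  define S where "S = {m. mon ((1, 0, 0) + m) \<in> I}"
  have "?J = ideal_gen (mon ` S)"
  proof (rule Set.set_eqI)
    fix f
    have "(\<exists>s\<in>S. mono_le s k) \<longleftrightarrow> mon ((1, 0, 0) + k) \<in> I" for k
    proof
      assume "\<exists>s\<in>S. mono_le s k"
      then obtain s where "mon ((1, 0, 0) + s) \<in> I" "mono_le ((1, 0, 0) + s) ((1, 0, 0) + k)"
        unfolding S_def mono_le_def by (metis add.assoc mem_Collect_eq)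
      then show "mon ((1, 0, 0) + k) \<in> I" by (rule monomial_ideal_upward[OF M])
    next
      assume "mon ((1, 0, 0) + k) \<in> I"
      then have "k \<in> S" by (simp add: S_def)
      then show "\<exists>s\<in>S. mono_le s k" using mono_le_refl by blast
    qed
    then show "f \<in> ?J \<longleftrightarrow> f \<in> ideal_gen (mon ` S)"
      unfolding mem mem_monomial_span_iff by blast
  qed
  then have "monomial_ideal ?J" unfolding monomial_ideal_def by blast
  then show ?thesis
    using assms unfolding stable_ideal_def colon_x_mon_iff[OF M] by blast
qed

theorem theorem1p1:
  fixes L \<aa> :: "'k::field poly3 set"
    and t :: nat and \<alpha> :: "nat \<Rightarrow> rat" and d :: "nat \<Rightarrow> nat list"
    and R\<^sub>\<aa> :: "(rat \<times> nat list) list"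
  assumes "lex_segment_ideal L"
    and "codim L = 3"
    and "\<aa> = colon_ideal L (ideal_gen {var_x})"
    and "\<aa> \<noteq> UNIV"
    and "bs_decomposition (betti \<aa>) (map (\<lambda>i. (\<alpha> i, d i)) [0..<Suc t] @ R\<^sub>\<aa>)"
    and "\<forall>i\<le>t. length (d i) = 3"
    and "\<forall>(c, e)\<in>set R\<^sub>\<aa>. length e \<noteq> 3"
  shows "\<exists>(\<alpha>' :: nat \<Rightarrow> rat) (R\<^sub>L :: (rat \<times> nat list) list).
    bs_decomposition (betti L) (map (\<lambda>i. (\<alpha>' i, map Suc (d i))) [0..<Suc t] @ R\<^sub>L) \<and>
    (\<forall>i<t. \<alpha>' i = \<alpha> i) \<and>
    \<alpha>' t \<ge> \<alpha> t \<and>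
    (\<forall>(c, e)\<in>set R\<^sub>L. deg_seq_less (map Suc (d t)) e)"
proof -
  have stable: "stable_ideal L" using assms(1) by (rule lex_segment_imp_stable)
  then have M: "monomial_ideal L" by (simp add: stable_ideal_def)
  have lex: "\<And>m n. n \<in> min_gens L \<Longrightarrow> mdeg m = mdeg n \<Longrightarrow> glex_greater m n \<Longrightarrow> mon m \<in> L"
    using assms(1) unfolding lex_segment_ideal_def by blast
  have stable_a: "stable_ideal \<aa>" unfolding assms(3) using stable by (rule colon_x_stable)
  have Ma: "monomial_ideal \<aa>" using stable_a by (simp add: stable_ideal_def)
  have a_mon: "mon (a, b, c) \<in> \<aa> \<longleftrightarrow> mon (Suc a, b, c) \<in> L" for a b c
    unfolding assms(3) by (rule colon_x_mon_iff[OF M])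
  have L_a: "mon m \<in> \<aa>" if "mon m \<in> L" for m
  proof (cases m)
    case (fields a b c)
    with monomial_ideal_upward[OF M that, of "(Suc a, b, c)"] show ?thesis by (simp add: a_mon)
  qed
  obtain A where A: "(0, A, 0) \<in> min_gens L"
    using codim_3_imp_y_power[OF stable assms(2)] least_power_min_gen[OF M, of 0 _ 1] by auto
  \<comment> \<open>Exchanging every y for x shows that L, and with it \<aa>, contains a power of
    x.\<close>
  have "mon (a, b, 0) \<in> L \<Longrightarrow> mon (a + b, 0, 0) \<in> L" for a b
  proof (induction b arbitrary: a)
    case (Suc b)
    then have "mon (Suc a, b, 0) \<in> L" using stable unfolding stable_ideal_def by blast
    with Suc.IH[of "Suc a"] show ?case by simp
  qed simp
  from this[of 0 A] have xA: "mon (A, 0, 0) \<in> L" using min_gens_mem[OF A] by simp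
  obtain q where q: "(q, 0, 0) \<in> min_gens L"
    using least_power_min_gen[OF M, of 1 A 0] xA by auto
  obtain q' where q': "(q', 0, 0) \<in> min_gens \<aa>"
    using least_power_min_gen[OF Ma, of 1 A 0] L_a[OF xA] by auto
  interpret L: stable_xy L q A
    using stable q min_gens_mem[OF A] by unfold_locales
  interpret a: stable_xy \<aa> q' A
    using stable_a q' L_a[OF min_gens_mem[OF A]] by unfold_locales
  \<comment> \<open>This is where \<aa> \<noteq> R enters: for A = 0 the unit would lie in L and
    hence in \<aa>.\<close>
  have "A \<noteq> 0"
  proof
    assume "A = 0"
    then have "mon (0, 0, 0) \<in> \<aa>" using L_a[OF min_gens_mem[OF A]] by simp
    then have "f \<in> \<aa>" for f
      unfolding monomial_ideal_mem_iff[OF Ma, of f]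
      by (metis monomial_ideal_upward[OF Ma] mono_le_iff prod_cases3 le0)
    with assms(4) show False by blast
  qed
  \<comment> \<open>Exchange every z for y and use that y^A is the least power of y in L.\<close>
  have x_free_deg: "A \<le> b + c" if "mon (0, b, c) \<in> L" for b c
  proof -
    have "mon (0, b, c) \<in> L \<Longrightarrow> mon (0, b + c, 0) \<in> L" for b
    proof (induction c arbitrary: b)
      case (Suc c)
      then have "mon (0, Suc b, c) \<in> L" using L.shift_zy by blast
      with Suc.IH[of "Suc b"] show ?case by simp
    qed simp
    with that have "mon (0, b + c, 0) \<in> L" by blast
    with A show ?thesis unfolding min_gens_iff by (metis mono_le_iff nat_le_linear le0 prod.inject)
  qed
  \<comment> \<open>A divisor m of g of degree A - 1 would give x m the degree of the generator y^A,
    and x m is lex-greater. So m would lie in \<aa>, against the minimality of g.\<close>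
  have a_deg: "mdeg g < A" if g: "g \<in> min_gens \<aa>" for g
  proof (rule ccontr)
    assume "\<not> mdeg g < A"
    then have "A - 1 \<le> mdeg g" by linarith
    then obtain m where m: "mono_le m g" "mdeg m = A - 1"
      using exists_divisor_of_degree by blast
    obtain a b c where e: "m = (a, b, c)" by (rule prod_cases3)
    have "mon (Suc a, b, c) \<in> L"
      using m(2) \<open>A \<noteq> 0\<close> by (intro lex[OF A]) (auto simp: e)
    then have "mon m \<in> \<aa>" by (simp add: e a_mon)
    with m(1) g have "m = g" unfolding min_gens_iff by blast
    with m(2) \<open>\<not> mdeg g < A\<close> \<open>A \<noteq> 0\<close> show False by simp
  qed
  have gens: "(Suc a, b, c) \<in> min_gens L \<longleftrightarrow> (a, b, c) \<in> min_gens \<aa>" for a b c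
  proof
    assume g: "(Suc a, b, c) \<in> min_gens L"
    show "(a, b, c) \<in> min_gens \<aa>"
      unfolding min_gens_iff
    proof (intro conjI allI impI)
      show "mon (a, b, c) \<in> \<aa>" using min_gens_mem[OF g] by (simp add: a_mon)
      fix n assume n: "mon n \<in> \<aa> \<and> mono_le n (a, b, c)"
      obtain n1 n2 n3 where e: "n = (n1, n2, n3)" by (rule prod_cases3)
      with n have "mon (Suc n1, n2, n3) \<in> L" "mono_le (Suc n1, n2, n3) (Suc a, b, c)" by (auto simp: a_mon)
      with g have "(Suc n1, n2, n3) = (Suc a, b, c)" unfolding min_gens_iff by blast
      then show "n = (a, b, c)" by (simp add: e)
    qed
  next
    assume g: "(a, b, c) \<in> min_gens \<aa>"
    show "(Suc a, b, c) \<in> min_gens L"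
      unfolding min_gens_iff
    proof (intro conjI allI impI)
      show "mon (Suc a, b, c) \<in> L" using min_gens_mem[OF g] by (simp add: a_mon)
      fix n assume n: "mon n \<in> L \<and> mono_le n (Suc a, b, c)"
      obtain n1 n2 n3 where e: "n = (n1, n2, n3)" by (rule prod_cases3)
      show "n = (Suc a, b, c)"
      proof (cases n1)
        \<comment> \<open>An x-free divisor has degree at least A, more than the degree of the
          generator of \<aa> can accommodate.\<close>
        case 0
        with n have "A \<le> n2 + n3" "n2 \<le> b" "n3 \<le> c" using x_free_deg by (auto simp: e)
        with a_deg[OF g] show ?thesis by simp
      next
        case (Suc n1')
        with n have "mon (n1', n2, n3) \<in> \<aa>" "mono_le (n1', n2, n3) (a, b, c)" by (auto simp: a_mon e)
        with g have "(n1', n2, n3) = (a, b, c)" unfolding min_gens_iff by blast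
        with Suc show ?thesis by (simp add: e)
      qed
    qed
  qed
  \<comment> \<open>These are the generators of J; all but y^A are divisible by z and are counted by
    \<open>n\<close>.\<close>
  define G\<^sub>0 where "G\<^sub>0 = {g \<in> min_gens L. fst g = 0}"
  define n where "n = gen_count G\<^sub>0 (\<lambda>s. 0 < snd s)"
  have fin0: "finite G\<^sub>0" using L.finite_min_gens by (simp add: G\<^sub>0_def)
  have count: "gen_count (min_gens L) P e =
      (case e of 0 \<Rightarrow> 0 | Suc e' \<Rightarrow> gen_count (min_gens \<aa>) P e') + gen_count G\<^sub>0 P e" for P e
  proof -
    let ?U = "{g \<in> min_gens L. P (snd g) \<and> mdeg g = e}"
    let ?V = "{g \<in> min_gens \<aa>. P (snd g) \<and> Suc (mdeg g) = e}"
    let ?W = "{g \<in> G\<^sub>0. P (snd g) \<and> mdeg g = e}"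
    let ?s = "\<lambda>(a, b, c). (Suc a, b, c) :: mono3"
    have "?U = ?s ` ?V \<union> ?W"
    proof (rule subset_antisym; rule subsetI)
      fix g assume g: "g \<in> ?U"
      obtain a b c where e: "g = (a, b, c)" by (rule prod_cases3)
      show "g \<in> ?s ` ?V \<union> ?W"
      proof (cases a)
        case 0
        with g show ?thesis by (simp add: e G\<^sub>0_def)
      next
        case (Suc a')
        with g have "(a', b, c) \<in> ?V" by (auto simp: e gens)
        then show ?thesis using Suc by (force simp: e)
      qed
    qed (auto simp: gens G\<^sub>0_def)
    moreover have "?s ` ?V \<inter> ?W = {}" by (auto simp: G\<^sub>0_def)
    moreover have "finite ?V" "finite ?W" using a.finite_min_gens fin0 by auto
    ultimately have "card ?U = card (?s ` ?V) + card ?W" by (simp add: card_Un_disjoint)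
    also have "card (?s ` ?V) = card ?V" by (rule card_image) (auto simp: inj_on_def)
    finally show ?thesis by (cases e) (simp_all add: gen_count_def)
  qed
  have y_gen: "b = A" if "(0, b, 0) \<in> min_gens L" for b
    using min_gens_antichain[OF that A] min_gens_antichain[OF A that] by (cases "b \<le> A") auto
  \<comment> \<open>Covers the predicates for columns 0 and 1; y^A satisfies the second one because
    A \<noteq> 0.\<close>
  have n_split: "gen_count G\<^sub>0 P e = (if e = A then 1 else 0) + n e"
    if P: "P (A, 0)" "\<And>b c. 0 < c \<Longrightarrow> P (b, c)" for P e
  proof -
    let ?W = "{g \<in> G\<^sub>0. 0 < snd (snd g) \<and> mdeg g = e}"
    have "{g \<in> G\<^sub>0. P (snd g) \<and> mdeg g = e} = (if e = A then {(0, A, 0)} else {}) \<union> ?W"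
    proof (rule subset_antisym; rule subsetI)
      fix g assume g: "g \<in> {g \<in> G\<^sub>0. P (snd g) \<and> mdeg g = e}"
      then obtain b c where "g = (0, b, c)" by (cases g) (auto simp: G\<^sub>0_def)
      with g y_gen show "g \<in> (if e = A then {(0, A, 0)} else {}) \<union> ?W"
        by (cases c) (auto simp: G\<^sub>0_def)
    next
      fix g assume "g \<in> (if e = A then {(0, A, 0)} else {}) \<union> ?W"
      with P A show "g \<in> {g \<in> G\<^sub>0. P (snd g) \<and> mdeg g = e}"
        by (cases g) (auto simp: G\<^sub>0_def split: if_splits)
    qed
    then show ?thesis using fin0 by (simp add: n_def gen_count_def)
  qed
  have n_True: "gen_count G\<^sub>0 (\<lambda>_. True) e = (if e = A then 1 else 0) + n e"
    and n_ne: "gen_count G\<^sub>0 (\<lambda>s. s \<noteq> (0, 0)) e = (if e = A then 1 else 0) + n e" for e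
    by (rule n_split; use \<open>A \<noteq> 0\<close> in simp)+
  define N where "N = Max (mdeg ` min_gens L)"
  have N: "mdeg g \<le> N" if "g \<in> min_gens L" for g
    unfolding N_def using that L.finite_min_gens by (intro Max_ge) auto
  \<comment> \<open>Taken as a difference, so that the splitting of \<beta>(L) holds by definition
    and the content lies in computing its columns.\<close>
  define E where "E i j = betti L i j - (case j of 0 \<Rightarrow> 0 | Suc j' \<Rightarrow> betti \<aa> i j')" for i j
  have "\<exists>\<alpha>' ys. pure_chain (betti L) (map (\<lambda>i. (\<alpha>' i, map Suc (d i))) [0..<Suc t] @ ys) \<and>
    (\<forall>i<t. \<alpha>' i = \<alpha> i) \<and> \<alpha> t \<le> \<alpha>' t \<and> (\<forall>(c, q)\<in>set ys. deg_seq_less (map Suc (d t)) q)"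
  proof (rule shifted_decomposition)
    show "pure_chain (betti \<aa>) (map (\<lambda>i. (\<alpha> i, d i)) [0..<Suc t] @ R\<^sub>\<aa>)"
      using assms(5) by (rule bs_decomposition_imp_pure_chain)
    show "i < 3 \<and> j < A + i" if "betti \<aa> i j \<noteq> 0" for i j
    proof -
      have low: "e < A" if "gen_count (min_gens \<aa>) P e \<noteq> 0" for P e
        using gen_count_nonzeroD[OF that] a_deg by blast
      have "i < 3" using a.betti_3[of i j] that by (meson not_le)
      then consider "i = 0" | "i = 1" | "i = 2" by linarith
      then show ?thesis
      proof cases
        case 1
        with that show ?thesis using low by (simp add: a.betti_0)
      next
        case 2
        from that[unfolded 2 a.betti_1] obtain e where "j = Suc e"
          "gen_count (min_gens \<aa>) (\<lambda>s. s \<noteq> (0, 0)) e \<noteq> 0 \<or> gen_count (min_gens \<aa>) (\<lambda>s. 0 < snd s) e \<noteq> 0"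
          by (cases j) auto
        then show ?thesis using 2 low by auto
      next
        case 3
        from that[unfolded 3 a.betti_2] obtain e where "j = Suc (Suc e)"
          "gen_count (min_gens \<aa>) (\<lambda>s. 0 < snd s) e \<noteq> 0"
          by (auto split: nat.splits)
        then show ?thesis using 3 low by auto
      qed
    qed
    show "E 0 e = (if e = A then 1 else 0) + n e" for e
      by (cases e) (simp_all add: E_def L.betti_0 a.betti_0 count n_True)
    show "E 1 j = (case j of 0 \<Rightarrow> 0 | Suc e \<Rightarrow> (if e = A then 1 else 0) + 2 * n e)" for j
      unfolding E_def L.betti_1 a.betti_1 count n_ne n_def[symmetric] by (simp split: nat.split)
    show "E 2 j = (case j of Suc (Suc e) \<Rightarrow> n e | _ \<Rightarrow> 0)" for j
      unfolding E_def L.betti_2 a.betti_2 count n_def[symmetric] by (simp split: nat.split)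
    show "E i j = 0" if "3 \<le> i" for i j
      using that by (simp add: E_def L.betti_3 a.betti_3 split: nat.split)
    show "n e \<ge> 0" for e unfolding n_def by (rule gen_count_nonneg)
    show "A \<le> e \<and> e \<le> N" if ne: "n e \<noteq> 0" for e
    proof -
      obtain g where g: "g \<in> G\<^sub>0" "mdeg g = e" using gen_count_nonzeroD[OF ne[unfolded n_def]] by blast
      obtain a b c where e: "g = (a, b, c)" by (rule prod_cases3)
      have "g \<in> min_gens L" "a = 0" using g(1) unfolding G\<^sub>0_def e by auto
      with N[of g] x_free_deg[of b c] min_gens_mem[of g L] g(2) show ?thesis by (simp add: e)
    qed
    show "A \<le> N" using N[OF A] by simp
    show "betti L i j = (case j of 0 \<Rightarrow> 0 | Suc j' \<Rightarrow> betti \<aa> i j') + E i j" for i j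
      by (simp add: E_def)
    show "euler_sum N (\<lambda>_. 1) (betti L) = 1" "euler_sum N of_nat (betti L) = 0"
      using L.euler_sum_betti[OF N] by blast+
  qed (use assms(6,7) in blast)+
  then show ?thesis using pure_chain_imp_bs_decomposition by blast
qed

end
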